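(* Let $\{\mathfrak{g}_\omega\}_{\omega\in\Omega}$ be a family of Riemannian metrics on $M$ satisfying conditions (i)--(iii) of the context, let $\overline{L}:\mathbb{R}^b\to\mathbb{R}$ be the effective Lagrangian associated with $L(x,v,\omega)=\mathfrak{g}_{\omega,x}(v,v)$, and define the stationary ergodic stable norm by $$\|h\|_{s,G}:=\overline{L}(h)^{1/2},\qquad h\in\mathbb{R}^b.$$ Then $\|\cdot\|_{s,G}$ is a norm on $\mathbb{R}^b$.
   Context: **Manifold and group.** $M$ is a smooth connected finite-dimensional manifold without boundary with a complete Riemannian metric; $|\cdot|_x$ denotes the induced norm on $T_xM$, and $d$ the Riemannian distance. $G$ is a finitely generated abelian group of rank $b$ acting on $M$ by isometries (of this fixed metric), and the action is free ($g(x)=x$ for some $x$ implies $g=e$), totally discontinuous (every $x\in M$ has a neighborhood $U$ with $g(U)\cap U=\emptyset$ for all $g$ with $g(x)\neq x$) and co-compact ($M/G$ is compact). An identification $G\simeq\mathbb{Z}^b\times\mathcal{T}$ with $\mathcal{T}$ a finite (torsion) group is fixed, and elements of $G$ are written $(h,k)$; $\mathbb{Z}^0=\mathbb{R}^0=\{0\}$. $\|\cdot\|$ is the Euclidean norm on $\mathbb{R}^b$. **Probability space.** $(\Omega,\mathcal{F},\mathbb{P})$ is a probability space with a dynamical system $\{\tau_g\}_{g\in G}$: maps $\tau_g:\Omega\to\Omega$ with $\tau_{gg'}=\tau_g\circ\tau_{g'}$, each measurable with $\mathbb{P}(\tau_gE)=\mathbb{P}(E)$ for all $E\in\mathcal{F}$,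 and $(g,\omega)\mapsto\tau_g\omega$ jointly measurable ($G$ carrying the Borel $\sigma$-algebra of its given topology). It is ergodic: if $E\in\mathcal{F}$ satisfies $\mathbb{P}(\tau_gE\,\Delta\,E)=0$ for all $g\in G$, then $\mathbb{P}(E)\in\{0,1\}$. **Conditions on the metrics** (Riemannian metrics are smooth). (i) $\omega\mapsto\mathfrak{g}_\omega(\cdot,\cdot)$ is a continuous random function, i.e. it is measurable from $\Omega$ into the space of continuous functions with the topology of uniform convergence on compact sets; (ii) there are convex nondecreasing superlinearly coercive functions $\vartheta,\Theta:[0,\infty)\to\mathbb{R}$ (superlinearly coercive: $f(r)/r\to\infty$ as $r\to\infty$) with $\vartheta(|v|_x)\le\mathfrak{g}_{\omega,x}(v,v)\le\Theta(|v|_x)$ for all $(x,v,\omega)\in TM\times\Omega$; (iii) $\mathfrak{g}_{\tau_g\omega,x}(v,v)=\mathfrak{g}_{\omega,g(x)}(\mathrm{d}g(v),\mathrm{d}g(v))$ for all $(x,v,\omega)\in TM\times\Omega$, $g\in G$. **Effective Lagrangian.** For $\varepsilon>0$ put $\phi_\varepsilon(x',x,t,\omega)=\inf\int_0^tL(\gamma,\varepsilon\dot\gamma,\omega)\,d\tau$ over absolutely continuous $\gamma:[0,t]\to M$ with $\gamma(0)=x'$, $\gamma(t)=x$. Maps $\Phi_\varepsilon:\mathbb{R}^b\to\mathbb{Z}^b$ are fixed with $\|\varepsilon\Phi_\varepsilon(h)-h\|\le C_\varepsilon$ for all $h\in\mathbb{R}^b$, where $C_\varepsilon\to0$ as $\varepsilon\to0^+$.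 The effective Lagrangian $\overline{L}:\mathbb{R}^b\to\mathbb{R}$ is the deterministic function such that, for all $\omega$ in a set of probability $1$ and all $x\in M$, $k\in\mathcal{T}$, $h\in\mathbb{R}^b$, $\lim_{\varepsilon\to0^+}\phi_\varepsilon((0,k)(x),(\Phi_\varepsilon(h),k)(x),1,\omega)=\overline{L}(h)$ (its existence is known in this setting). *)

theory Defs
  imports
    "HOL-Probability.Probability"
    "HOL-Algebra.Group_Action"
    "HOL-Algebra.Product_Groups"
begin

section \<open>Smooth manifolds\<close>

text \<open>A smooth manifold is a topological type \<^typ>\<open>'m\<close> with a (not necessarily maximal)
  smooth atlas. The model space is a finite-dimensional inner product space; it is not required to
  be of class \<^class>\<open>euclidean_space\<close>, which would exclude dimension \<open>0\<close>.\<close>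

type_synonym ('m, 'e) chart = "'m set \<times> ('m \<Rightarrow> 'e)"

abbreviation chart_inv :: "('m, 'e) chart \<Rightarrow> 'e \<Rightarrow> 'm" where
  "chart_inv c \<equiv> inv_into (fst c) (snd c)"

primrec Ck_on :: "nat \<Rightarrow> 'a::real_normed_vector set \<Rightarrow> ('a \<Rightarrow> 'b::real_normed_vector) \<Rightarrow> bool" where
  "Ck_on 0 S f \<longleftrightarrow> continuous_on S f"
| "Ck_on (Suc k) S f \<longleftrightarrow>
     (\<forall>p\<in>S. f differentiable (at p)) \<and> (\<forall>v. Ck_on k S (\<lambda>p. frechet_derivative f (at p) v))"

definition smooth_on :: "'a::real_normed_vector set \<Rightarrow> ('a \<Rightarrow> 'b::real_normed_vector) \<Rightarrow> bool" where
  "smooth_on S f \<longleftrightarrow> (\<forall>k. Ck_on k S f)"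

definition smooth_atlas ::
  "('m::{t2_space,second_countable_topology}, 'e::real_inner) chart set \<Rightarrow> bool" where
  "smooth_atlas A \<longleftrightarrow>
     (\<exists>B::'e set. finite B \<and> span B = UNIV) \<and>
     \<Union> (fst ` A) = UNIV \<and>
     (\<forall>c\<in>A. open (fst c) \<and> open (snd c ` fst c) \<and>
        homeomorphism (fst c) (snd c ` fst c) (snd c) (chart_inv c)) \<and>
     (\<forall>c\<in>A. \<forall>c'\<in>A. smooth_on (snd c ` (fst c \<inter> fst c')) (snd c' \<circ> chart_inv c))"

definition smooth_map :: "('m::topological_space, 'e::real_normed_vector) chart set \<Rightarrow> ('m \<Rightarrow> 'm) \<Rightarrow> bool" where
  "smooth_map A f \<longleftrightarrow> continuous_on UNIV f \<and>
     (\<forall>c\<in>A. \<forall>c'\<in>A. smooth_on (snd c ` (fst c \<inter> f -` fst c')) (snd c' \<circ> f \<circ> chart_inv c))"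

section \<open>Tangent vectors\<close>

text \<open>A tangent vector at \<open>x\<close> is the family of its coordinate vectors in all charts around \<open>x\<close>,
  related by the Jacobians of the chart changes. Entries of a family that do not belong to a chart
  of the atlas around \<open>x\<close> are \<open>0\<close>.\<close>

type_synonym ('m, 'e) tvec = "('m, 'e) chart \<Rightarrow> 'e"

definition tangent_space ::
  "('m, 'e::real_normed_vector) chart set \<Rightarrow> 'm \<Rightarrow> ('m, 'e) tvec set" where
  "tangent_space A x = {v.
     (\<forall>c. \<not> (c \<in> A \<and> x \<in> fst c) \<longrightarrow> v c = 0) \<and>
     (\<forall>c\<in>A. \<forall>c'\<in>A. x \<in> fst c \<inter> fst c' \<longrightarrow>
        v c' = frechet_derivative (snd c' \<circ> chart_inv c) (at (snd c x)) (v c))}"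

definition tvec_of :: "('m, 'e::real_normed_vector) chart set \<Rightarrow> ('m, 'e) chart \<Rightarrow> 'm \<Rightarrow> 'e \<Rightarrow> ('m, 'e) tvec" where
  "tvec_of A c x u = (\<lambda>c'. if c' \<in> A \<and> x \<in> fst c'
     then frechet_derivative (snd c' \<circ> chart_inv c) (at (snd c x)) u else 0)"

definition tangent_map ::
  "('m, 'e::real_normed_vector) chart set \<Rightarrow> ('m \<Rightarrow> 'm) \<Rightarrow> 'm \<Rightarrow> ('m, 'e) tvec \<Rightarrow> ('m, 'e) tvec" where
  "tangent_map A f x v = (let c = (SOME c. c \<in> A \<and> x \<in> fst c) in
     (\<lambda>c'. if c' \<in> A \<and> f x \<in> fst c'
        then frechet_derivative (snd c' \<circ> f \<circ> chart_inv c) (at (snd c x)) (v c) else 0))"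

definition velocity ::
  "('m, 'e::real_normed_vector) chart set \<Rightarrow> (real \<Rightarrow> 'm) \<Rightarrow> real \<Rightarrow> ('m, 'e) tvec" where
  "velocity A \<gamma> s = (\<lambda>c. if c \<in> A \<and> \<gamma> s \<in> fst c then vector_derivative (snd c \<circ> \<gamma>) (at s) else 0)"

text \<open>The total space of \<open>TM \<oplus> TM\<close>, with the topology for which the bundle charts are
  homeomorphisms onto open sets.\<close>

definition tangent_sum ::
  "('m, 'e::real_normed_vector) chart set \<Rightarrow> ('m \<times> ('m, 'e) tvec \<times> ('m, 'e) tvec) set" where
  "tangent_sum A = {(x, v, w). v \<in> tangent_space A x \<and> w \<in> tangent_space A x}"

definition tangent_sum_chart_image ::
  "('m, 'e::real_normed_vector) chart set \<Rightarrow> ('m, 'e) chart \<Rightarrow>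
   ('m \<times> ('m, 'e) tvec \<times> ('m, 'e) tvec) set \<Rightarrow> ('e \<times> 'e \<times> 'e) set" where
  "tangent_sum_chart_image A c W = {(p, u, u'). p \<in> snd c ` fst c \<and>
     (chart_inv c p, tvec_of A c (chart_inv c p) u, tvec_of A c (chart_inv c p) u') \<in> W}"

definition tangent_sum_topology ::
  "('m, 'e::real_normed_vector) chart set \<Rightarrow> ('m \<times> ('m, 'e) tvec \<times> ('m, 'e) tvec) topology" where
  "tangent_sum_topology A = topology (\<lambda>W. W \<subseteq> tangent_sum A \<and>
     (\<forall>c\<in>A. open (tangent_sum_chart_image A c W)))"

lemma openin_tangent_sum_topology:
  "openin (tangent_sum_topology A) W \<longleftrightarrow>
     W \<subseteq> tangent_sum A \<and> (\<forall>c\<in>A. open (tangent_sum_chart_image A c W))"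
proof -
  have int: "tangent_sum_chart_image A c (S \<inter> T) =
      tangent_sum_chart_image A c S \<inter> tangent_sum_chart_image A c T" for c S T
    by (auto simp: tangent_sum_chart_image_def)
  have un: "tangent_sum_chart_image A c (\<Union>K) = (\<Union>S\<in>K. tangent_sum_chart_image A c S)" for c K
    by (auto simp: tangent_sum_chart_image_def)
  have "istopology (\<lambda>W. W \<subseteq> tangent_sum A \<and> (\<forall>c\<in>A. open (tangent_sum_chart_image A c W)))"
    unfolding istopology_def by (auto simp: int un intro!: open_Int open_UN)
  then show ?thesis
    by (simp add: tangent_sum_topology_def topology_inverse')
qed

section \<open>Riemannian metrics\<close>

type_synonym ('m, 'e) metric = "'m \<Rightarrow> ('m, 'e) tvec \<Rightarrow> ('m, 'e) tvec \<Rightarrow> real"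

definition riemannian_metric ::
  "('m, 'e::real_normed_vector) chart set \<Rightarrow> ('m, 'e) metric \<Rightarrow> bool" where
  "riemannian_metric A g \<longleftrightarrow>
     (\<forall>x. \<forall>u\<in>tangent_space A x. \<forall>v\<in>tangent_space A x.
        g x u v = g x v u \<and>
        (\<forall>w\<in>tangent_space A x. g x (\<lambda>c. u c + v c) w = g x u w + g x v w) \<and>
        (\<forall>r. g x (\<lambda>c. r *\<^sub>R u c) v = r * g x u v) \<and>
        (u \<noteq> (\<lambda>_. 0) \<longrightarrow> 0 < g x u u)) \<and>
     (\<forall>c\<in>A. \<forall>u u'. smooth_on (snd c ` fst c)
        (\<lambda>p. g (chart_inv c p) (tvec_of A c (chart_inv c p) u) (tvec_of A c (chart_inv c p) u')))"

definition tnorm :: "('m, 'e) metric \<Rightarrow> 'm \<Rightarrow> ('m, 'e) tvec \<Rightarrow> real" where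
  "tnorm g x v = sqrt (g x v v)"

definition piecewise_C1_curve ::
  "('m::topological_space, 'e::real_normed_vector) chart set \<Rightarrow> (real \<Rightarrow> 'm) \<Rightarrow> bool" where
  "piecewise_C1_curve A \<gamma> \<longleftrightarrow> continuous_on {0..1} \<gamma> \<and>
     (\<forall>c\<in>A. \<forall>r s. 0 \<le> r \<and> r \<le> s \<and> s \<le> 1 \<and> \<gamma> ` {r..s} \<subseteq> fst c \<longrightarrow>
        (snd c \<circ> \<gamma>) piecewise_C1_differentiable_on {r..s})"

definition riemannian_dist ::
  "('m::topological_space, 'e::real_normed_vector) chart set \<Rightarrow> ('m, 'e) metric \<Rightarrow> 'm \<Rightarrow> 'm \<Rightarrow> real" where
  "riemannian_dist A g x y =
     enn2real (INF \<gamma>\<in>{\<gamma>. piecewise_C1_curve A \<gamma> \<and> \<gamma> 0 = x \<and> \<gamma> 1 = y}.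
       \<integral>\<^sup>+s\<in>{0..1}. ennreal (tnorm g (\<gamma> s) (velocity A \<gamma> s)) \<partial>lebesgue)"

definition complete_metric ::
  "('m::topological_space, 'e::real_normed_vector) chart set \<Rightarrow> ('m, 'e) metric \<Rightarrow> bool" where
  "complete_metric A g \<longleftrightarrow> Metric_space.mcomplete UNIV (riemannian_dist A g)"

definition riemannian_isometry ::
  "('m::topological_space, 'e::real_normed_vector) chart set \<Rightarrow> ('m, 'e) metric \<Rightarrow> ('m \<Rightarrow> 'm) \<Rightarrow> bool" where
  "riemannian_isometry A g f \<longleftrightarrow>
     bij f \<and> smooth_map A f \<and> smooth_map A (inv_into UNIV f) \<and>
     (\<forall>x. \<forall>v\<in>tangent_space A x. \<forall>w\<in>tangent_space A x.
        g (f x) (tangent_map A f x v) (tangent_map A f x w) = g x v w)"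

section \<open>The group action\<close>

definition orbit_space_topology ::
  "('g, 'z) monoid_scheme \<Rightarrow> ('g \<Rightarrow> 'm \<Rightarrow> 'm) \<Rightarrow> ('m::topological_space) set topology" where
  "orbit_space_topology G act =
     topology (\<lambda>W. W \<subseteq> orbits G UNIV act \<and> open {x. orbit G act x \<in> W})"

lemma openin_orbit_space_topology:
  "openin (orbit_space_topology G act) W \<longleftrightarrow>
     W \<subseteq> orbits G UNIV act \<and> open {x. orbit G act x \<in> W}"
proof -
  have un: "{x. orbit G act x \<in> \<Union>K} = (\<Union>S\<in>K. {x. orbit G act x \<in> S})" for K
    by auto
  have int: "{x. orbit G act x \<in> S \<inter> T} = {x. orbit G act x \<in> S} \<inter> {x. orbit G act x \<in> T}" for S T
    by auto
  have "istopology (\<lambda>W. W \<subseteq> orbits G UNIV act \<and> open {x. orbit G act x \<in> W})"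
    unfolding istopology_def un int by (auto intro!: open_Int open_UN)
  then show ?thesis
    by (simp add: orbit_space_topology_def topology_inverse')
qed

definition free_action :: "('g, 'z) monoid_scheme \<Rightarrow> ('g \<Rightarrow> 'm \<Rightarrow> 'm) \<Rightarrow> bool" where
  "free_action G act \<longleftrightarrow> (\<forall>g\<in>carrier G. (\<exists>x. act g x = x) \<longrightarrow> g = \<one>\<^bsub>G\<^esub>)"

definition totally_discontinuous ::
  "('g, 'z) monoid_scheme \<Rightarrow> ('g \<Rightarrow> 'm::topological_space \<Rightarrow> 'm) \<Rightarrow> bool" where
  "totally_discontinuous G act \<longleftrightarrow>
     (\<forall>x. \<exists>U. open U \<and> x \<in> U \<and> (\<forall>g\<in>carrier G. act g x \<noteq> x \<longrightarrow> act g ` U \<inter> U = {}))"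

definition cocompact_action ::
  "('g, 'z) monoid_scheme \<Rightarrow> ('g \<Rightarrow> 'm::topological_space \<Rightarrow> 'm) \<Rightarrow> bool" where
  "cocompact_action G act \<longleftrightarrow> compact_space (orbit_space_topology G act)"

text \<open>\<open>\<int>\<^sup>b\<close> and \<open>\<real>\<^sup>b\<close> are indexed by \<open>{..<b}\<close>, so that \<open>b = 0\<close> is allowed; vectors of \<open>\<real>\<^sup>b\<close> are
  extended by \<open>0\<close>, as in \<^const>\<open>Euclidean_space\<close>.\<close>

abbreviation Zb :: "nat \<Rightarrow> (nat \<Rightarrow> int) monoid" where
  "Zb b \<equiv> product_group {..<b} (\<lambda>_. integer_group)"

abbreviation Rb :: "nat \<Rightarrow> (nat \<Rightarrow> real) set" where
  "Rb b \<equiv> {h. \<forall>i\<ge>b. h i = 0}"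

section \<open>The dynamical system\<close>

text \<open>As in the mathematical definition, \<open>\<tau>\<^sub>e\<close> is not required to be the identity. The
  \<open>\<sigma>\<close>-algebra on \<open>G\<close> is the Borel \<open>\<sigma>\<close>-algebra of the topology \<open>TG\<close>.\<close>

definition dynamical_system ::
  "('g, 'z) monoid_scheme \<Rightarrow> 'g topology \<Rightarrow> 'w measure \<Rightarrow> ('g \<Rightarrow> 'w \<Rightarrow> 'w) \<Rightarrow> bool" where
  "dynamical_system G TG P \<tau> \<longleftrightarrow>
     (\<forall>g\<in>carrier G. \<forall>g'\<in>carrier G. \<forall>\<omega>\<in>space P. \<tau> (g \<otimes>\<^bsub>G\<^esub> g') \<omega> = \<tau> g (\<tau> g' \<omega>)) \<and>
     (\<forall>g\<in>carrier G. \<tau> g \<in> measurable P P) \<and>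
     (\<forall>g\<in>carrier G. \<forall>E\<in>sets P. \<tau> g ` E \<in> sets P \<and> measure P (\<tau> g ` E) = measure P E) \<and>
     (\<lambda>(g, \<omega>). \<tau> g \<omega>) \<in> measurable (sigma (carrier G) {U. openin TG U} \<Otimes>\<^sub>M P) P"

definition ergodic_system ::
  "('g, 'z) monoid_scheme \<Rightarrow> 'w measure \<Rightarrow> ('g \<Rightarrow> 'w \<Rightarrow> 'w) \<Rightarrow> bool" where
  "ergodic_system G P \<tau> \<longleftrightarrow>
     (\<forall>E\<in>sets P. (\<forall>g\<in>carrier G. measure P (sym_diff (\<tau> g ` E) E) = 0) \<longrightarrow>
        measure P E \<in> {0, 1})"

section \<open>Random metrics\<close>

text \<open>The space of continuous functions on \<open>X\<close> with the Borel \<open>\<sigma>\<close>-algebra of the topology of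
  uniform convergence on compact sets. Values outside \<open>topspace X\<close> are not seen by that topology.\<close>

definition continuous_functions :: "'a topology \<Rightarrow> ('a \<Rightarrow> real) set" where
  "continuous_functions X = {f. continuous_map X euclideanreal f}"

definition ucc_open :: "'a topology \<Rightarrow> ('a \<Rightarrow> real) set \<Rightarrow> bool" where
  "ucc_open X F \<longleftrightarrow> F \<subseteq> continuous_functions X \<and>
     (\<forall>f\<in>F. \<exists>K e. compactin X K \<and> 0 < e \<and>
        (\<forall>h\<in>continuous_functions X. (\<forall>z\<in>K. \<bar>h z - f z\<bar> < e) \<longrightarrow> h \<in> F))"

definition ucc_borel :: "'a topology \<Rightarrow> ('a \<Rightarrow> real) measure" where
  "ucc_borel X = sigma (continuous_functions X) {F. ucc_open X F}"

definition continuous_random_metric ::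
  "('m, 'e::real_normed_vector) chart set \<Rightarrow> 'w measure \<Rightarrow> ('w \<Rightarrow> ('m, 'e) metric) \<Rightarrow> bool" where
  "continuous_random_metric A P g \<longleftrightarrow>
     (\<lambda>\<omega> (x, v, w). g \<omega> x v w) \<in> measurable P (ucc_borel (tangent_sum_topology A))"

definition convex_superlinear :: "(real \<Rightarrow> real) \<Rightarrow> bool" where
  "convex_superlinear f \<longleftrightarrow>
     convex_on {0..} f \<and> mono_on {0..} f \<and> filterlim (\<lambda>r. f r / r) at_top at_top"

definition superlinear_bounds ::
  "('m, 'e::real_normed_vector) chart set \<Rightarrow> ('m, 'e) metric \<Rightarrow> 'w measure \<Rightarrow>
   ('w \<Rightarrow> ('m, 'e) metric) \<Rightarrow> bool" where
  "superlinear_bounds A g0 P g \<longleftrightarrow>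
     (\<exists>\<theta> \<Theta>. convex_superlinear \<theta> \<and> convex_superlinear \<Theta> \<and>
        (\<forall>\<omega>\<in>space P. \<forall>x. \<forall>v\<in>tangent_space A x.
           \<theta> (tnorm g0 x v) \<le> g \<omega> x v v \<and> g \<omega> x v v \<le> \<Theta> (tnorm g0 x v)))"

definition stationary_metric ::
  "('m, 'e::real_normed_vector) chart set \<Rightarrow> ('g, 'z) monoid_scheme \<Rightarrow> ('g \<Rightarrow> 'm \<Rightarrow> 'm) \<Rightarrow>
   'w measure \<Rightarrow> ('g \<Rightarrow> 'w \<Rightarrow> 'w) \<Rightarrow> ('w \<Rightarrow> ('m, 'e) metric) \<Rightarrow> bool" where
  "stationary_metric A G act P \<tau> g \<longleftrightarrow>
     (\<forall>a\<in>carrier G. \<forall>\<omega>\<in>space P. \<forall>x. \<forall>v\<in>tangent_space A x.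
        g (\<tau> a \<omega>) x v v = g \<omega> (act a x) (tangent_map A (act a) x v) (tangent_map A (act a) x v))"

section \<open>Minimal action and the effective Lagrangian\<close>

definition abs_continuous_on :: "real \<Rightarrow> real \<Rightarrow> (real \<Rightarrow> 'a::real_normed_vector) \<Rightarrow> bool" where
  "abs_continuous_on a b f \<longleftrightarrow> (\<forall>e>0. \<exists>\<delta>>0. \<forall>I. finite I \<and>
     (\<forall>(r, s)\<in>I. a \<le> r \<and> r < s \<and> s \<le> b) \<and>
     disjoint_family_on (\<lambda>(r, s). {r<..<s}) I \<and> (\<Sum>(r, s)\<in>I. s - r) < \<delta> \<longrightarrow>
     (\<Sum>(r, s)\<in>I. norm (f s - f r)) < e)"

definition abs_continuous_curve ::
  "('m::topological_space, 'e::real_normed_vector) chart set \<Rightarrow> real \<Rightarrow> (real \<Rightarrow> 'm) \<Rightarrow> bool" where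
  "abs_continuous_curve A t \<gamma> \<longleftrightarrow> continuous_on {0..t} \<gamma> \<and>
     (\<forall>c\<in>A. \<forall>r s. 0 \<le> r \<and> r \<le> s \<and> s \<le> t \<and> \<gamma> ` {r..s} \<subseteq> fst c \<longrightarrow>
        abs_continuous_on r s (snd c \<circ> \<gamma>))"

text \<open>\<^const>\<open>ennreal\<close> truncates negative values of \<open>L\<close> at \<open>0\<close>; the Lagrangian of a
  Riemannian metric, the only one used here, is nonnegative on tangent vectors. The velocity of an
  absolutely continuous curve is arbitrary on the null set where the curve is not differentiable.\<close>

definition min_action ::
  "('m::topological_space, 'e::real_normed_vector) chart set \<Rightarrow>
   ('m \<Rightarrow> ('m, 'e) tvec \<Rightarrow> 'w \<Rightarrow> real) \<Rightarrow> real \<Rightarrow> 'm \<Rightarrow> 'm \<Rightarrow> real \<Rightarrow> 'w \<Rightarrow> ereal" where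
  "min_action A L \<epsilon> x' x t \<omega> =
     (INF \<gamma>\<in>{\<gamma>. abs_continuous_curve A t \<gamma> \<and> \<gamma> 0 = x' \<and> \<gamma> t = x}.
       enn2ereal (\<integral>\<^sup>+s\<in>{0..t}. ennreal (L (\<gamma> s) (\<lambda>c. \<epsilon> *\<^sub>R velocity A \<gamma> s c) \<omega>) \<partial>lebesgue))"

definition metric_lagrangian ::
  "('w \<Rightarrow> ('m, 'e) metric) \<Rightarrow> 'm \<Rightarrow> ('m, 'e) tvec \<Rightarrow> 'w \<Rightarrow> real" where
  "metric_lagrangian g x v \<omega> = g \<omega> x v v"

text \<open>\<open>\<iota>\<close> is the identification of \<open>\<int>\<^sup>b \<times> T\<close> with \<open>G\<close>, and \<open>\<Phi> \<epsilon>\<close> the map \<open>\<Phi>\<^sub>\<epsilon> : \<real>\<^sup>b \<rightarrow> \<int>\<^sup>b\<close>.\<close>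

definition lattice_approximation ::
  "nat \<Rightarrow> (real \<Rightarrow> (nat \<Rightarrow> real) \<Rightarrow> nat \<Rightarrow> int) \<Rightarrow> (real \<Rightarrow> real) \<Rightarrow> bool" where
  "lattice_approximation b \<Phi> C \<longleftrightarrow>
     (\<forall>\<epsilon>>0. \<forall>h\<in>Rb b. \<Phi> \<epsilon> h \<in> carrier (Zb b) \<and>
        L2_set (\<lambda>i. \<epsilon> * real_of_int (\<Phi> \<epsilon> h i) - h i) {..<b} \<le> C \<epsilon>) \<and>
     (C \<longlongrightarrow> 0) (at_right 0)"

definition effective_lagrangian ::
  "('m::topological_space, 'e::real_normed_vector) chart set \<Rightarrow> nat \<Rightarrow> ('k, 'y) monoid_scheme \<Rightarrow>
   ((nat \<Rightarrow> int) \<times> 'k \<Rightarrow> 'g) \<Rightarrow> ('g \<Rightarrow> 'm \<Rightarrow> 'm) \<Rightarrow> 'w measure \<Rightarrow>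
   (real \<Rightarrow> (nat \<Rightarrow> real) \<Rightarrow> nat \<Rightarrow> int) \<Rightarrow> ('m \<Rightarrow> ('m, 'e) tvec \<Rightarrow> 'w \<Rightarrow> real) \<Rightarrow>
   ((nat \<Rightarrow> real) \<Rightarrow> real) \<Rightarrow> bool" where
  "effective_lagrangian A b T \<iota> act P \<Phi> L Lbar \<longleftrightarrow>
     (\<exists>E\<in>sets P. measure P E = 1 \<and>
        (\<forall>\<omega>\<in>E. \<forall>x. \<forall>k\<in>carrier T. \<forall>h\<in>Rb b.
           ((\<lambda>\<epsilon>. min_action A L \<epsilon> (act (\<iota> (\<one>\<^bsub>Zb b\<^esub>, k)) x) (act (\<iota> (\<Phi> \<epsilon> h, k)) x) 1 \<omega>)
              \<longlongrightarrow> ereal (Lbar h)) (at_right 0)))"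

definition stable_norm :: "((nat \<Rightarrow> real) \<Rightarrow> real) \<Rightarrow> (nat \<Rightarrow> real) \<Rightarrow> real" where
  "stable_norm Lbar h = sqrt (Lbar h)"

definition is_norm_on :: "(nat \<Rightarrow> real) set \<Rightarrow> ((nat \<Rightarrow> real) \<Rightarrow> real) \<Rightarrow> bool" where
  "is_norm_on V N \<longleftrightarrow>
     (\<forall>h\<in>V. 0 \<le> N h \<and> (N h = 0 \<longleftrightarrow> h = (\<lambda>_. 0))) \<and>
     (\<forall>h\<in>V. \<forall>r. N (\<lambda>i. r * h i) = \<bar>r\<bar> * N h) \<and>
     (\<forall>h\<in>V. \<forall>h'\<in>V. N (\<lambda>i. h i + h' i) \<le> N h + N h')"

end

theory Submission
  imports Defs
begin

text \<open>For the Lagrangian of a metric, the minimal action at scale \<open>\<epsilon>\<close> in time one is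
  \<open>\<epsilon>\<^sup>2 d\<^sub>\<omega>(x, y)\<^sup>2\<close>, where \<open>d\<^sub>\<omega>\<close> is the square root of the minimal energy of curves from \<open>x\<close>
  to \<open>y\<close> (\<open>min_action_eq\<close>). Splitting the time between two curves in proportion to their lengths shows
  that \<open>d\<^sub>\<omega>\<close> satisfies the triangle inequality (\<open>energy_dist_triangle\<close>); it is the Riemannian distance,
  obtained without length-minimizing reparametrizations. So the stable norm of \<open>h\<close> is the almost sure
  limit of \<open>\<epsilon> d\<^sub>\<omega>(x, \<Phi>\<^sub>\<epsilon>(h) x)\<close>, and each norm axiom is read off from a property of distances.

  Since the metric is quadratic, the two superlinear bounds make all \<open>d\<^sub>\<omega>\<close> uniformly comparable with
  the invariant reference distance (\<open>superlinear_bounds_comparable\<close>). Hence \<open>d\<^sub>\<omega>(x, n x)\<close> is Lipschitz in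
  the lattice point \<open>n\<close>, and the limit is the same along all scales \<open>\<epsilon>\<^sub>j\<close> tending to \<open>0\<close> and lattice points
  \<open>n\<^sub>j\<close> with \<open>\<epsilon>\<^sub>j n\<^sub>j\<close> tending to \<open>h\<close> (\<open>rdist_limit\<close>). Positive homogeneity follows by rescaling \<open>\<epsilon>\<^sub>j\<close>.

  For subadditivity, go from \<open>x\<close> to \<open>n x\<close> and on to \<open>(n + m) x\<close>. By stationarity the second leg has the
  length of the leg from \<open>x\<close> to \<open>m x\<close> at the sample point \<open>\<tau>\<^sub>n \<omega>\<close>, which moves with the scale, so that almost
  sure convergence says nothing about it. But \<open>\<tau>\<^sub>n\<close> preserves probabilities, and convergence in
  probability gives, for a suitable scale, one sample point at which all three limits are almost
  attained (\<open>common_sample\<close>). Symmetry is the same argument for the way back. It relies on the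
  measurability of \<open>d\<^sub>\<omega>\<close> in \<open>\<omega>\<close>, an infimum over uncountably many curves, which holds because the
  minimal energy is upper semicontinuous in the metric (\<open>min_energy_less_measurable\<close>).

  Definiteness is a Svarc--Milnor estimate: as the quotient is compact and the action is by isometries
  with displacements bounded away from \<open>0\<close>, the reference distance from \<open>x\<close> to \<open>n x\<close> grows at least
  linearly in \<open>n\<close> (\<open>displacement_bound\<close>).

  The analytical basis is that the competitors are merely absolutely continuous. Their velocities
  are tangent vectors only almost everywhere, which is Lebesgue's differentiation theorem for monotone
  functions (\<open>mono_differentiable_ae\<close>); that energy controls distance in a chart is the fundamental
  theorem of calculus for absolutely continuous functions (\<open>abs_continuous_has_integral\<close>).\<close>

section \<open>Absolutely continuous functions on the line\<close>

text \<open>Vitali's covering theorem for intervals that need only contain the points they cover, here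
  as endpoints, and not be centred at them.\<close>

lemma vitali_intervals:
  fixes S :: "real set"
  assumes S: "\<And>x d. x \<in> S \<Longrightarrow> 0 < d \<Longrightarrow> \<exists>l u. R l u \<and> l < u \<and> x \<in> {l..u} \<and> u - l < d"
  obtains C where "countable C" "\<And>l u. (l, u) \<in> C \<Longrightarrow> R l u \<and> l < u"
    "\<And>l u l' u'. (l, u) \<in> C \<Longrightarrow> (l', u') \<in> C \<Longrightarrow> (l, u) \<noteq> (l', u') \<Longrightarrow> {l..u} \<inter> {l'..u'} = {}"
    "negligible (S - (\<Union>(l, u)\<in>C. {l..u}))"
proof -
  define K where "K = {(l, u). R l u \<and> l < u}"
  define a r where "a = (\<lambda>(l, u). (l + u) / 2 :: real)" and "r = (\<lambda>(l, u). (u - l) / 2 :: real)"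
  have cb: "cball (a i) (r i) = {fst i..snd i}" for i
    by (cases i) (simp add: a_def r_def cball_eq_atLeastAtMost field_simps)
  have 1: "0 < r i" if "i \<in> K" for i
    using that by (auto simp: K_def r_def)
  have 2: "\<exists>i. i \<in> K \<and> x \<in> cball (a i) (r i) \<and> r i < d" if xd: "x \<in> S" "0 < d" for x d
  proof -
    obtain l u where "R l u" "l < u" "x \<in> {l..u}" "u - l < d" using S[OF xd] by blast
    then show ?thesis unfolding cb by (intro exI[of _ "(l, u)"]) (auto simp: K_def r_def)
  qed
  obtain C where C: "countable C" "C \<subseteq> K"
     "pairwise (\<lambda>i j. disjnt (cball (a i) (r i)) (cball (a j) (r j))) C"
     "negligible (S - (\<Union>i \<in> C. cball (a i) (r i)))"
    by (rule Vitali_covering_theorem_cballs[of K r S a, OF 1 2])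
  show thesis
  proof
    show "countable C" by fact
    show "R l u \<and> l < u" if "(l, u) \<in> C" for l u
      using that C(2) by (auto simp: K_def)
    show "{l..u} \<inter> {l'..u'} = {}" if "(l, u) \<in> C" "(l', u') \<in> C" "(l, u) \<noteq> (l', u')" for l u l' u'
      using pairwiseD[OF C(3) that] unfolding disjnt_def cb by simp
    show "negligible (S - (\<Union>(l, u)\<in>C. {l..u}))"
      using C(4) unfolding cb by (simp add: case_prod_unfold)
  qed
qed

text \<open>The open intervals between the values of a monotone function at the ends of disjoint
  intervals are again disjoint, so their total length is at most the total increment.\<close>

lemma mono_increments_le:
  fixes F :: "real \<Rightarrow> real"
  assumes F: "mono_on {a..b} F" and ab: "a \<le> b" and I: "finite I"
    and sub: "\<And>l u. (l, u) \<in> I \<Longrightarrow> a \<le> l \<and> l < u \<and> u \<le> b"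
    and dj: "\<And>l u l' u'. (l, u) \<in> I \<Longrightarrow> (l', u') \<in> I \<Longrightarrow> (l, u) \<noteq> (l', u') \<Longrightarrow> {l..u} \<inter> {l'..u'} = {}"
  shows "(\<Sum>(l, u)\<in>I. F u - F l) \<le> F b - F a"
proof -
  let ?J = "\<lambda>i. {F (fst i)<..<F (snd i)}"
  have mon: "F x \<le> F y" if "a \<le> x" "x \<le> y" "y \<le> b" for x y
    using F that by (auto simp: mono_on_def)
  have disj: "?J i \<inter> ?J j = {}" if ij: "i \<in> I" "j \<in> I" "i \<noteq> j" for i j
  proof -
    obtain l u l' u' where e: "i = (l, u)" "j = (l', u')" by (cases i, cases j)
    have 1: "a \<le> l \<and> l < u \<and> u \<le> b" "a \<le> l' \<and> l' < u' \<and> u' \<le> b"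
      using sub ij e by auto
    have 2: "{l..u} \<inter> {l'..u'} = {}" using dj ij e by auto
    have "u < l' \<or> u' < l"
    proof (rule ccontr)
      assume "\<not> ?thesis"
      then have "max l l' \<in> {l..u} \<inter> {l'..u'}" using 1 by auto
      then show False using 2 by auto
    qed
    then have "F u \<le> F l' \<or> F u' \<le> F l"
      using mon[of u l'] mon[of u' l] 1 by auto
    then show ?thesis by (auto simp: e)
  qed
  have "(\<Sum>(l, u)\<in>I. F u - F l) = (\<Sum>i\<in>I. measure lebesgue (?J i))"
  proof (rule sum.cong)
    fix i assume "i \<in> I"
    then have "F (fst i) \<le> F (snd i)" using sub[of "fst i" "snd i"] mon by auto
    then show "(case i of (l, u) \<Rightarrow> F u - F l) = measure lebesgue (?J i)"
      by (auto simp: case_prod_unfold)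
  qed simp
  also have "\<dots> = measure lebesgue (\<Union>i\<in>I. ?J i)"
    by (rule measure_UNION'[symmetric]) (use I disj in \<open>auto simp: pairwise_def disjnt_def\<close>)
  also have "\<dots> \<le> measure lebesgue {F a..F b}"
  proof (rule measure_mono_fmeasurable)
    show "(\<Union>i\<in>I. ?J i) \<subseteq> {F a..F b}"
    proof clarsimp
      fix l u y assume "(l, u) \<in> I" "F l < y" "y < F u"
      then show "F a \<le> y \<and> y \<le> F b"
        using sub[of l u] mon[of a l] mon[of u b] by auto
    qed
  qed (use I in \<open>auto intro!: sets.finite_UN\<close>)
  also have "\<dots> = F b - F a"
    using mon[of a b] ab by simp
  finally show ?thesis .
qed

definition diffquot :: "(real \<Rightarrow> real) \<Rightarrow> real \<Rightarrow> real \<Rightarrow> real" where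
  "diffquot F x y = (F y - F x) / (y - x)"

text \<open>By Vitali, almost all of \<open>S\<close> is covered by disjoint intervals on which the average slope
  exceeds \<open>q\<close>, so their total length is at most the total increment divided by \<open>q\<close>. The set \<open>S\<close> is
  not assumed measurable, hence the measurable superset.\<close>

lemma large_slope_cover:
  fixes F :: "real \<Rightarrow> real"
  assumes F: "mono_on {a..b} F" and ab: "a \<le> b" and q: "0 < q"
    and S: "S \<subseteq> {a<..<b}" "\<And>x. x \<in> S \<Longrightarrow> \<exists>\<^sub>F y in at x. q < diffquot F x y"
  obtains T where "S \<subseteq> T" "T \<in> lmeasurable" "measure lebesgue T \<le> (F b - F a) / q"
proof -
  define R where "R l u \<longleftrightarrow> a \<le> l \<and> u \<le> b \<and> q * (u - l) < F u - F l" for l u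
  have "\<exists>l u. R l u \<and> l < u \<and> x \<in> {l..u} \<and> u - l < d" if x: "x \<in> S" and d: "0 < d" for x d
  proof -
    have xab: "a < x" "x < b" using S x by auto
    define d' where "d' = min d (min (x - a) (b - x))"
    have "0 < d'" using d xab by (auto simp: d'_def)
    then obtain y where y: "y \<noteq> x" "dist y x < d'" "q < diffquot F x y"
      using S(2)[OF x] unfolding frequently_at by blast
    have yab: "a \<le> y" "y \<le> b" "\<bar>y - x\<bar> < d" using y(2) by (auto simp: d'_def dist_real_def)
    show ?thesis
    proof (cases "x < y")
      case True
      then have "q * (y - x) < F y - F x" using y by (simp add: diffquot_def pos_less_divide_eq)
      then show ?thesis using True yab xab by (intro exI[of _ x] exI[of _ y]) (auto simp: R_def)
    next
      case False
      then have "y < x" using y by simp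
      then have "q * (x - y) < F x - F y"
        using y(3) by (simp add: diffquot_def neg_less_divide_eq algebra_simps)
      then show ?thesis using \<open>y < x\<close> yab xab by (intro exI[of _ y] exI[of _ x]) (auto simp: R_def)
    qed
  qed
  from vitali_intervals[of S R, OF this] obtain C where C: "countable C"
    "\<And>l u. (l, u) \<in> C \<Longrightarrow> R l u \<and> l < u"
    "\<And>l u l' u'. (l, u) \<in> C \<Longrightarrow> (l', u') \<in> C \<Longrightarrow> (l, u) \<noteq> (l', u') \<Longrightarrow> {l..u} \<inter> {l'..u'} = {}"
    "negligible (S - (\<Union>(l, u)\<in>C. {l..u}))" by blast
  define U where "U = (\<Union>i\<in>C. {fst i..snd i})"
  have bound: "measure lebesgue (\<Union>i\<in>I'. {fst i..snd i}) \<le> (F b - F a) / q"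
    if "I' \<subseteq> C" "finite I'" for I'
  proof -
    have "measure lebesgue (\<Union>i\<in>I'. {fst i..snd i}) \<le> (\<Sum>i\<in>I'. measure lebesgue {fst i..snd i})"
      by (rule measure_UNION_le) (use that in auto)
    also have "\<dots> \<le> (\<Sum>(l, u)\<in>I'. (F u - F l) / q)"
    proof (rule sum_mono)
      fix i assume "i \<in> I'"
      then have "R (fst i) (snd i) \<and> fst i < snd i" using C(2)[of "fst i" "snd i"] that by auto
      then show "measure lebesgue {fst i..snd i} \<le> (case i of (l, u) \<Rightarrow> (F u - F l) / q)"
        using q by (auto simp: case_prod_unfold R_def field_simps)
    qed
    also have "\<dots> = (\<Sum>(l, u)\<in>I'. F u - F l) / q"
      by (simp add: sum_divide_distrib case_prod_unfold)
    also have "(\<Sum>(l, u)\<in>I'. F u - F l) \<le> F b - F a"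
    proof (rule mono_increments_le[OF F ab])
      show "finite I'" by fact
      show "a \<le> l \<and> l < u \<and> u \<le> b" if "(l, u) \<in> I'" for l u
        using C(2)[of l u] that \<open>I' \<subseteq> C\<close> by (auto simp: R_def)
      show "{l..u} \<inter> {l'..u'} = {}" if "(l, u) \<in> I'" "(l', u') \<in> I'" "(l, u) \<noteq> (l', u')" for l u l' u'
        using C(3) that \<open>I' \<subseteq> C\<close> by blast
    qed
    finally show ?thesis using q by (simp add: divide_right_mono)
  qed
  have U: "U \<in> lmeasurable" "measure lebesgue U \<le> (F b - F a) / q"
    unfolding U_def
    by (rule fmeasurable_UN_bound[OF C(1) _ bound], auto)
       (rule measure_UN_bound[OF C(1) _ bound], auto)
  have N: "negligible (S - U)" using C(4) by (simp add: U_def case_prod_unfold)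
  show thesis
  proof
    show "S \<subseteq> U \<union> (S - U)" by auto
    show "U \<union> (S - U) \<in> lmeasurable"
      using U(1) negligible_imp_measurable[OF N] by (rule fmeasurable.Un)
    have "measure lebesgue (U \<union> (S - U)) \<le> measure lebesgue U + measure lebesgue (S - U)"
      by (rule measure_Un_le) (use U N negligible_imp_sets in auto)
    then show "measure lebesgue (U \<union> (S - U)) \<le> (F b - F a) / q"
      using U(2) negligible_imp_measure0[OF N] by simp
  qed
qed

text \<open>Arbitrarily large slopes \<open>q\<close> give measurable supersets of arbitrarily small measure.\<close>

lemma negligible_infinite_slope:
  fixes F :: "real \<Rightarrow> real"
  assumes F: "mono_on {a..b} F" and ab: "a \<le> b"
  shows "negligible {x\<in>{a<..<b}. \<forall>q. \<exists>\<^sub>F y in at x. q < diffquot F x y}" (is "negligible ?S")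
  unfolding negligible_outer_le
proof (intro allI impI)
  fix e :: real assume e: "0 < e"
  define q where "q = (F b - F a) / e + 1"
  have Fab: "F a \<le> F b" using F ab by (auto simp: mono_on_def)
  have q: "0 < q" using e Fab by (simp add: q_def add_nonneg_pos)
  obtain T where T: "?S \<subseteq> T" "T \<in> lmeasurable" "measure lebesgue T \<le> (F b - F a) / q"
    by (rule large_slope_cover[OF F ab q, of ?S]) auto
  have "(F b - F a) / q \<le> e"
    using e q by (simp add: pos_divide_le_eq q_def field_simps)
  then show "\<exists>T. ?S \<subseteq> T \<and> T \<in> lmeasurable \<and> measure lebesgue T \<le> e"
    using T by (intro exI[of _ T]) auto
qed

lemma lmeasurable_outer_open:
  fixes S :: "real set" and e :: real
  assumes S: "S \<in> lmeasurable" and e: "0 < e"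
  obtains T where "open T" "S \<subseteq> T" "T \<in> lmeasurable" "measure lebesgue T < measure lebesgue S + e"
proof -
  obtain T where T: "open T" "S \<subseteq> T" "(T - S) \<in> lmeasurable" "emeasure lebesgue (T - S) < ennreal e"
    using sets_lebesgue_outer_open[of S e] S e by (auto intro: fmeasurableD)
  have un: "S \<union> (T - S) = T" using T(2) by auto
  have "T \<in> lmeasurable" using fmeasurable.Un[OF S T(3)] un by simp
  moreover have "measure lebesgue (T - S) < e"
    using T(3,4) e by (simp add: emeasure_eq_measure2 ennreal_less_iff)
  moreover have "measure lebesgue T \<le> measure lebesgue S + measure lebesgue (T - S)"
    using measure_Un_le[of S lebesgue "T - S"] S T(3) un by (simp add: fmeasurableD)
  ultimately show thesis using that T(1,2) by force
qed

text \<open>The classical double covering argument: inside an open superset of \<open>?E\<close>, first cover by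
  intervals of slope less than \<open>p\<close> and then cover within these by intervals of slope greater than
  \<open>q\<close>. This shrinks the measure of a superset by the factor \<open>p / q < 1\<close>.\<close>

lemma negligible_slope_oscillation:
  fixes F :: "real \<Rightarrow> real"
  assumes F: "mono_on {a..b} F" and ab: "a \<le> b" and pq: "0 < p" "p < q"
  shows "negligible {x\<in>{a<..<b}. (\<exists>\<^sub>F y in at x. diffquot F x y < p) \<and>
     (\<exists>\<^sub>F y in at x. q < diffquot F x y)}" (is "negligible ?E")
proof -
  have shrink: "\<exists>T. ?E \<subseteq> T \<and> T \<in> lmeasurable \<and> measure lebesgue T \<le> p / q * m"
    if O: "open O'" "?E \<subseteq> O'" "O' \<in> lmeasurable" "measure lebesgue O' \<le> m" for O' m
  proof -
    define R where "R l u \<longleftrightarrow> a \<le> l \<and> u \<le> b \<and> {l..u} \<subseteq> O' \<and> F u - F l < p * (u - l)" for l u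
    have "\<exists>l u. R l u \<and> l < u \<and> x \<in> {l..u} \<and> u - l < d" if x: "x \<in> ?E" and d: "0 < d" for x d
    proof -
      have xab: "a < x" "x < b" using x by auto
      have "x \<in> O'" using x O(2) by blast
      then obtain e where e: "0 < e" "ball x e \<subseteq> O'"
        using O(1) open_contains_ball by blast
      define d' where "d' = Min {d, x - a, b - x, e}"
      have "0 < d'" using d xab e by (auto simp: d'_def)
      then obtain y where y: "y \<noteq> x" "dist y x < d'" "diffquot F x y < p"
        using x unfolding frequently_at by blast
      have yab: "a \<le> y" "y \<le> b" "\<bar>y - x\<bar> < d" "\<bar>y - x\<bar> < e"
        using y(2) by (auto simp: d'_def dist_real_def)
      have sub: "{min x y..max x y} \<subseteq> O'"
        using e(2) yab(4) by (force simp: dist_real_def)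
      show ?thesis
      proof (cases "x < y")
        case True
        then have "F y - F x < p * (y - x)" using y by (simp add: diffquot_def pos_divide_less_eq)
        then show ?thesis using True yab xab sub by (intro exI[of _ x] exI[of _ y]) (auto simp: R_def)
      next
        case False
        then have "y < x" using y by simp
        then have "F x - F y < p * (x - y)"
          using y(3) by (simp add: diffquot_def neg_divide_less_eq algebra_simps)
        then show ?thesis using \<open>y < x\<close> yab xab sub by (intro exI[of _ y] exI[of _ x]) (auto simp: R_def)
      qed
    qed
    from vitali_intervals[of ?E R, OF this] obtain C where C: "countable C"
      "\<And>l u. (l, u) \<in> C \<Longrightarrow> R l u \<and> l < u"
      "\<And>l u l' u'. (l, u) \<in> C \<Longrightarrow> (l', u') \<in> C \<Longrightarrow> (l, u) \<noteq> (l', u') \<Longrightarrow> {l..u} \<inter> {l'..u'} = {}"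
      "negligible (?E - (\<Union>(l, u)\<in>C. {l..u}))" by blast
    have "\<forall>i\<in>C. \<exists>T. ?E \<inter> {fst i<..<snd i} \<subseteq> T \<and> T \<in> lmeasurable \<and>
        measure lebesgue T \<le> (F (snd i) - F (fst i)) / q"
    proof
      fix i assume "i \<in> C"
      then have i: "R (fst i) (snd i)" "fst i < snd i" using C(2)[of "fst i" "snd i"] by auto
      show "\<exists>T. ?E \<inter> {fst i<..<snd i} \<subseteq> T \<and> T \<in> lmeasurable \<and>
        measure lebesgue T \<le> (F (snd i) - F (fst i)) / q"
        by (rule large_slope_cover[of "fst i" "snd i" F q "?E \<inter> {fst i<..<snd i}"])
           (use i pq F in \<open>auto simp: R_def mono_on_def\<close>)
    qed
    from bchoice[OF this] obtain T where T': "\<forall>i\<in>C. ?E \<inter> {fst i<..<snd i} \<subseteq> T i \<and>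
        T i \<in> lmeasurable \<and> measure lebesgue (T i) \<le> (F (snd i) - F (fst i)) / q"
      by (elim exE)
    have T: "?E \<inter> {fst i<..<snd i} \<subseteq> T i" "T i \<in> lmeasurable"
      "measure lebesgue (T i) \<le> (F (snd i) - F (fst i)) / q" if "i \<in> C" for i
      using bspec[OF T' that] by simp_all
    have bound: "measure lebesgue (\<Union>i\<in>I'. T i) \<le> p / q * m"
      if "I' \<subseteq> C" "finite I'" for I'
    proof -
      have le_m: "(\<Sum>i\<in>I'. measure lebesgue {fst i..snd i}) \<le> m"
      proof -
        have "(\<Sum>i\<in>I'. measure lebesgue {fst i..snd i}) = measure lebesgue (\<Union>i\<in>I'. {fst i..snd i})"
        proof (rule measure_UNION'[symmetric])
          show "pairwise (\<lambda>i j. disjnt {fst i..snd i} {fst j..snd j}) I'"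
          proof (rule pairwiseI)
            fix i j assume "i \<in> I'" "j \<in> I'" "i \<noteq> j"
            then show "disjnt {fst i..snd i} {fst j..snd j}"
              using C(3)[of "fst i" "snd i" "fst j" "snd j"] that by (auto simp: disjnt_def prod_eq_iff)
          qed
        qed (use that in auto)
        also have "\<dots> \<le> measure lebesgue O'"
        proof (rule measure_mono_fmeasurable)
          show "(\<Union>i\<in>I'. {fst i..snd i}) \<subseteq> O'"
          proof (rule UN_least)
            fix i assume "i \<in> I'"
            then show "{fst i..snd i} \<subseteq> O'"
              using C(2)[of "fst i" "snd i"] that by (auto simp: R_def)
          qed
        qed (use that O in \<open>auto intro!: sets.finite_UN\<close>)
        also have "\<dots> \<le> m" by fact
        finally show ?thesis .
      qed
      have "measure lebesgue (\<Union>i\<in>I'. T i) \<le> (\<Sum>i\<in>I'. measure lebesgue (T i))"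
        by (rule measure_UNION_le) (use that T in auto)
      also have "\<dots> \<le> (\<Sum>i\<in>I'. p / q * measure lebesgue {fst i..snd i})"
      proof (rule sum_mono)
        fix i assume "i \<in> I'"
        then have i: "i \<in> C" using that by auto
        have R: "R (fst i) (snd i)" "fst i < snd i" using C(2)[of "fst i" "snd i"] i by auto
        have "(F (snd i) - F (fst i)) / q \<le> (p * (snd i - fst i)) / q"
          using R pq by (intro divide_right_mono) (auto simp: R_def)
        then show "measure lebesgue (T i) \<le> p / q * measure lebesgue {fst i..snd i}"
          using T(3)[OF i] R by simp
      qed
      also have "\<dots> = p / q * (\<Sum>i\<in>I'. measure lebesgue {fst i..snd i})"
        by (simp add: sum_distrib_left)
      also have "\<dots> \<le> p / q * m"
        by (rule mult_left_mono[OF le_m]) (use pq in auto)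
      finally show ?thesis .
    qed
    define U where "U = (\<Union>i\<in>C. T i)"
    have U1: "U \<in> lmeasurable"
      unfolding U_def by (rule fmeasurable_UN_bound[OF C(1) T(2) bound])
    have U2: "measure lebesgue U \<le> p / q * m"
      unfolding U_def by (rule measure_UN_bound[OF C(1) T(2) bound])
    note U = U1 U2
    define N where "N = (?E - (\<Union>(l, u)\<in>C. {l..u})) \<union> (\<Union>i\<in>C. {fst i, snd i})"
    have N: "negligible N"
      unfolding N_def using C(1,4)
      by (intro negligible_Un negligible_countable_Union) auto
    have "?E \<subseteq> U \<union> N"
    proof
      fix x assume x: "x \<in> ?E"
      show "x \<in> U \<union> N"
      proof (cases "x \<in> N")
        case False
        then have "x \<in> (\<Union>(l, u)\<in>C. {l..u})" "x \<notin> (\<Union>i\<in>C. {fst i, snd i})"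
          using x unfolding N_def by blast+
        then obtain i where i: "i \<in> C" "x \<in> {fst i..snd i}" "x \<noteq> fst i" "x \<noteq> snd i"
          by (auto simp: case_prod_unfold)
        then have "x \<in> ?E \<inter> {fst i<..<snd i}" using x by auto
        then have "x \<in> T i" using T(1)[OF i(1)] by blast
        then show ?thesis using i by (auto simp: U_def)
      qed simp
    qed
    moreover have "U \<union> N \<in> lmeasurable"
      using U(1) negligible_imp_measurable[OF N] by (rule fmeasurable.Un)
    moreover have "measure lebesgue (U \<union> N) \<le> p / q * m"
    proof -
      have "measure lebesgue (U \<union> N) \<le> measure lebesgue U + measure lebesgue N"
        by (rule measure_Un_le) (use U N negligible_imp_sets in auto)
      then show ?thesis using U(2) negligible_imp_measure0[OF N] by simp
    qed
    ultimately show ?thesis by blast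
  qed
  define M where "M = {measure lebesgue T | T. ?E \<subseteq> T \<and> T \<in> lmeasurable}"
  have "measure lebesgue {a..b} \<in> M" unfolding M_def by (auto intro!: exI[of _ "{a..b}"])
  then have ne: "M \<noteq> {}" by blast
  have bd: "bdd_below M" by (rule bdd_belowI[of _ 0]) (auto simp: M_def)
  have nn: "0 \<le> Inf M" by (rule cInf_greatest[OF ne]) (auto simp: M_def)
  have step: "Inf M \<le> p / q * (Inf M + e)" if e: "0 < e" for e
  proof -
    obtain s where "s \<in> M" "s < Inf M + e / 2"
      using cInf_lessD[OF ne, of "Inf M + e / 2"] e by auto
    then obtain T where T: "?E \<subseteq> T" "T \<in> lmeasurable" "measure lebesgue T < Inf M + e / 2"
      by (auto simp: M_def)
    obtain O' where O: "open O'" "T \<subseteq> O'" "O' \<in> lmeasurable" "measure lebesgue O' < measure lebesgue T + e / 2"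
      by (rule lmeasurable_outer_open[OF T(2), of "e / 2"]) (use e in auto)
    have "?E \<subseteq> O'" using T(1) O(2) by (rule order_trans)
    moreover have "measure lebesgue O' \<le> Inf M + e" using O(4) T(3) by simp
    ultimately obtain T' where T': "?E \<subseteq> T'" "T' \<in> lmeasurable" "measure lebesgue T' \<le> p / q * (Inf M + e)"
      using shrink[OF O(1) _ O(3)] by blast
    then have "measure lebesgue T' \<in> M" unfolding M_def by blast
    then show ?thesis using cInf_lower[OF _ bd] T'(3) order_trans by blast
  qed
  have "Inf M \<le> p / q * Inf M"
  proof (rule field_le_epsilon)
    fix e :: real assume "0 < e"
    then have "Inf M \<le> p / q * (Inf M + e * q / p)"
      using pq by (intro step) simp
    also have "\<dots> = p / q * Inf M + e"
      using pq by (simp add: field_simps)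
    finally show "Inf M \<le> p / q * Inf M + e" .
  qed
  moreover have "p / q * Inf M < 1 * Inf M" if "0 < Inf M"
    using that pq by (intro mult_strict_right_mono) auto
  ultimately have "Inf M = 0" using nn by force
  show ?thesis
    unfolding negligible_outer
  proof (intro allI impI)
    fix e :: real assume "0 < e"
    then obtain s where "s \<in> M" "s < e"
      using cInf_lessD[OF ne, of e] \<open>Inf M = 0\<close> by auto
    then show "\<exists>T. ?E \<subseteq> T \<and> T \<in> lmeasurable \<and> measure lebesgue T < e"
      by (auto simp: M_def)
  qed
qed

text \<open>Outside countably many null sets with rational thresholds, the supremum of the eventual lower
  bounds of the difference quotient is finite and is its limit.\<close>

lemma mono_differentiable_ae:
  fixes F :: "real \<Rightarrow> real"
  assumes F: "mono_on {a..b} F"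
  shows "negligible {x\<in>{a<..<b}. \<not> F differentiable (at x)}"
proof (cases "a \<le> b")
  case ab: True
  define A where "A = {x\<in>{a<..<b}. \<forall>q. \<exists>\<^sub>F y in at x. q < diffquot F x y}"
  define B where "B p q = {x\<in>{a<..<b}. (\<exists>\<^sub>F y in at x. diffquot F x y < p) \<and>
     (\<exists>\<^sub>F y in at x. q < diffquot F x y)}" for p q
  define PQ where "PQ = {(p, q). p \<in> \<rat> \<and> q \<in> \<rat> \<and> 0 < p \<and> p < (q::real)}"
  have "countable PQ"
    by (rule countable_subset[of _ "\<rat> \<times> \<rat>"]) (auto simp: PQ_def countable_rat)
  moreover have "negligible (B p q)" if "(p, q) \<in> PQ" for p q
    unfolding B_def by (rule negligible_slope_oscillation[OF F ab]) (use that in \<open>auto simp: PQ_def\<close>)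
  moreover have "negligible A" unfolding A_def by (rule negligible_infinite_slope[OF F ab])
  ultimately have N: "negligible (A \<union> \<Union> ((\<lambda>(p, q). B p q) ` PQ))"
    by (intro negligible_Un negligible_countable_Union) auto
  have "F differentiable (at x)" if x: "x \<in> {a<..<b}" and nA: "x \<notin> A"
    and nB: "\<And>p q. (p, q) \<in> PQ \<Longrightarrow> x \<notin> B p q" for x
  proof -
    have near: "\<forall>\<^sub>F y in at x. y \<in> {a<..<b}"
      using x by (intro eventually_at_topological[THEN iffD2] exI[of _ "{a<..<b}"]) auto
    have ne: "\<forall>\<^sub>F y in at x. y \<noteq> x" by (simp add: eventually_at_filter)
    have nonneg: "\<forall>\<^sub>F y in at x. 0 \<le> diffquot F x y"
      using near
    proof eventually_elim
      case (elim y)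
      have "F x \<le> F y" if "x \<le> y" using F x elim that by (auto simp: mono_on_def)
      moreover have "F y \<le> F x" if "y \<le> x" using F x elim that by (auto simp: mono_on_def)
      ultimately show ?case
        by (cases "x \<le> y") (auto simp: diffquot_def divide_nonpos_nonpos)
    qed
    obtain q0 where q0: "\<forall>\<^sub>F y in at x. diffquot F x y \<le> q0"
      using nA x by (auto simp: A_def not_frequently not_less)
    define L0 where "L0 = {p. \<forall>\<^sub>F y in at x. p \<le> diffquot F x y}"
    have "0 \<in> L0" using nonneg by (simp add: L0_def)
    have up: "p \<le> q0" if "p \<in> L0" for p
    proof -
      have "\<forall>\<^sub>F y in at x. p \<le> q0"
        using that q0 unfolding L0_def mem_Collect_eq by eventually_elim linarith
      then show ?thesis by simp
    qed
    have bdd: "bdd_above L0" using up by (auto simp: bdd_above_def)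
    define L where "L = Sup L0"
    have L0: "0 \<le> L" unfolding L_def using \<open>0 \<in> L0\<close> bdd by (rule cSup_upper)
    have "(diffquot F x \<longlongrightarrow> L) (at x)"
    proof (rule order_tendstoI)
      fix e assume "e < L"
      then obtain p where "p \<in> L0" "e < p"
        using less_cSupE[of e L0] \<open>0 \<in> L0\<close> unfolding L_def by blast
      then show "\<forall>\<^sub>F y in at x. e < diffquot F x y"
        unfolding L0_def by (auto elim!: eventually_mono)
    next
      fix e assume "L < e"
      then obtain q where q: "q \<in> \<rat>" "L < q" "q < e" using Rats_dense_in_real by blast
      obtain p where p: "p \<in> \<rat>" "L < p" "p < q" using Rats_dense_in_real[OF q(2)] by blast
      have "p \<notin> L0" using p cSup_upper[OF _ bdd, of p] unfolding L_def by force
      then have "\<exists>\<^sub>F y in at x. diffquot F x y < p"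
        by (simp add: L0_def not_eventually not_le)
      moreover have "(p, q) \<in> PQ" using p q L0 by (auto simp: PQ_def)
      ultimately have "\<not> (\<exists>\<^sub>F y in at x. q < diffquot F x y)"
        using nB[of p q] x by (auto simp: B_def)
      then show "\<forall>\<^sub>F y in at x. diffquot F x y < e"
        using q by (auto simp: not_frequently not_less elim!: eventually_mono)
    qed
    then have "(F has_field_derivative L) (at x)"
      by (simp add: has_field_derivative_iff diffquot_def[abs_def])
    then show ?thesis
      using real_differentiable_def by blast
  qed
  then have "{x\<in>{a<..<b}. \<not> F differentiable (at x)} \<subseteq> A \<union> \<Union> ((\<lambda>(p, q). B p q) ` PQ)"
    by blast
  then show ?thesis using N negligible_subset by blast
qed simp

text \<open>Families of intervals are indexed by an arbitrary set, so that a family can be transported by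
  changing its endpoint maps without forming images of sets of pairs.\<close>

definition disjoint_intervals :: "real \<Rightarrow> real \<Rightarrow> 'i set \<Rightarrow> ('i \<Rightarrow> real) \<Rightarrow> ('i \<Rightarrow> real) \<Rightarrow> bool" where
  "disjoint_intervals a b X l u \<longleftrightarrow> finite X \<and> (\<forall>x\<in>X. a \<le> l x \<and> l x < u x \<and> u x \<le> b) \<and>
     (\<forall>x\<in>X. \<forall>y\<in>X. x \<noteq> y \<longrightarrow> {l x<..<u x} \<inter> {l y<..<u y} = {})"

lemma disjoint_intervals_image:
  assumes "disjoint_intervals a b X l u"
  shows "inj_on (\<lambda>x. (l x, u x)) X" "disjoint_intervals a b ((\<lambda>x. (l x, u x)) ` X) fst snd"
proof -
  show "inj_on (\<lambda>x. (l x, u x)) X"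
  proof (rule inj_onI, rule ccontr)
    fix x y assume xy: "x \<in> X" "y \<in> X" "(l x, u x) = (l y, u y)" "x \<noteq> y"
    then have "(l x + u x) / 2 \<in> {l x<..<u x} \<inter> {l y<..<u y}"
      using assms by (auto simp: disjoint_intervals_def)
    then show False using assms xy unfolding disjoint_intervals_def by blast
  qed
  show "disjoint_intervals a b ((\<lambda>x. (l x, u x)) ` X) fst snd"
    using assms unfolding disjoint_intervals_def by (simp add: image_iff) metis
qed

lemma abs_continuous_on_iff:
  "abs_continuous_on a b f \<longleftrightarrow> (\<forall>e>0. \<exists>\<delta>>0. \<forall>I. disjoint_intervals a b I fst snd \<longrightarrow>
     (\<Sum>i\<in>I. snd i - fst i) < \<delta> \<longrightarrow> (\<Sum>i\<in>I. norm (f (snd i) - f (fst i))) < e)"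
  unfolding abs_continuous_on_def disjoint_intervals_def disjoint_family_on_def case_prod_unfold
  by (simp only: conj_assoc imp_conjL)

lemma abs_continuous_onE:
  assumes "abs_continuous_on a b f" "0 < e"
  shows "\<exists>\<delta>>0. \<forall>(X::'i set) l u. disjoint_intervals a b X l u \<longrightarrow>
       (\<Sum>x\<in>X. u x - l x) < \<delta> \<longrightarrow> (\<Sum>x\<in>X. norm (f (u x) - f (l x))) < e"
proof -
  obtain \<delta> where \<delta>: "0 < \<delta>" and H: "\<forall>I. disjoint_intervals a b I fst snd \<longrightarrow>
     (\<Sum>i\<in>I. snd i - fst i) < \<delta> \<longrightarrow> (\<Sum>i\<in>I. norm (f (snd i) - f (fst i))) < e"
    using assms unfolding abs_continuous_on_iff by blast
  have "(\<Sum>x\<in>X. norm (f (u x) - f (l x))) < e"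
    if X: "disjoint_intervals a b X l u" and sm: "(\<Sum>x\<in>X. u x - l x) < \<delta>" for X :: "'i set" and l u
    using H[rule_format, OF disjoint_intervals_image(2)[OF X]] sm
    by (simp add: sum.reindex[OF disjoint_intervals_image(1)[OF X]])
  then show ?thesis using \<delta> by blast
qed

lemma abs_continuous_on_lipschitz:
  assumes f: "abs_continuous_on a b f"
    and K: "\<And>s t. s \<in> {a..b} \<Longrightarrow> t \<in> {a..b} \<Longrightarrow> norm (h t - h s) \<le> K * norm (f t - f s)"
  shows "abs_continuous_on a b h"
unfolding abs_continuous_on_iff
proof (intro allI impI)
  fix e :: real assume e: "0 < e"
  have K1: "0 < \<bar>K\<bar> + 1" by simp
  obtain \<delta> where \<delta>: "0 < \<delta>" and H: "\<forall>(X::(real \<times> real) set) l u. disjoint_intervals a b X l u \<longrightarrow>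
       (\<Sum>x\<in>X. u x - l x) < \<delta> \<longrightarrow> (\<Sum>x\<in>X. norm (f (u x) - f (l x))) < e / (\<bar>K\<bar> + 1)"
    using abs_continuous_onE[OF f, of "e / (\<bar>K\<bar> + 1)"] e K1 divide_pos_pos[OF e K1] by blast
  show "\<exists>\<delta>>0. \<forall>I. disjoint_intervals a b I fst snd \<longrightarrow>
     (\<Sum>i\<in>I. snd i - fst i) < \<delta> \<longrightarrow> (\<Sum>i\<in>I. norm (h (snd i) - h (fst i))) < e"
  proof (intro exI[of _ \<delta>] conjI \<delta> allI impI)
    fix I :: "(real \<times> real) set"
    assume I0: "disjoint_intervals a b I fst snd" and sm: "(\<Sum>i\<in>I. snd i - fst i) < \<delta>"
    then have I: "finite I" "\<forall>i\<in>I. a \<le> fst i \<and> fst i < snd i \<and> snd i \<le> b"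
      by (auto simp: disjoint_intervals_def)
    have "(\<Sum>i\<in>I. norm (h (snd i) - h (fst i))) \<le> (\<Sum>i\<in>I. (\<bar>K\<bar> + 1) * norm (f (snd i) - f (fst i)))"
    proof (rule sum_mono)
      fix i assume "i \<in> I"
      then have "a \<le> fst i \<and> fst i < snd i \<and> snd i \<le> b" using I(2) by blast
      then have "norm (h (snd i) - h (fst i)) \<le> K * norm (f (snd i) - f (fst i))"
        by (intro K) auto
      also have "\<dots> \<le> (\<bar>K\<bar> + 1) * norm (f (snd i) - f (fst i))"
        by (rule mult_right_mono) auto
      finally show "norm (h (snd i) - h (fst i)) \<le> (\<bar>K\<bar> + 1) * norm (f (snd i) - f (fst i))" .
    qed
    also have "\<dots> = (\<bar>K\<bar> + 1) * (\<Sum>i\<in>I. norm (f (snd i) - f (fst i)))"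
      by (simp add: sum_distrib_left)
    also have "\<dots> < (\<bar>K\<bar> + 1) * (e / (\<bar>K\<bar> + 1))"
      using H[rule_format, OF I0 sm] by (rule mult_strict_left_mono[OF _ K1])
    finally show "(\<Sum>i\<in>I. norm (h (snd i) - h (fst i))) < e" using K1 by simp
  qed
qed

lemma abs_continuous_on_ident: "abs_continuous_on a b (\<lambda>x::real. x)"
unfolding abs_continuous_on_iff
proof (intro allI impI)
  fix e :: real assume e: "0 < e"
  show "\<exists>\<delta>>0. \<forall>I. disjoint_intervals a b I fst snd \<longrightarrow>
     (\<Sum>i\<in>I. snd i - fst i) < \<delta> \<longrightarrow> (\<Sum>i\<in>I. norm (snd i - fst i)) < e"
  proof (intro exI[of _ e] conjI e allI impI)
    fix I :: "(real \<times> real) set"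
    assume I: "disjoint_intervals a b I fst snd" and "(\<Sum>i\<in>I. snd i - fst i) < e"
    moreover have "(\<Sum>i\<in>I. norm (snd i - fst i)) = (\<Sum>i\<in>I. snd i - fst i)"
      using I by (intro sum.cong) (auto simp: disjoint_intervals_def)
    ultimately show "(\<Sum>i\<in>I. norm (snd i - fst i)) < e" by simp
  qed
qed

lemma abs_continuous_on_combine:
  assumes 1: "abs_continuous_on a m f" and 2: "abs_continuous_on m b f"
  shows "abs_continuous_on a b f"
unfolding abs_continuous_on_iff
proof (intro allI impI)
  fix e :: real assume e: "0 < e"
  obtain \<delta>1 where \<delta>1: "0 < \<delta>1" and H1: "\<forall>(X::(real \<times> real) set) l u. disjoint_intervals a m X l u \<longrightarrow>
       (\<Sum>x\<in>X. u x - l x) < \<delta>1 \<longrightarrow> (\<Sum>x\<in>X. norm (f (u x) - f (l x))) < e / 2"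
    using abs_continuous_onE[OF 1, of "e / 2"] half_gt_zero[OF e] by blast
  obtain \<delta>2 where \<delta>2: "0 < \<delta>2" and H2: "\<forall>(X::(real \<times> real) set) l u. disjoint_intervals m b X l u \<longrightarrow>
       (\<Sum>x\<in>X. u x - l x) < \<delta>2 \<longrightarrow> (\<Sum>x\<in>X. norm (f (u x) - f (l x))) < e / 2"
    using abs_continuous_onE[OF 2, of "e / 2"] half_gt_zero[OF e] by blast
  show "\<exists>\<delta>>0. \<forall>I. disjoint_intervals a b I fst snd \<longrightarrow>
     (\<Sum>i\<in>I. snd i - fst i) < \<delta> \<longrightarrow> (\<Sum>i\<in>I. norm (f (snd i) - f (fst i))) < e"
  proof (intro exI[of _ "min \<delta>1 \<delta>2"] conjI allI impI)
    show "0 < min \<delta>1 \<delta>2" using \<delta>1 \<delta>2 by simp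
    fix I :: "(real \<times> real) set"
    assume I0: "disjoint_intervals a b I fst snd"
      and sm: "(\<Sum>i\<in>I. snd i - fst i) < min \<delta>1 \<delta>2"
    then have fin: "finite I" and ab: "\<And>i. i \<in> I \<Longrightarrow> a \<le> fst i \<and> fst i < snd i \<and> snd i \<le> b"
      and dj: "\<And>i j. i \<in> I \<Longrightarrow> j \<in> I \<Longrightarrow> i \<noteq> j \<Longrightarrow> {fst i<..<snd i} \<inter> {fst j<..<snd j} = {}"
      by (auto simp: disjoint_intervals_def)
    \<comment> \<open>An interval that contains \<open>m\<close> is cut at \<open>m\<close>.\<close>
    define I1 I2 where "I1 = {i\<in>I. fst i < m}" and "I2 = {i\<in>I. m < snd i}"
    have fin12: "finite I1" "finite I2" using fin by (auto simp: I1_def I2_def)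
    have d1: "disjoint_intervals a m I1 fst (\<lambda>i. min (snd i) m)"
      unfolding disjoint_intervals_def
    proof (intro conjI ballI impI)
      fix i j assume "i \<in> I1" "j \<in> I1" "i \<noteq> j"
      then show "{fst i<..<min (snd i) m} \<inter> {fst j<..<min (snd j) m} = {}"
        using dj[of i j] by (fastforce simp: I1_def)
    qed (use ab fin12 in \<open>auto simp: I1_def\<close>)
    have d2: "disjoint_intervals m b I2 (\<lambda>i. max (fst i) m) snd"
      unfolding disjoint_intervals_def
    proof (intro conjI ballI impI)
      fix i j assume "i \<in> I2" "j \<in> I2" "i \<noteq> j"
      then show "{max (fst i) m<..<snd i} \<inter> {max (fst j) m<..<snd j} = {}"
        using dj[of i j] by (fastforce simp: I2_def)
    qed (use ab fin12 in \<open>auto simp: I2_def\<close>)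
    have "(\<Sum>i\<in>I1. min (snd i) m - fst i) \<le> (\<Sum>i\<in>I1. snd i - fst i)"
      by (rule sum_mono) auto
    also have "\<dots> \<le> (\<Sum>i\<in>I. snd i - fst i)"
      by (rule sum_mono2[OF fin]) (use ab in \<open>force simp: I1_def\<close>)+
    finally have s1: "(\<Sum>i\<in>I1. norm (f (min (snd i) m) - f (fst i))) < e / 2"
      using sm by (intro H1[rule_format, OF d1]) simp
    have "(\<Sum>i\<in>I2. snd i - max (fst i) m) \<le> (\<Sum>i\<in>I2. snd i - fst i)"
      by (rule sum_mono) auto
    also have "\<dots> \<le> (\<Sum>i\<in>I. snd i - fst i)"
      by (rule sum_mono2[OF fin]) (use ab in \<open>force simp: I2_def\<close>)+
    finally have s2: "(\<Sum>i\<in>I2. norm (f (snd i) - f (max (fst i) m))) < e / 2"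
      using sm by (intro H2[rule_format, OF d2]) simp
    have "(\<Sum>i\<in>I. norm (f (snd i) - f (fst i))) \<le>
      (\<Sum>i\<in>I. (if fst i < m then norm (f (min (snd i) m) - f (fst i)) else 0) +
              (if m < snd i then norm (f (snd i) - f (max (fst i) m)) else 0))"
    proof (rule sum_mono)
      fix i assume "i \<in> I"
      show "norm (f (snd i) - f (fst i)) \<le> (if fst i < m then norm (f (min (snd i) m) - f (fst i)) else 0) +
              (if m < snd i then norm (f (snd i) - f (max (fst i) m)) else 0)"
      proof (cases "fst i < m \<and> m < snd i")
        case True
        then show ?thesis
          using norm_triangle_ineq[of "f m - f (fst i)" "f (snd i) - f m"] by auto
      next
        case False
        then show ?thesis using ab[OF \<open>i \<in> I\<close>] by (auto simp: min_def max_def)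
      qed
    qed
    also have "\<dots> = (\<Sum>i\<in>I1. norm (f (min (snd i) m) - f (fst i))) + (\<Sum>i\<in>I2. norm (f (snd i) - f (max (fst i) m)))"
      unfolding I1_def I2_def sum.distrib by (simp add: sum.inter_filter[OF fin])
    finally show "(\<Sum>i\<in>I. norm (f (snd i) - f (fst i))) < e" using s1 s2 by simp
  qed
qed

lemma abs_continuous_on_trivial: "b \<le> a \<Longrightarrow> abs_continuous_on a b f"
proof -
  assume "b \<le> a"
  then have "I = {}" if "disjoint_intervals a b I fst snd" for I :: "(real \<times> real) set"
    using that unfolding disjoint_intervals_def by force
  then show ?thesis
    unfolding abs_continuous_on_iff by (metis sum.empty zero_less_one)
qed

text \<open>By bisection of the interval.\<close>

lemma abs_continuous_on_local:
  assumes "\<And>x. x \<in> {a..b} \<Longrightarrow> \<exists>d>0. \<forall>r s. a \<le> r \<and> r \<le> x \<and> x \<le> s \<and> s \<le> b \<and> s - r < d \<longrightarrow> abs_continuous_on r s f"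
  shows "abs_continuous_on a b f"
proof (cases "a \<le> b")
  case True
  have "abs_continuous_on (max a a) (min b b) f"
    using True
  proof (induction rule: Bolzano[where P = "\<lambda>r s. abs_continuous_on (max a r) (min b s) f"])
    case (trans r m s)
    show ?case
    proof (cases "a \<le> m \<and> m \<le> b")
      case True
      then have "abs_continuous_on (max a r) m f" "abs_continuous_on m (min b s) f"
        using trans(1,2) by (simp_all add: min_absorb2 max_absorb2)
      then show ?thesis by (rule abs_continuous_on_combine)
    next
      case False
      then show ?thesis using trans by (auto simp: max_def min_def split: if_splits intro: abs_continuous_on_trivial)
    qed
  next
    case (local x)
    then obtain d where "d > 0" and d: "\<forall>r s. a \<le> r \<and> r \<le> x \<and> x \<le> s \<and> s \<le> b \<and> s - r < d \<longrightarrow> abs_continuous_on r s f"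
      using assms[of x] by auto
    then show ?case using local by (intro exI[of _ d]) auto
  qed
  then show ?thesis by simp
qed (simp add: abs_continuous_on_trivial)

lemma abs_continuous_on_affine:
  assumes f: "abs_continuous_on a' b' f" and k: "k \<noteq> 0"
    and im: "\<And>s. s \<in> {a..b} \<Longrightarrow> k * s + t \<in> {a'..b'}"
  shows "abs_continuous_on a b (\<lambda>s. f (k * s + t))"
unfolding abs_continuous_on_iff
proof (intro allI impI)
  fix e :: real assume e: "0 < e"
  obtain \<delta> where \<delta>: "0 < \<delta>" and H: "\<forall>(X::(real \<times> real) set) l u. disjoint_intervals a' b' X l u \<longrightarrow>
       (\<Sum>x\<in>X. u x - l x) < \<delta> \<longrightarrow> (\<Sum>x\<in>X. norm (f (u x) - f (l x))) < e"
    using abs_continuous_onE[OF f, of "e"] e by blast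
  let ?g = "\<lambda>s. k * s + t"
  let ?l = "\<lambda>i. min (?g (fst i)) (?g (snd i))" and ?u = "\<lambda>i. max (?g (fst i)) (?g (snd i))"
  show "\<exists>\<delta>>0. \<forall>I. disjoint_intervals a b I fst snd \<longrightarrow>
     (\<Sum>i\<in>I. snd i - fst i) < \<delta> \<longrightarrow> (\<Sum>i\<in>I. norm (f (?g (snd i)) - f (?g (fst i)))) < e"
  proof (intro exI[of _ "\<delta> / \<bar>k\<bar>"] conjI allI impI)
    show "0 < \<delta> / \<bar>k\<bar>" using \<delta> k by simp
    fix I :: "(real \<times> real) set"
    assume I0: "disjoint_intervals a b I fst snd"
      and sm: "(\<Sum>i\<in>I. snd i - fst i) < \<delta> / \<bar>k\<bar>"
    then have fin: "finite I" and ab: "\<And>i. i \<in> I \<Longrightarrow> a \<le> fst i \<and> fst i < snd i \<and> snd i \<le> b"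
      and dj: "\<And>i j. i \<in> I \<Longrightarrow> j \<in> I \<Longrightarrow> i \<noteq> j \<Longrightarrow> {fst i<..<snd i} \<inter> {fst j<..<snd j} = {}"
      by (auto simp: disjoint_intervals_def)
    have d: "disjoint_intervals a' b' I ?l ?u"
      unfolding disjoint_intervals_def
    proof (intro conjI ballI impI fin)
      fix i assume i: "i \<in> I"
      have "?g (fst i) \<in> {a'..b'}" "?g (snd i) \<in> {a'..b'}" using im ab[OF i] by auto
      moreover have "?g (fst i) \<noteq> ?g (snd i)" using ab[OF i] k by auto
      then have "?g (fst i) < ?g (snd i) \<or> ?g (snd i) < ?g (fst i)" by (rule linorder_neqE) auto
      ultimately show "a' \<le> ?l i" "?l i < ?u i" "?u i \<le> b'" by auto
    next
      fix i j assume ij: "i \<in> I" "j \<in> I" "i \<noteq> j"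
      have pre: "(z - t) / k \<in> {fst i<..<snd i}" if "z \<in> {?l i<..<?u i}" "i \<in> I" for i z
        using that(1) k ab[OF that(2)]
        by (cases "k > 0") (auto simp: min_def max_def field_simps split: if_splits)
      show "{?l i<..<?u i} \<inter> {?l j<..<?u j} = {}"
        using pre ij dj by blast
    qed
    have "(\<Sum>i\<in>I. norm (f (?u i) - f (?l i))) < e"
    proof (rule H[rule_format, OF d])
      have "(\<Sum>i\<in>I. ?u i - ?l i) = (\<Sum>i\<in>I. \<bar>k\<bar> * (snd i - fst i))"
      proof (rule sum.cong)
        fix i assume "i \<in> I"
        then have "fst i \<le> snd i" using ab[of i] by simp
        then have "?u i - ?l i = \<bar>k * (snd i - fst i)\<bar>" by (auto simp: max_def min_def algebra_simps)
        then show "?u i - ?l i = \<bar>k\<bar> * (snd i - fst i)" using \<open>fst i \<le> snd i\<close> by (simp add: abs_mult)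
      qed simp
      also have "\<dots> = \<bar>k\<bar> * (\<Sum>i\<in>I. snd i - fst i)" by (simp add: sum_distrib_left)
      also have "\<dots> < \<delta>" using sm k by (simp add: pos_less_divide_eq mult.commute)
      finally show "(\<Sum>i\<in>I. ?u i - ?l i) < \<delta>" .
    qed
    moreover have "norm (f (?u i) - f (?l i)) = norm (f (?g (snd i)) - f (?g (fst i)))" for i
      by (auto simp: max_def min_def norm_minus_commute)
    ultimately show "(\<Sum>i\<in>I. norm (f (?g (snd i)) - f (?g (fst i)))) < e" by simp
  qed
qed

text \<open>On an interval where the total variation is finite, the variation function \<open>V\<close> and \<open>V + f\<close>
  are monotone; an absolutely continuous function has finite variation on short intervals.\<close>

lemma abs_continuous_differentiable_ae:
  fixes f :: "real \<Rightarrow> real"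
  assumes f: "abs_continuous_on a b f"
  shows "negligible {x\<in>{a<..<b}. \<not> f differentiable (at x)}"
proof -
  obtain \<delta> where \<delta>: "0 < \<delta>" and H: "\<forall>(X::(real \<times> real) set) l u. disjoint_intervals a b X l u \<longrightarrow>
       (\<Sum>x\<in>X. u x - l x) < \<delta> \<longrightarrow> (\<Sum>x\<in>X. norm (f (u x) - f (l x))) < 1"
    using abs_continuous_onE[OF f, of "1"] zero_less_one by blast
  have short: "negligible {x\<in>{r<..<s}. \<not> f differentiable (at x)}"
    if rs: "a \<le> r" "s \<le> b" "s - r < \<delta>" for r s
  proof -
    define fam where "fam t = {I :: (real \<times> real) set. disjoint_intervals r t I fst snd}" for t
    define var where "var I = (\<Sum>i\<in>I. norm (f (snd i) - f (fst i)))" for I :: "(real \<times> real) set"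
    define V where "V t = Sup (var ` fam t)" for t
    have vb: "var I \<le> 1" if I: "I \<in> fam t" and t: "t \<le> s" for I t
    proof -
      have I': "finite I" "\<And>i. i \<in> I \<Longrightarrow> r \<le> fst i \<and> fst i < snd i \<and> snd i \<le> t"
        "\<And>i j. i \<in> I \<Longrightarrow> j \<in> I \<Longrightarrow> i \<noteq> j \<Longrightarrow> {fst i<..<snd i} \<inter> {fst j<..<snd j} = {}"
        using I by (auto simp: fam_def disjoint_intervals_def)
      have "(\<Sum>i\<in>I. snd i - fst i) = (\<Sum>i\<in>I. measure lebesgue {fst i<..<snd i})"
        using I'(2) by (intro sum.cong) (auto simp: less_imp_le)
      also have "\<dots> = measure lebesgue (\<Union>i\<in>I. {fst i<..<snd i})"
        by (rule measure_UNION'[symmetric]) (use I' in \<open>auto simp: pairwise_def disjnt_def\<close>)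
      also have "\<dots> \<le> measure lebesgue {r..max r s}"
      proof (rule measure_mono_fmeasurable)
        show "(\<Union>i\<in>I. {fst i<..<snd i}) \<subseteq> {r..max r s}"
        proof (rule UN_least)
          fix i assume "i \<in> I"
          then show "{fst i<..<snd i} \<subseteq> {r..max r s}" using I'(2)[of i] t by auto
        qed
      qed (use I' in \<open>auto intro!: sets.finite_UN\<close>)
      also have "\<dots> < \<delta>" using rs \<delta> by (auto simp: max_def)
      finally have sm: "(\<Sum>i\<in>I. snd i - fst i) < \<delta>" .
      have "disjoint_intervals a b I fst snd"
        using I rs t unfolding fam_def disjoint_intervals_def by force
      from H[rule_format, OF this sm] have "var I < 1" unfolding var_def .
      then show ?thesis by simp
    qed
    have bdd: "bdd_above (var ` fam t)" if "t \<le> s" for t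
      using vb that by (intro bdd_aboveI[of _ 1]) auto
    have ne: "var ` fam t \<noteq> {}" for t
      by (auto simp: fam_def disjoint_intervals_def intro!: exI[of _ "{}"])
    have step: "V t + \<bar>f u - f t\<bar> \<le> V u" if tu: "r \<le> t" "t < u" "u \<le> s" for t u
    proof -
      have "V t \<le> V u - \<bar>f u - f t\<bar>"
        unfolding V_def[of t]
      proof (rule cSup_least[OF ne])
        fix v assume "v \<in> var ` fam t"
        then obtain I where I: "I \<in> fam t" "v = var I" by auto
        have I': "finite I" "\<And>i. i \<in> I \<Longrightarrow> r \<le> fst i \<and> fst i < snd i \<and> snd i \<le> t"
          "\<And>i j. i \<in> I \<Longrightarrow> j \<in> I \<Longrightarrow> i \<noteq> j \<Longrightarrow> {fst i<..<snd i} \<inter> {fst j<..<snd j} = {}"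
          using I(1) by (auto simp: fam_def disjoint_intervals_def)
        have nin: "(t, u) \<notin> I" using I'(2)[of "(t, u)"] tu by auto
        have new: "{fst i<..<snd i} \<inter> {t<..<u} = {}" if "i \<in> I" for i
          using I'(2)[OF that] by auto
        have "disjoint_intervals r u (insert (t, u) I) fst snd"
          unfolding disjoint_intervals_def
        proof (intro conjI ballI impI)
          fix i j assume "i \<in> insert (t, u) I" "j \<in> insert (t, u) I" "i \<noteq> j"
          then show "{fst i<..<snd i} \<inter> {fst j<..<snd j} = {}"
            using new[of i] new[of j] I'(3)[of i j] by (cases "i = (t, u)"; cases "j = (t, u)") auto
        next
          fix i assume "i \<in> insert (t, u) I"
          then show "r \<le> fst i" "fst i < snd i" "snd i \<le> u" using I'(2)[of i] tu by (auto elim!: insertE)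
        qed (use I' in simp)
        then have "insert (t, u) I \<in> fam u"
          by (simp add: fam_def)
        then have "var (insert (t, u) I) \<le> V u"
          unfolding V_def using bdd[OF tu(3)] by (intro cSup_upper) auto
        moreover have "var (insert (t, u) I) = \<bar>f u - f t\<bar> + var I"
          using nin I'(1) by (simp add: var_def)
        ultimately show "v \<le> V u - \<bar>f u - f t\<bar>" using I(2) by simp
      qed
      then show ?thesis by simp
    qed
    have 1: "mono_on {r..s} V"
    proof (rule mono_onI)
      fix t u assume "t \<in> {r..s}" "u \<in> {r..s}" "t \<le> u"
      then show "V t \<le> V u" using step[of t u] by (cases "t = u") auto
    qed
    have 2: "mono_on {r..s} (\<lambda>t. V t + f t)"
    proof (rule mono_onI)
      fix t u assume "t \<in> {r..s}" "u \<in> {r..s}" "t \<le> u"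
      then show "V t + f t \<le> V u + f u" using step[of t u] by (cases "t = u") auto
    qed
    have "{x\<in>{r<..<s}. \<not> f differentiable (at x)} \<subseteq>
      {x\<in>{r<..<s}. \<not> V differentiable (at x)} \<union> {x\<in>{r<..<s}. \<not> (\<lambda>t. V t + f t) differentiable (at x)}"
    proof -
      have "f differentiable (at x)" if "V differentiable (at x)" "(\<lambda>t. V t + f t) differentiable (at x)" for x
        using differentiable_diff[OF that(2,1)] by simp
      then show ?thesis by blast
    qed
    from negligible_subset[OF negligible_Un[OF mono_differentiable_ae[OF 1] mono_differentiable_ae[OF 2]] this]
    show ?thesis .
  qed
  show ?thesis
  proof (cases "a \<le> b")
    case True
    have "negligible {x\<in>{a<..<b} \<inter> {a<..<b}. \<not> f differentiable (at x)}"
      using True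
    proof (induction rule: Bolzano[where P = "\<lambda>r s. negligible {x\<in>{a<..<b} \<inter> {r<..<s}. \<not> f differentiable (at x)}"])
      case (trans r m s)
      have "{x\<in>{a<..<b} \<inter> {r<..<s}. \<not> f differentiable (at x)} \<subseteq>
        {x\<in>{a<..<b} \<inter> {r<..<m}. \<not> f differentiable (at x)} \<union> {x\<in>{a<..<b} \<inter> {m<..<s}. \<not> f differentiable (at x)} \<union> {m}"
        by auto
      from negligible_subset[OF _ this] show ?case
        using trans(1,2) by (simp add: negligible_Un)
    next
      case (local x)
      show ?case
      proof (intro exI[of _ \<delta>] conjI \<delta> allI impI)
        fix r s assume "r \<le> x \<and> x \<le> s \<and> s - r < \<delta>"
        then have "negligible {x\<in>{max a r<..<min b s}. \<not> f differentiable (at x)}"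
          by (intro short) auto
        then show "negligible {x\<in>{a<..<b} \<inter> {r<..<s}. \<not> f differentiable (at x)}"
          by (rule negligible_subset) auto
      qed
    qed
    then show ?thesis by simp
  qed simp
qed

text \<open>The gauge handles the points of differentiability as in the usual fundamental theorem; the
  remaining points are caught in an open set so small that absolute continuity makes the
  corresponding increments negligible.\<close>

lemma abs_continuous_has_integral:
  fixes f :: "real \<Rightarrow> real"
  assumes f: "abs_continuous_on a b f" and ab: "a \<le> b"
  shows "((\<lambda>s. if f differentiable (at s) then vector_derivative f (at s) else 0)
    has_integral (f b - f a)) {a..b}"
proof -
  define D where "D = {s\<in>{a<..<b}. f differentiable (at s)}"
  define f' where "f' s = (if s \<in> D then vector_derivative f (at s) else 0)" for s
  have "{a..b} - D \<subseteq> {x\<in>{a<..<b}. \<not> f differentiable (at x)} \<union> {a, b}"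
    by (auto simp: D_def)
  moreover have "negligible ({x\<in>{a<..<b}. \<not> f differentiable (at x)} \<union> {a, b})"
    using abs_continuous_differentiable_ae[OF f] by (intro negligible_Un) auto
  ultimately have neg: "negligible ({a..b} - D)" by (rule negligible_subset[rotated])
  have "(f' has_integral (f b - f a)) (cbox a b)"
    unfolding has_integral
  proof (intro allI impI)
    fix e :: real assume e: "0 < e"
    define e' where "e' = e / (2 * (b - a) + 2)"
    have e': "0 < e'" "e' * (b - a) < e / 2" using e ab by (auto simp: e'_def field_simps)
    obtain \<delta> where \<delta>: "0 < \<delta>" and H: "\<forall>(X::(real \<times> real set) set) l u. disjoint_intervals a b X l u \<longrightarrow>
       (\<Sum>x\<in>X. u x - l x) < \<delta> \<longrightarrow> (\<Sum>x\<in>X. norm (f (u x) - f (l x))) < e / 2"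
      using abs_continuous_onE[OF f half_gt_zero[OF e]] by blast
    have nl: "{a..b} - D \<in> lmeasurable" "measure lebesgue ({a..b} - D) = 0"
      using neg by (auto intro: negligible_imp_measurable negligible_imp_measure0)
    obtain U where U: "open U" "{a..b} - D \<subseteq> U" "U \<in> lmeasurable" "measure lebesgue U < \<delta>"
      by (rule lmeasurable_outer_open[OF nl(1) \<delta>]) (use nl(2) in auto)
    have "\<exists>d>0. \<forall>y. \<bar>y - s\<bar> < d \<longrightarrow> \<bar>f y - f s - (y - s) * f' s\<bar> \<le> e' * \<bar>y - s\<bar>" if s: "s \<in> D" for s
    proof -
      have "(f has_vector_derivative f' s) (at s)"
        using s by (simp add: D_def f'_def vector_derivative_works)
      then have "(f has_derivative (\<lambda>h. h * f' s)) (at s)"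
        by (simp add: has_vector_derivative_def)
      then show ?thesis
        unfolding has_derivative_at_alt using e'(1) by (auto simp: abs_mult)
    qed
    then obtain d where d: "\<And>s. s \<in> D \<Longrightarrow> 0 < d s"
      "\<And>s y. s \<in> D \<Longrightarrow> \<bar>y - s\<bar> < d s \<Longrightarrow> \<bar>f y - f s - (y - s) * f' s\<bar> \<le> e' * \<bar>y - s\<bar>"
      by metis
    define \<gamma> where "\<gamma> s = (if s \<in> D then ball s (d s) else if s \<in> {a..b} then U else ball s 1)" for s
    have ga: "gauge \<gamma>" using d(1) U by (auto simp: gauge_def \<gamma>_def)
    have main: "norm ((\<Sum>(x,k)\<in>T. measure lborel k *\<^sub>R f' x) - (f b - f a)) < e"
      if T: "T tagged_division_of (cbox a b)" and fine: "\<gamma> fine T" for T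
    proof -
      note TD = tagged_division_ofD[OF T]
      have T': "T tagged_division_of {a..b}" using T by simp
      have iv: "\<exists>c d. k = {c..d} \<and> c \<le> x \<and> x \<le> d \<and> a \<le> c \<and> d \<le> b" if xk: "(x, k) \<in> T" for x k
      proof -
        obtain c d where k: "k = cbox c d" using TD(4)[OF xk] by auto
        have "x \<in> k" "k \<subseteq> {a..b}" using TD(2,3)[OF xk] by auto
        then show ?thesis using k by (intro exI[of _ c] exI[of _ d]) auto
      qed
      define l u where "l = (\<lambda>i :: real \<times> real set. Inf (snd i))" and "u = (\<lambda>i :: real \<times> real set. Sup (snd i))"
      have lu: "snd i = {l i..u i} \<and> l i \<le> fst i \<and> fst i \<le> u i \<and> a \<le> l i \<and> u i \<le> b"
        if i: "i \<in> T" for i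
      proof -
        obtain c d where k: "snd i = {c..d}" and cd: "c \<le> fst i" "fst i \<le> d" "a \<le> c" "d \<le> b"
          using iv[of "fst i" "snd i"] i by auto
        have "l i = c" "u i = d" using k cd(1,2) by (simp_all add: l_def u_def)
        then show ?thesis using k cd by simp
      qed
      have cont: "measure lborel (snd i) = u i - l i" if i: "i \<in> T" for i
      proof -
        have "snd i = {l i..u i}" "l i \<le> u i" using lu[OF i] by auto
        then show ?thesis by (simp only: content_real)
      qed
      define X where "X = {i\<in>T. fst i \<notin> D \<and> l i < u i}"
      have finT: "finite T" by (rule TD(1))
      have dj: "{l i<..<u i} \<inter> {l j<..<u j} = {}" if ij: "i \<in> T" "j \<in> T" "i \<noteq> j" for i j
      proof -
        have "interior (snd i) \<inter> interior (snd j) = {}"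
          using TD(5)[of "fst i" "snd i" "fst j" "snd j"] ij by (simp add: prod_eq_iff)
        moreover have "snd i = {l i..u i}" "snd j = {l j..u j}" using lu ij by blast+
        ultimately show ?thesis by (simp only: interior_atLeastAtMost_real)
      qed
      have dX: "disjoint_intervals a b X l u"
        unfolding disjoint_intervals_def
      proof (intro conjI ballI impI)
        show "finite X" using finT by (simp add: X_def)
        fix i assume "i \<in> X"
        then show "a \<le> l i" "l i < u i" "u i \<le> b" using lu[of i] by (auto simp: X_def)
      next
        fix i j assume "i \<in> X" "j \<in> X" "i \<noteq> j"
        then show "{l i<..<u i} \<inter> {l j<..<u j} = {}" using dj[of i j] by (simp add: X_def)
      qed
      have "(\<Sum>i\<in>X. u i - l i) = (\<Sum>i\<in>X. measure lebesgue {l i<..<u i})"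
        by (intro sum.cong) (auto simp: X_def)
      also have "\<dots> = measure lebesgue (\<Union>i\<in>X. {l i<..<u i})"
        by (rule measure_UNION'[symmetric])
           (use dX in \<open>auto simp: pairwise_def disjnt_def disjoint_intervals_def\<close>)
      also have "\<dots> \<le> measure lebesgue U"
      proof (rule measure_mono_fmeasurable)
        show "(\<Union>i\<in>X. {l i<..<u i}) \<subseteq> U"
        proof (rule UN_least)
          fix i assume i: "i \<in> X"
          then have "snd i \<subseteq> \<gamma> (fst i)" using fineD[OF fine, of "fst i" "snd i"] by (simp add: X_def)
          moreover have iT: "i \<in> T" "fst i \<notin> D" using i by (simp_all add: X_def)
          note lui = lu[OF iT(1), THEN conjunct1]
          have "a \<le> fst i" "fst i \<le> b" using lu[OF iT(1)] by linarith+
          then have "\<gamma> (fst i) = U" using iT(2) by (simp add: \<gamma>_def)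
          moreover have "{l i<..<u i} \<subseteq> snd i" by (subst lui) auto
          ultimately show "{l i<..<u i} \<subseteq> U" by simp
        qed
      qed (use dX U(3) in \<open>auto simp: disjoint_intervals_def intro!: sets.finite_UN\<close>)
      also have "\<dots> < \<delta>" by (rule U(4))
      finally have sX: "(\<Sum>i\<in>X. norm (f (u i) - f (l i))) < e / 2"
        by (rule H[rule_format, OF dX])
      have est: "\<bar>f (u i) - f (l i) - measure lborel (snd i) * f' (fst i)\<bar> \<le>
         e' * (u i - l i) + (if i \<in> X then norm (f (u i) - f (l i)) else 0)" if i: "i \<in> T" for i
      proof (cases "fst i \<in> D")
        case True
        let ?x = "fst i"
        have sub: "snd i \<subseteq> ball ?x (d ?x)" using fineD[OF fine, of ?x "snd i"] i True by (simp add: \<gamma>_def)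
        have le: "l i \<le> ?x" "?x \<le> u i" using lu[OF i] by auto
        have "{l i, u i} \<subseteq> snd i" using lu[OF i] by auto
        then have "\<bar>l i - ?x\<bar> < d ?x" "\<bar>u i - ?x\<bar> < d ?x" using sub by (auto simp: dist_real_def)
        then have "\<bar>f (l i) - f ?x - (l i - ?x) * f' ?x\<bar> \<le> e' * \<bar>l i - ?x\<bar>"
          "\<bar>f (u i) - f ?x - (u i - ?x) * f' ?x\<bar> \<le> e' * \<bar>u i - ?x\<bar>"
          using d(2)[OF True] by auto
        moreover have "f (u i) - f (l i) - (u i - l i) * f' ?x =
           (f (u i) - f ?x - (u i - ?x) * f' ?x) - (f (l i) - f ?x - (l i - ?x) * f' ?x)"
          by (simp add: algebra_simps)
        moreover have "e' * (u i - l i) = e' * \<bar>u i - ?x\<bar> + e' * \<bar>l i - ?x\<bar>"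
          using le by (simp add: algebra_simps)
        ultimately have "\<bar>f (u i) - f (l i) - (u i - l i) * f' ?x\<bar> \<le> e' * (u i - l i)" by linarith
        then show ?thesis using True cont[OF i] by (simp add: X_def)
      next
        case False
        have "0 \<le> e' * (u i - l i)" using e' lu[OF i] by simp
        moreover have "l i < u i \<or> u i = l i" using lu[OF i] by linarith
        ultimately show ?thesis using False i by (auto simp: X_def f'_def)
      qed
      have tot: "(\<Sum>i\<in>T. f (u i) - f (l i)) = f b - f a"
        using additive_tagged_division_1[OF ab T', of f]
        by (simp add: l_def u_def case_prod_unfold)
      have tot': "(\<Sum>i\<in>T. u i - l i) = b - a"
        using additive_tagged_division_1[OF ab T', of "\<lambda>x. x"]
        by (simp add: l_def u_def case_prod_unfold)
      have "norm ((\<Sum>(x,k)\<in>T. measure lborel k *\<^sub>R f' x) - (f b - f a)) =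
        \<bar>\<Sum>i\<in>T. f (u i) - f (l i) - measure lborel (snd i) * f' (fst i)\<bar>"
        by (simp only: sum_subtractf[of "\<lambda>i. f (u i) - f (l i)"] tot case_prod_unfold
            abs_minus_commute real_norm_def real_scaleR_def)
      also have "\<dots> \<le> (\<Sum>i\<in>T. \<bar>f (u i) - f (l i) - measure lborel (snd i) * f' (fst i)\<bar>)"
        by (rule sum_abs)
      also have "\<dots> \<le> (\<Sum>i\<in>T. e' * (u i - l i) + (if i \<in> X then norm (f (u i) - f (l i)) else 0))"
        by (rule sum_mono) (rule est)
      also have "\<dots> = e' * (b - a) + (\<Sum>i\<in>X. norm (f (u i) - f (l i)))"
      proof -
        have "(\<Sum>i\<in>T. if i \<in> X then norm (f (u i) - f (l i)) else 0) = (\<Sum>i\<in>X. norm (f (u i) - f (l i)))"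
          by (rule sum.mono_neutral_cong_right) (auto simp: X_def finT)
        then show ?thesis by (simp add: sum.distrib sum_distrib_left[symmetric] tot')
      qed
      also have "\<dots> < e" using sX e' by simp
      finally show ?thesis .
    qed
    show "\<exists>\<gamma>. gauge \<gamma> \<and> (\<forall>T. T tagged_division_of (cbox a b) \<and> \<gamma> fine T \<longrightarrow>
        norm ((\<Sum>(x,k)\<in>T. measure lborel k *\<^sub>R f' x) - (f b - f a)) < e)"
      by (intro exI[of _ \<gamma>] conjI ga allI impI, elim conjE) (rule main)
  qed
  then have 1: "(f' has_integral (f b - f a)) {a..b}" by simp
  have fin2: "negligible {a, b}" by simp
  show ?thesis
    by (rule has_integral_spike[OF fin2 _ 1]) (auto simp: f'_def D_def)
qed

text \<open>Cauchy--Schwarz for the increment of an absolutely continuous curve, in the direction of the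
  increment.\<close>

lemma abs_continuous_increment_le:
  fixes f :: "real \<Rightarrow> 'a::real_inner" and F :: "real \<Rightarrow> ennreal"
  assumes f: "abs_continuous_on a b f" and ab: "a \<le> b"
    and F: "AE s in lebesgue. s \<in> {a<..<b} \<longrightarrow> f differentiable (at s) \<and>
       ennreal ((norm (vector_derivative f (at s)))\<^sup>2) \<le> F s"
  shows "ennreal ((norm (f b - f a))\<^sup>2) \<le> ennreal (b - a) * (\<integral>\<^sup>+s\<in>{a..b}. F s \<partial>lebesgue)"
proof (cases "f b = f a \<or> (\<integral>\<^sup>+s\<in>{a..b}. F s \<partial>lebesgue) = \<infinity>")
  case True
  then show ?thesis
  proof
    assume "(\<integral>\<^sup>+s\<in>{a..b}. F s \<partial>lebesgue) = \<infinity>"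
    then show ?thesis using ab by (cases "a = b") (auto simp: ennreal_mult_top)
  qed simp
next
  case False
  define R where "R = norm (f b - f a)"
  have R: "0 < R" using False by (simp add: R_def)
  define v where "v = (1 / R) *\<^sub>R (f b - f a)"
  have nv: "norm v = 1" using R by (simp add: v_def R_def)
  have ab': "a < b" using ab False by force
  define \<phi> where "\<phi> s = inner (f s) v" for s
  have inc: "\<phi> b - \<phi> a = R"
  proof -
    have "\<phi> b - \<phi> a = inner (f b - f a) v" by (simp add: \<phi>_def inner_diff_left)
    also have "\<dots> = R" using R by (simp add: v_def R_def dot_square_norm power2_eq_square)
    finally show ?thesis .
  qed
  have ac: "abs_continuous_on a b \<phi>"
  proof (rule abs_continuous_on_lipschitz[OF f])
    fix s t
    have "\<bar>inner (f t - f s) v\<bar> \<le> norm (f t - f s)"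
      using Cauchy_Schwarz_ineq2[of "f t - f s" v] nv by simp
    then show "norm (\<phi> t - \<phi> s) \<le> 1 * norm (f t - f s)"
      by (simp add: \<phi>_def inner_diff_left)
  qed
  define p where "p s = (if \<phi> differentiable (at s) then vector_derivative \<phi> (at s) else 0)" for s
  have I: "(p has_integral R) {a..b}"
    using abs_continuous_has_integral[OF ac ab] unfolding p_def inc .
  define J where "J = (\<integral>\<^sup>+s\<in>{a..b}. F s \<partial>lebesgue)"
  have meas: "(\<lambda>s. indicator {a..b} s * p s) \<in> borel_measurable lebesgue"
    using has_integral_implies_lebesgue_measurable[OF I] by simp
  have ple: "ennreal ((p s)\<^sup>2) \<le> F s" if "f differentiable (at s)"
    "ennreal ((norm (vector_derivative f (at s)))\<^sup>2) \<le> F s" for s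
  proof -
    have "(f has_vector_derivative vector_derivative f (at s)) (at s)"
      using that(1) by (simp add: vector_derivative_works)
    then have "(\<phi> has_vector_derivative inner (vector_derivative f (at s)) v) (at s)"
      unfolding \<phi>_def has_vector_derivative_def
      by (auto intro!: derivative_eq_intros)
    then have "p s = inner (vector_derivative f (at s)) v"
      by (simp add: p_def vector_derivative_at differentiableI_vector)
    then have "\<bar>p s\<bar> \<le> norm (vector_derivative f (at s))"
      using Cauchy_Schwarz_ineq2[of "vector_derivative f (at s)" v] nv by simp
    then have "(p s)\<^sup>2 \<le> (norm (vector_derivative f (at s)))\<^sup>2"
      using power_mono[of "\<bar>p s\<bar>" _ 2] by simp
    then show ?thesis using that(2) by (meson ennreal_leI order_trans)
  qed
  have "AE s in lebesgue. s \<notin> {a, b}"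
    using AE_not_in[of "{a, b}" lebesgue] negligible_iff_null_sets[of "{a, b}"] by simp
  then have bound: "(\<integral>\<^sup>+s. ennreal ((indicator {a..b} s * p s)\<^sup>2) \<partial>lebesgue) \<le> J"
    unfolding J_def
  proof (intro nn_integral_mono_AE)
    show "AE s in lebesgue. ennreal ((indicator {a..b} s * p s)\<^sup>2) \<le> F s * indicator {a..b} s"
      using F \<open>AE s in lebesgue. s \<notin> {a, b}\<close>
      by eventually_elim (auto simp: indicator_def intro: ple)
  qed
  have "J \<noteq> \<infinity>" using False by (simp add: J_def)
  then have int: "integrable lebesgue (\<lambda>s. (indicator {a..b} s * p s)\<^sup>2)"
    using bound meas by (intro integrableI_bounded) (auto simp: top.not_eq_extremum le_less_trans)
  define Q where "Q = (\<integral>s. (indicator {a..b} s * p s)\<^sup>2 \<partial>lebesgue)"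
  have QJ: "ennreal Q \<le> J"
    using bound nn_integral_eq_integral[OF int] by (simp add: Q_def)
  have Q0: "0 \<le> Q" by (simp add: Q_def)
  have "((\<lambda>s. (indicator {a..b} s * p s)\<^sup>2) has_integral Q) UNIV"
    unfolding Q_def by (rule has_integral_integral_lebesgue[OF int])
  then have "((\<lambda>s. if s \<in> {a..b} then (p s)\<^sup>2 else 0) has_integral Q) UNIV"
    by (rule has_integral_eq[rotated]) (simp add: indicator_def)
  then have I2: "((\<lambda>s. (p s)\<^sup>2) has_integral Q) {a..b}"
    by (rule has_integral_restrict_UNIV[THEN iffD1])
  \<comment> \<open>Integrate \<open>(p - \<lambda>)\<^sup>2 \<ge> 0\<close> with the mean value \<open>\<lambda>\<close> of \<open>p\<close>.\<close>
  define m where "m = R / (b - a)"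
  have "((\<lambda>s. (p s)\<^sup>2 - (2 * m) * p s + m\<^sup>2) has_integral (Q - (2 * m) * R + (b - a) * m\<^sup>2)) {a..b}"
    by (intro has_integral_add has_integral_diff I2 has_integral_mult_right I)
       (use has_integral_const_real[of "m\<^sup>2" a b] ab in simp)
  moreover have "(p s)\<^sup>2 - (2 * m) * p s + m\<^sup>2 = (p s - m)\<^sup>2" for s
    by (simp add: power2_diff)
  ultimately have "0 \<le> Q - (2 * m) * R + (b - a) * m\<^sup>2"
    by (metis (no_types, lifting) has_integral_nonneg zero_le_power2)
  moreover have "(b - a) * m\<^sup>2 = m * R" using ab' by (simp add: m_def power2_eq_square)
  ultimately have "m * R \<le> Q" by (simp add: mult.commute)
  then have "R\<^sup>2 \<le> (b - a) * Q"
    using ab' by (simp add: m_def power2_eq_square field_simps)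
  then have "ennreal (R\<^sup>2) \<le> ennreal (b - a) * ennreal Q"
    using ab Q0 by (simp add: ennreal_mult[symmetric] ennreal_leI)
  also have "\<dots> \<le> ennreal (b - a) * J"
    using QJ by (rule mult_left_mono) simp
  finally show ?thesis by (simp add: R_def J_def)
qed

section \<open>The model space\<close>

text \<open>Gram--Schmidt, followed by normalizing the nonzero vectors.\<close>

lemma orthonormal_spanning_set:
  fixes B :: "'e::real_inner set"
  assumes "finite B" "span B = UNIV"
  obtains C :: "'e set" where "finite C" "\<And>b. b \<in> C \<Longrightarrow> norm b = 1"
    "\<And>u. u = (\<Sum>b\<in>C. inner u b *\<^sub>R b)"
proof -
  obtain C0 :: "'e set" where C0: "finite C0" "span C0 = UNIV" "pairwise orthogonal C0"
    using basis_orthogonal[OF assms(1)] assms(2) by metis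
  define C where "C = (\<lambda>b. b /\<^sub>R norm b) ` (C0 - {0})"
  have fin: "finite C" using C0 by (simp add: C_def)
  have n1: "norm b = 1" if b: "b \<in> C" for b
  proof -
    obtain c where "c \<in> C0" "c \<noteq> 0" "b = c /\<^sub>R norm c" using b by (auto simp: C_def)
    then show ?thesis by simp
  qed
  have orth: "inner b c = 0" if bc: "b \<in> C" "c \<in> C" "b \<noteq> c" for b c
  proof -
    obtain b0 c0 where "b0 \<in> C0" "c0 \<in> C0" "b = b0 /\<^sub>R norm b0" "c = c0 /\<^sub>R norm c0"
      using bc by (auto simp: C_def)
    moreover from this bc(3) have "b0 \<noteq> c0" by auto
    ultimately show ?thesis using pairwiseD[OF C0(3)] by (simp add: orthogonal_def)
  qed
  have "x \<in> span C" if "x \<in> C0" for x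
  proof (cases "x = 0")
    case False
    then have "x /\<^sub>R norm x \<in> span C" using that by (intro span_base) (auto simp: C_def)
    then have "norm x *\<^sub>R (x /\<^sub>R norm x) \<in> span C" by (rule span_scale)
    then show ?thesis using False by simp
  qed (simp add: span_zero)
  then have "span C0 \<subseteq> span C" by (intro span_minimal) auto
  then have sp: "span C = UNIV" using C0(2) by auto
  have "u = (\<Sum>b\<in>C. inner u b *\<^sub>R b)" for u
  proof -
    define w where "w = u - (\<Sum>b\<in>C. inner u b *\<^sub>R b)"
    have "inner w c = 0" if c: "c \<in> C" for c
    proof -
      have "inner (\<Sum>b\<in>C. inner u b *\<^sub>R b) c = (\<Sum>b\<in>C. if b = c then inner u c else 0)"
        unfolding inner_sum_left
      proof (rule sum.cong)
        fix b assume "b \<in> C"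
        then show "inner (inner u b *\<^sub>R b) c = (if b = c then inner u c else 0)"
          using orth[OF _ c] n1[OF c] by (auto simp: dot_square_norm)
      qed simp
      then show ?thesis using c fin by (simp add: w_def inner_diff_left)
    qed
    then have "x \<in> {x. inner w x = 0}" if "x \<in> span C" for x
    proof -
      have "span C \<subseteq> {x. inner w x = 0}"
        using \<open>\<And>c. c \<in> C \<Longrightarrow> inner w c = 0\<close>
        by (intro span_minimal subspace_hyperplane) auto
      then show ?thesis using that by auto
    qed
    then have "inner w w = 0" using sp by auto
    then show ?thesis by (simp add: w_def)
  qed
  then show thesis using that fin n1 by blast
qed

text \<open>One coordinate at a time: adding a vector to the family makes the cube the image of the product
  of an interval with the smaller cube.\<close>

lemma compact_cube:
  fixes C :: "'e::real_inner set"
  assumes "finite C"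
  shows "compact {\<Sum>b\<in>C. t b *\<^sub>R b | t. \<forall>b\<in>C. t b \<in> {-R..R}}" (is "compact (?Q C)")
  using assms
proof induction
  case (insert c C)
  have "?Q (insert c C) = (\<lambda>(r, x). r *\<^sub>R c + x) ` ({-R..R} \<times> ?Q C)"
  proof (intro equalityI subsetI)
    fix x assume "x \<in> ?Q (insert c C)"
    then obtain t where t: "\<forall>b\<in>insert c C. t b \<in> {-R..R}" "x = (\<Sum>b\<in>insert c C. t b *\<^sub>R b)" by blast
    have "(t c, \<Sum>b\<in>C. t b *\<^sub>R b) \<in> {-R..R} \<times> ?Q C" using t(1) by auto
    then show "x \<in> (\<lambda>(r, x). r *\<^sub>R c + x) ` ({-R..R} \<times> ?Q C)"
      using t(2) insert(1,2) by force
  next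
    fix x assume "x \<in> (\<lambda>(r, x). r *\<^sub>R c + x) ` ({-R..R} \<times> ?Q C)"
    then obtain r t where t: "r \<in> {-R..R}" "\<forall>b\<in>C. t b \<in> {-R..R}" "x = r *\<^sub>R c + (\<Sum>b\<in>C. t b *\<^sub>R b)" by auto
    have "(\<Sum>b\<in>C. (t(c := r)) b *\<^sub>R b) = (\<Sum>b\<in>C. t b *\<^sub>R b)"
      using insert(2) by (intro sum.cong) auto
    then have "x = (\<Sum>b\<in>insert c C. (t(c := r)) b *\<^sub>R b)" using t(3) insert(1,2) by simp
    moreover have "\<forall>b\<in>insert c C. (t(c := r)) b \<in> {-R..R}" using t by auto
    ultimately show "x \<in> ?Q (insert c C)" by blast
  qed
  moreover have "compact ((\<lambda>(r, x). r *\<^sub>R c + x) ` ({-R..R} \<times> ?Q C))"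
    by (intro compact_continuous_image compact_Times insert compact_Icc)
       (auto simp: case_prod_unfold intro!: continuous_intros)
  ultimately show ?case by simp
qed simp

locale smooth_manifold =
  fixes A :: "('m::{t2_space,second_countable_topology}, 'e::real_inner) chart set"
  assumes atlas: "smooth_atlas A"
begin

text \<open>The model space may have dimension \<open>0\<close>; compactness and almost everywhere differentiability are
  transferred to it through the coordinates of a chosen orthonormal basis.\<close>

definition ONB :: "'e set" where
  "ONB = (SOME C. finite C \<and> (\<forall>b\<in>C. norm b = 1) \<and> (\<forall>u. u = (\<Sum>b\<in>C. inner u b *\<^sub>R b)))"

lemma ONB: "finite ONB" "b \<in> ONB \<Longrightarrow> norm b = 1" "u = (\<Sum>b\<in>ONB. inner u b *\<^sub>R b)"
proof -
  obtain B :: "'e set" where "finite B" "span B = UNIV"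
    using atlas by (auto simp: smooth_atlas_def)
  then obtain C :: "'e set" where "finite C \<and> (\<forall>b\<in>C. norm b = 1) \<and> (\<forall>u. u = (\<Sum>b\<in>C. inner u b *\<^sub>R b))"
    using orthonormal_spanning_set by metis
  then have *: "finite ONB \<and> (\<forall>b\<in>ONB. norm b = 1) \<and> (\<forall>u. u = (\<Sum>b\<in>ONB. inner u b *\<^sub>R b))"
    unfolding ONB_def by (rule someI)
  show "finite ONB" "b \<in> ONB \<Longrightarrow> norm b = 1" using * by auto
  show "u = (\<Sum>b\<in>ONB. inner u b *\<^sub>R b)" using * by blast
qed

lemma abs_inner_ONB: "b \<in> ONB \<Longrightarrow> \<bar>inner u b\<bar> \<le> norm u"
  using Cauchy_Schwarz_ineq2[of u b] ONB(2)[of b] by simp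

lemma closed_bounded_compact:
  fixes S :: "'e set"
  assumes "closed S" "bounded S"
  shows "compact S"
proof -
  obtain R where R: "\<And>u. u \<in> S \<Longrightarrow> norm u \<le> R" using assms(2) by (auto simp: bounded_iff)
  let ?Q = "{\<Sum>b\<in>ONB. t b *\<^sub>R b | t. \<forall>b\<in>ONB. t b \<in> {-R..R}}"
  have "S \<subseteq> ?Q"
  proof
    fix u assume u: "u \<in> S"
    have "\<forall>b\<in>ONB. inner u b \<in> {-R..R}"
    proof
      fix b assume "b \<in> ONB"
      from abs_inner_ONB[OF this, of u] R[OF u] show "inner u b \<in> {-R..R}" by auto
    qed
    then show "u \<in> ?Q" using ONB(3)[of u] by blast
  qed
  then have eq: "?Q \<inter> S = S" by (rule Int_absorb1)
  have "compact (?Q \<inter> S)" by (rule compact_Int_closed[OF compact_cube[OF ONB(1)] assms(1)])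
  then show ?thesis unfolding eq .
qed

lemma abs_continuous_vector_differentiable_ae:
  fixes f :: "real \<Rightarrow> 'e"
  assumes f: "abs_continuous_on a b f"
  shows "negligible {s\<in>{a<..<b}. \<not> f differentiable (at s)}"
proof -
  have neg: "negligible {s\<in>{a<..<b}. \<not> (\<lambda>s. inner (f s) c) differentiable (at s)}" if c: "c \<in> ONB" for c
  proof (rule abs_continuous_differentiable_ae, rule abs_continuous_on_lipschitz[OF f])
    fix s t
    show "norm (inner (f t) c - inner (f s) c) \<le> 1 * norm (f t - f s)"
      using abs_inner_ONB[OF c, of "f t - f s"] by (simp add: inner_diff_left)
  qed
  have "f differentiable (at s)" if "\<And>c. c \<in> ONB \<Longrightarrow> (\<lambda>s. inner (f s) c) differentiable (at s)" for s
  proof -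
    have "(\<lambda>s. \<Sum>b\<in>ONB. inner (f s) b *\<^sub>R b) differentiable (at s)"
      by (intro differentiable_sum ONB(1) ballI differentiable_scaleR that) auto
    then show ?thesis using ONB(3) by simp
  qed
  then have "{s\<in>{a<..<b}. \<not> f differentiable (at s)} \<subseteq>
    (\<Union>c\<in>ONB. {s\<in>{a<..<b}. \<not> (\<lambda>s. inner (f s) c) differentiable (at s)})" by blast
  moreover have "negligible (\<Union>c\<in>ONB. {s\<in>{a<..<b}. \<not> (\<lambda>s. inner (f s) c) differentiable (at s)})"
    using neg ONB(1) by (intro negligible_countable_Union) (auto intro: countable_finite)
  ultimately show ?thesis by (rule negligible_subset[rotated])
qed

text \<open>The partial derivatives in the directions of the basis are continuous, hence bounded near each
  point, and they control the derivative because there are only finitely many of them.\<close>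

lemma smooth_on_lipschitz:
  fixes F :: "'e \<Rightarrow> 'b::real_normed_vector"
  assumes F: "smooth_on S F" and S: "open S" and p: "p \<in> S"
  obtains d K where "0 < d" "ball p d \<subseteq> S"
    "\<And>q q'. q \<in> ball p d \<Longrightarrow> q' \<in> ball p d \<Longrightarrow> norm (F q' - F q) \<le> K * norm (q' - q)"
proof -
  have "Ck_on (Suc 0) S F" using F unfolding smooth_on_def by blast
  then have diff: "\<And>q. q \<in> S \<Longrightarrow> F differentiable (at q)"
    and cont: "\<And>v. continuous_on S (\<lambda>q. frechet_derivative F (at q) v)" by auto
  let ?n = "\<lambda>q. \<Sum>b\<in>ONB. norm (frechet_derivative F (at q) b)"
  have "continuous_on S ?n" by (intro continuous_intros cont)
  then have "isCont ?n p" using S p by (simp add: continuous_on_eq_continuous_at)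
  then obtain d1 where d1: "0 < d1" "\<And>q. dist q p < d1 \<Longrightarrow> dist (?n q) (?n p) < 1"
    unfolding continuous_at_eps_delta by (metis zero_less_one)
  obtain d2 where d2: "0 < d2" "ball p d2 \<subseteq> S" using S p open_contains_ball by blast
  define d where "d = min d1 d2"
  have d: "0 < d" "ball p d \<subseteq> S" using d1 d2 by (auto simp: d_def)
  define K where "K = ?n p + 1"
  show thesis
  proof (rule that[OF d])
    fix q q' assume qq: "q \<in> ball p d" "q' \<in> ball p d"
    show "norm (F q' - F q) \<le> K * norm (q' - q)"
    proof (rule differentiable_bound[where f' = "\<lambda>x. frechet_derivative F (at x)" and S = "ball p d"])
      fix x assume x: "x \<in> ball p d"
      then have der: "(F has_derivative frechet_derivative F (at x)) (at x)"
        using diff d(2) by (auto simp: frechet_derivative_works[symmetric])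
      then show "(F has_derivative frechet_derivative F (at x)) (at x within ball p d)"
        by (rule has_derivative_at_withinI)
      have lin: "linear (frechet_derivative F (at x))" using der has_derivative_linear by blast
      have nx: "?n x \<le> K"
        using d1(2)[of x] x by (auto simp: d_def K_def dist_commute dist_real_def)
      show "onorm (frechet_derivative F (at x)) \<le> K"
      proof (rule onorm_bound)
        show "0 \<le> K" unfolding K_def by (intro add_nonneg_nonneg sum_nonneg) auto
        fix v
        have "frechet_derivative F (at x) v = frechet_derivative F (at x) (\<Sum>b\<in>ONB. inner v b *\<^sub>R b)"
          using ONB(3) by simp
        also have "\<dots> = (\<Sum>b\<in>ONB. inner v b *\<^sub>R frechet_derivative F (at x) b)"
          using lin by (simp add: linear_sum linear_scale)
        also have "norm \<dots> \<le> (\<Sum>b\<in>ONB. norm (inner v b *\<^sub>R frechet_derivative F (at x) b))"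
          by (rule norm_sum)
        also have "\<dots> \<le> (\<Sum>b\<in>ONB. norm v * norm (frechet_derivative F (at x) b))"
          by (intro sum_mono) (simp add: mult_right_mono abs_inner_ONB)
        also have "\<dots> = norm v * ?n x" by (simp add: sum_distrib_left)
        also have "\<dots> \<le> K * norm v" using mult_left_mono[OF nx, of "norm v"] by (simp add: mult.commute)
        finally show "norm (frechet_derivative F (at x) v) \<le> K * norm v" .
      qed
    qed (use qq in auto)
  qed
qed

section \<open>Charts and tangent vectors\<close>

lemma chart_facts:
  assumes "c \<in> A"
  shows "open (fst c)" "open (snd c ` fst c)" "continuous_on (fst c) (snd c)"
    "continuous_on (snd c ` fst c) (chart_inv c)"
    "x \<in> fst c \<Longrightarrow> chart_inv c (snd c x) = x"
    "p \<in> snd c ` fst c \<Longrightarrow> snd c (chart_inv c p) = p"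
    "p \<in> snd c ` fst c \<Longrightarrow> chart_inv c p \<in> fst c"
proof -
  have *: "open (fst c)" "open (snd c ` fst c)" "homeomorphism (fst c) (snd c ` fst c) (snd c) (chart_inv c)"
    using atlas assms by (auto simp: smooth_atlas_def)
  show "open (fst c)" "open (snd c ` fst c)" using * by auto
  show "continuous_on (fst c) (snd c)" "continuous_on (snd c ` fst c) (chart_inv c)"
    "x \<in> fst c \<Longrightarrow> chart_inv c (snd c x) = x"
    "p \<in> snd c ` fst c \<Longrightarrow> snd c (chart_inv c p) = p"
    using *(3) unfolding homeomorphism_def by auto
  show "p \<in> snd c ` fst c \<Longrightarrow> chart_inv c p \<in> fst c" by (rule inv_into_into)
qed

lemma chart_exists: obtains c where "c \<in> A" "x \<in> fst c"
proof -
  have "x \<in> \<Union> (fst ` A)" using atlas by (simp add: smooth_atlas_def)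
  then show thesis using that by auto
qed

lemma open_chart_image:
  assumes c: "c \<in> A" and U: "open U"
  shows "open (snd c ` (fst c \<inter> U))"
proof -
  have "snd c ` (fst c \<inter> U) = chart_inv c -` U \<inter> (snd c ` fst c)"
    using chart_facts[OF c] by force
  moreover have "open (chart_inv c -` U \<inter> (snd c ` fst c))"
    using chart_facts[OF c] U continuous_on_open_vimage by blast
  ultimately show ?thesis by simp
qed

lemma open_chart_inv_image:
  assumes c: "c \<in> A" and U: "open U" "U \<subseteq> snd c ` fst c"
  shows "open (chart_inv c ` U)"
proof -
  have "chart_inv c ` U = snd c -` U \<inter> fst c"
  proof (intro equalityI subsetI)
    fix x assume "x \<in> chart_inv c ` U"
    then obtain p where "p \<in> U" "x = chart_inv c p" by auto
    then show "x \<in> snd c -` U \<inter> fst c" using chart_facts(6,7)[OF c, of p] U(2) by auto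
  next
    fix x assume "x \<in> snd c -` U \<inter> fst c"
    then show "x \<in> chart_inv c ` U" using chart_facts(5)[OF c, of x] by (metis IntD1 IntD2 imageI vimageD)
  qed
  moreover have "open (snd c -` U \<inter> fst c)"
    using chart_facts[OF c] U continuous_on_open_vimage by blast
  ultimately show ?thesis by simp
qed

text \<open>Chart changes are the local representatives of the identity, so that one chain rule
  (\<open>jac_chain\<close>) serves both for changing charts and for smooth maps.\<close>

definition local_map :: "('m \<Rightarrow> 'm) \<Rightarrow> ('m, 'e) chart \<Rightarrow> ('m, 'e) chart \<Rightarrow> 'e \<Rightarrow> 'e" where
  "local_map f c c' = snd c' \<circ> f \<circ> chart_inv c"

definition jac :: "('m \<Rightarrow> 'm) \<Rightarrow> ('m, 'e) chart \<Rightarrow> ('m, 'e) chart \<Rightarrow> 'm \<Rightarrow> 'e \<Rightarrow> 'e" where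
  "jac f c c' x = frechet_derivative (local_map f c c') (at (snd c x))"

lemma smooth_map_id: "smooth_map A id"
  using atlas by (simp add: smooth_map_def smooth_atlas_def)

lemma local_map_smooth:
  assumes f: "smooth_map A f" and c: "c \<in> A" "c' \<in> A"
  shows "smooth_on (snd c ` (fst c \<inter> f -` fst c')) (local_map f c c')"
    "open (snd c ` (fst c \<inter> f -` fst c'))"
proof -
  show "smooth_on (snd c ` (fst c \<inter> f -` fst c')) (local_map f c c')"
    using f c by (simp add: smooth_map_def local_map_def)
  have "open (f -` fst c')"
    using f chart_facts(1)[OF c(2)] by (auto simp: smooth_map_def open_vimage)
  then show "open (snd c ` (fst c \<inter> f -` fst c'))" by (rule open_chart_image[OF c(1)])
qed

lemma jac_has_derivative:
  assumes f: "smooth_map A f" and c: "c \<in> A" "c' \<in> A" and x: "x \<in> fst c" "f x \<in> fst c'"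
  shows "(local_map f c c' has_derivative jac f c c' x) (at (snd c x))"
proof -
  have "Ck_on (Suc 0) (snd c ` (fst c \<inter> f -` fst c')) (local_map f c c')"
    using local_map_smooth(1)[OF f c] unfolding smooth_on_def by blast
  then have "local_map f c c' differentiable (at (snd c x))" using x by auto
  then show ?thesis by (simp add: jac_def frechet_derivative_works[symmetric])
qed

lemma jac_linear:
  assumes "smooth_map A f" "c \<in> A" "c' \<in> A" "x \<in> fst c" "f x \<in> fst c'"
  shows "linear (jac f c c' x)"
  using jac_has_derivative[OF assms] has_derivative_linear by blast

lemma smooth_map_continuous: "smooth_map A f \<Longrightarrow> isCont f x"
  by (simp add: smooth_map_def continuous_on_eq_continuous_at)

lemma eventually_chart_preimage:
  assumes c: "c \<in> A" and x: "x \<in> fst c" and V: "open V" "f x \<in> V" "isCont f x"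
  shows "\<forall>\<^sub>F p in at (snd c x). p \<in> snd c ` fst c \<and> f (chart_inv c p) \<in> V"
proof -
  obtain U where U: "open U" "x \<in> U" "\<And>y. y \<in> U \<Longrightarrow> f y \<in> V"
    using V unfolding continuous_at_open by metis
  have "open (snd c ` (fst c \<inter> U))" by (rule open_chart_image[OF c U(1)])
  moreover have "snd c x \<in> snd c ` (fst c \<inter> U)" using x U by blast
  ultimately have "\<forall>\<^sub>F p in at (snd c x). p \<in> snd c ` (fst c \<inter> U)"
    by (intro eventually_at_topological[THEN iffD2]) blast
  then show ?thesis
    by (rule eventually_mono) (use chart_facts(5)[OF c] U(3) in auto)
qed

lemma jac_comp:
  assumes f: "smooth_map A f" and h: "smooth_map A h" and c: "c \<in> A" "c' \<in> A" "c'' \<in> A"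
    and x: "x \<in> fst c" "f x \<in> fst c'" "h (f x) \<in> fst c''"
  shows "(local_map (h \<circ> f) c c'' has_derivative (jac h c' c'' (f x) \<circ> jac f c c' x)) (at (snd c x))"
proof -
  have eq: "local_map f c c' (snd c x) = snd c' (f x)"
    using chart_facts(5)[OF c(1) x(1)] by (simp add: local_map_def)
  have "(local_map h c' c'' \<circ> local_map f c c' has_derivative (jac h c' c'' (f x) \<circ> jac f c c' x)) (at (snd c x))"
    using jac_has_derivative[OF f c(1,2) x(1,2)] jac_has_derivative[OF h c(2,3) x(2,3)]
    by (intro diff_chain_at) (simp_all add: eq)
  moreover have "\<forall>\<^sub>F p in at (snd c x). (local_map h c' c'' \<circ> local_map f c c') p = local_map (h \<circ> f) c c'' p"
    using eventually_chart_preimage[OF c(1) x(1) chart_facts(1)[OF c(2)] x(2) smooth_map_continuous[OF f]]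
    by (rule eventually_mono) (simp add: local_map_def chart_facts(5)[OF c(2)])
  moreover have "(local_map h c' c'' \<circ> local_map f c c') (snd c x) = local_map (h \<circ> f) c c'' (snd c x)"
    using chart_facts(5)[OF c(1) x(1)] chart_facts(5)[OF c(2) x(2)] by (simp add: local_map_def)
  ultimately show ?thesis
    by (rule has_derivative_transform_eventually[OF _ _ _ UNIV_I])
qed

lemma jac_chain:
  assumes f: "smooth_map A f" and h: "smooth_map A h" and c: "c \<in> A" "c' \<in> A" "c'' \<in> A"
    and x: "x \<in> fst c" "f x \<in> fst c'" "h (f x) \<in> fst c''"
  shows "jac (h \<circ> f) c c'' x = jac h c' c'' (f x) \<circ> jac f c c' x"
  unfolding jac_def[of "h \<circ> f"]
  by (rule frechet_derivative_at[symmetric]) (rule jac_comp[OF assms])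

lemma jac_id_same:
  assumes c: "c \<in> A" and x: "x \<in> fst c"
  shows "jac id c c x = id"
proof -
  have "\<forall>\<^sub>F p in at (snd c x). id p = local_map id c c p"
    using eventually_chart_preimage[OF c x open_UNIV, of id]
    by (auto simp: local_map_def chart_facts(6)[OF c] elim!: eventually_mono)
  moreover have "id (snd c x) = local_map id c c (snd c x)"
    using chart_facts(5)[OF c x] by (simp add: local_map_def)
  ultimately have "(local_map id c c has_derivative id) (at (snd c x))"
    by (intro has_derivative_transform_eventually[OF has_derivative_id _ _ UNIV_I])
  then show ?thesis unfolding jac_def by (rule frechet_derivative_at[symmetric])
qed

lemma frechet_transition: "frechet_derivative (snd c' \<circ> chart_inv c) (at (snd c x)) = jac id c c' x"
  by (simp add: jac_def local_map_def)

lemma tvec_of_eq: "tvec_of A c x u c' = (if c' \<in> A \<and> x \<in> fst c' then jac id c c' x u else 0)"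
  by (simp add: tvec_of_def frechet_transition)

lemma tangent_space_iff:
  "v \<in> tangent_space A x \<longleftrightarrow> (\<forall>c. \<not> (c \<in> A \<and> x \<in> fst c) \<longrightarrow> v c = 0) \<and>
     (\<forall>c\<in>A. \<forall>c'\<in>A. x \<in> fst c \<and> x \<in> fst c' \<longrightarrow> v c' = jac id c c' x (v c))"
  by (simp add: tangent_space_def frechet_transition)

text \<open>The compatibility of the coordinates is the chain rule for chart changes.\<close>

lemma tvec_of_tangent:
  assumes c: "c \<in> A" "x \<in> fst c"
  shows "tvec_of A c x u \<in> tangent_space A x"
  unfolding tangent_space_iff
proof (intro conjI allI ballI impI)
  fix c1 c2 assume c1: "c1 \<in> A" "c2 \<in> A" "x \<in> fst c1 \<and> x \<in> fst c2"
  have "jac (id \<circ> id) c c2 x = jac id c1 c2 (id x) \<circ> jac id c c1 x"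
    using c c1 by (intro jac_chain smooth_map_id) auto
  then show "tvec_of A c x u c2 = jac id c1 c2 x (tvec_of A c x u c1)"
    using c1 by (simp add: tvec_of_eq fun_eq_iff)
qed (auto simp: tvec_of_eq)

lemma tangent_eq_tvec_of:
  assumes "v \<in> tangent_space A x" "c \<in> A" "x \<in> fst c"
  shows "v = tvec_of A c x (v c)"
proof
  fix c'
  show "v c' = tvec_of A c x (v c) c'"
  proof (cases "c' \<in> A \<and> x \<in> fst c'")
    case True
    then have "v c' = jac id c c' x (v c)" using assms unfolding tangent_space_iff by blast
    then show ?thesis using True by (simp add: tvec_of_eq)
  next
    case False
    then have "v c' = 0" using assms(1) unfolding tangent_space_iff by blast
    then show ?thesis using False by (simp only: tvec_of_eq if_False)
  qed
qed

lemma tvec_of_self: "c \<in> A \<Longrightarrow> x \<in> fst c \<Longrightarrow> tvec_of A c x u c = u"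
  by (simp add: tvec_of_eq jac_id_same)

lemma tvec_of_add:
  assumes "c \<in> A" "x \<in> fst c"
  shows "tvec_of A c x (u + w) = (\<lambda>c'. tvec_of A c x u c' + tvec_of A c x w c')"
  using jac_linear[OF smooth_map_id assms(1) _ assms(2)]
  by (auto simp: tvec_of_eq fun_eq_iff linear_add)

lemma tvec_of_scale:
  assumes "c \<in> A" "x \<in> fst c"
  shows "tvec_of A c x (r *\<^sub>R u) = (\<lambda>c'. r *\<^sub>R tvec_of A c x u c')"
  using jac_linear[OF smooth_map_id assms(1) _ assms(2)]
  by (auto simp: tvec_of_eq fun_eq_iff linear_scale)

lemma tangent_scale:
  assumes "v \<in> tangent_space A x"
  shows "(\<lambda>c. r *\<^sub>R v c) \<in> tangent_space A x"
proof -
  obtain c where c: "c \<in> A" "x \<in> fst c" by (rule chart_exists)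
  have "(\<lambda>c. r *\<^sub>R v c) = tvec_of A c x (r *\<^sub>R v c)"
    using tangent_eq_tvec_of[OF assms c] tvec_of_scale[OF c, of r "v c"] by metis
  then show ?thesis using tvec_of_tangent[OF c] by metis
qed


section \<open>Absolutely continuous curves\<close>

text \<open>Absolute continuity of curves on arbitrary intervals, in a form that is checked at each point
  and in a single chart there. Only intervals containing the point matter, which makes the notion
  stable under gluing at a point. It is equivalent to the condition for all charts
  (\<open>ac_curve_iff\<close>).\<close>

definition ac_at :: "real \<Rightarrow> real \<Rightarrow> real \<Rightarrow> (real \<Rightarrow> 'e) \<Rightarrow> bool" where
  "ac_at a b u f \<longleftrightarrow> (\<exists>d>0. \<forall>r s. a \<le> r \<and> r \<le> u \<and> u \<le> s \<and> s \<le> b \<and> s - r < d \<longrightarrow> abs_continuous_on r s f)"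

definition ac_curve :: "real \<Rightarrow> real \<Rightarrow> (real \<Rightarrow> 'm) \<Rightarrow> bool" where
  "ac_curve a b \<gamma> \<longleftrightarrow> continuous_on {a..b} \<gamma> \<and>
     (\<forall>u\<in>{a..b}. \<exists>c\<in>A. \<gamma> u \<in> fst c \<and> ac_at a b u (snd c \<circ> \<gamma>))"

lemma curve_near:
  fixes \<gamma> :: "real \<Rightarrow> 'm"
  assumes g: "continuous_on {a..b} \<gamma>" and u: "u \<in> {a..b}" and U: "open U" "\<gamma> u \<in> U"
  obtains d where "0 < d" "\<And>r s \<tau>. a \<le> r \<Longrightarrow> r \<le> u \<Longrightarrow> u \<le> s \<Longrightarrow> s \<le> b \<Longrightarrow> s - r < d \<Longrightarrow> \<tau> \<in> {r..s} \<Longrightarrow> \<gamma> \<tau> \<in> U"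
proof -
  obtain V where V: "open V" "u \<in> V" "\<And>y. y \<in> {a..b} \<Longrightarrow> y \<in> V \<Longrightarrow> \<gamma> y \<in> U"
    using g u U unfolding continuous_on_topological by metis
  then obtain d where d: "0 < d" "ball u d \<subseteq> V" using open_contains_ball by metis
  show thesis
  proof (rule that[OF d(1)])
    fix r s \<tau> assume *: "a \<le> r" "r \<le> u" "u \<le> s" "s \<le> b" "s - r < d" "\<tau> \<in> {r..s}"
    then have "\<tau> \<in> {a..b}" "\<tau> \<in> ball u d" by (auto simp: dist_real_def)
    then show "\<gamma> \<tau> \<in> U" using V(3) d(2) by blast
  qed
qed

text \<open>In charts, smooth maps are locally Lipschitz, and these preserve absolute continuity.\<close>

lemma ac_curve_image_at:
  assumes g: "ac_curve a b \<gamma>" and f: "smooth_map A f" and u: "u \<in> {a..b}"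
    and c': "c' \<in> A" "f (\<gamma> u) \<in> fst c'"
  shows "ac_at a b u (snd c' \<circ> (f \<circ> \<gamma>))"
proof -
  obtain c d0 where c: "c \<in> A" "\<gamma> u \<in> fst c" and d0: "0 < d0"
    "\<And>r s. a \<le> r \<Longrightarrow> r \<le> u \<Longrightarrow> u \<le> s \<Longrightarrow> s \<le> b \<Longrightarrow> s - r < d0 \<Longrightarrow> abs_continuous_on r s (snd c \<circ> \<gamma>)"
    using g u unfolding ac_curve_def ac_at_def by meson
  let ?S = "snd c ` (fst c \<inter> f -` fst c')"
  have p: "snd c (\<gamma> u) \<in> ?S" using c c' by blast
  obtain \<rho> K where \<rho>: "0 < \<rho>" "ball (snd c (\<gamma> u)) \<rho> \<subseteq> ?S" and
    K: "\<And>q q'. q \<in> ball (snd c (\<gamma> u)) \<rho> \<Longrightarrow> q' \<in> ball (snd c (\<gamma> u)) \<rho> \<Longrightarrow>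
      norm (local_map f c c' q' - local_map f c c' q) \<le> K * norm (q' - q)"
    by (rule smooth_on_lipschitz[OF local_map_smooth[OF f c(1) c'(1)] p]) blast
  let ?O = "chart_inv c ` ball (snd c (\<gamma> u)) \<rho>"
  have sub: "ball (snd c (\<gamma> u)) \<rho> \<subseteq> snd c ` fst c" using \<rho>(2) by blast
  have O: "open ?O" by (rule open_chart_inv_image[OF c(1) open_ball sub])
  have "\<gamma> u \<in> ?O"
    using chart_facts(5)[OF c] \<rho>(1) by (intro image_eqI[of _ _ "snd c (\<gamma> u)"]) auto
  moreover have "continuous_on {a..b} \<gamma>" using g by (simp add: ac_curve_def)
  ultimately obtain d1 where d1: "0 < d1" "\<And>r s \<tau>. a \<le> r \<Longrightarrow> r \<le> u \<Longrightarrow> u \<le> s \<Longrightarrow> s \<le> b \<Longrightarrow> s - r < d1 \<Longrightarrow> \<tau> \<in> {r..s} \<Longrightarrow> \<gamma> \<tau> \<in> ?O"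
    using curve_near[OF _ u O] by metis
  have near: "snd c (\<gamma> \<tau>) \<in> ball (snd c (\<gamma> u)) \<rho> \<and> \<gamma> \<tau> \<in> fst c" if \<tau>: "\<gamma> \<tau> \<in> ?O" for \<tau>
  proof -
    obtain q where q: "q \<in> ball (snd c (\<gamma> u)) \<rho>" "\<gamma> \<tau> = chart_inv c q" using \<tau> by blast
    then have "q \<in> snd c ` fst c" using sub by blast
    then show ?thesis using q chart_facts(6,7)[OF c(1), of q] by simp
  qed
  show ?thesis
    unfolding ac_at_def
  proof (intro exI[of _ "min d0 d1"] conjI allI impI)
    show "0 < min d0 d1" using d0 d1 by simp
    fix r s assume rs: "a \<le> r \<and> r \<le> u \<and> u \<le> s \<and> s \<le> b \<and> s - r < min d0 d1"
    have "abs_continuous_on r s (snd c \<circ> \<gamma>)" using d0(2)[of r s] rs by auto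
    then show "abs_continuous_on r s (snd c' \<circ> (f \<circ> \<gamma>))"
    proof (rule abs_continuous_on_lipschitz)
      fix \<sigma> \<tau> assume st: "\<sigma> \<in> {r..s}" "\<tau> \<in> {r..s}"
      have n: "snd c (\<gamma> \<tau>) \<in> ball (snd c (\<gamma> u)) \<rho> \<and> \<gamma> \<tau> \<in> fst c"
        "snd c (\<gamma> \<sigma>) \<in> ball (snd c (\<gamma> u)) \<rho> \<and> \<gamma> \<sigma> \<in> fst c"
        using near d1(2)[of r s] rs st by auto
      then show "norm ((snd c' \<circ> (f \<circ> \<gamma>)) \<tau> - (snd c' \<circ> (f \<circ> \<gamma>)) \<sigma>) \<le> K * norm ((snd c \<circ> \<gamma>) \<tau> - (snd c \<circ> \<gamma>) \<sigma>)"
        using K[of "snd c (\<gamma> \<sigma>)" "snd c (\<gamma> \<tau>)"] chart_facts(5)[OF c(1)] by (simp add: local_map_def)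
    qed
  qed
qed

lemma ac_curve_chart_at:
  "ac_curve a b \<gamma> \<Longrightarrow> u \<in> {a..b} \<Longrightarrow> c \<in> A \<Longrightarrow> \<gamma> u \<in> fst c \<Longrightarrow> ac_at a b u (snd c \<circ> \<gamma>)"
  using ac_curve_image_at[OF _ smooth_map_id, of a b \<gamma> u c] by simp

lemma ac_curve_image:
  assumes g: "ac_curve a b \<gamma>" and f: "smooth_map A f"
  shows "ac_curve a b (f \<circ> \<gamma>)"
  unfolding ac_curve_def
proof (intro conjI ballI)
  show "continuous_on {a..b} (f \<circ> \<gamma>)"
    using g f unfolding ac_curve_def smooth_map_def
    by (metis continuous_on_compose continuous_on_subset subset_UNIV)
  fix u assume u: "u \<in> {a..b}"
  obtain c where c: "c \<in> A" "f (\<gamma> u) \<in> fst c" by (rule chart_exists)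
  then show "\<exists>c\<in>A. (f \<circ> \<gamma>) u \<in> fst c \<and> ac_at a b u (snd c \<circ> (f \<circ> \<gamma>))"
    using ac_curve_image_at[OF g f u c] by auto
qed

lemma ac_curve_iff: "ac_curve 0 t \<gamma> \<longleftrightarrow> abs_continuous_curve A t \<gamma>"
proof
  assume g: "ac_curve 0 t \<gamma>"
  show "abs_continuous_curve A t \<gamma>"
    unfolding abs_continuous_curve_def
  proof (intro conjI ballI allI impI)
    show "continuous_on {0..t} \<gamma>" using g by (simp add: ac_curve_def)
    fix c r s assume c: "c \<in> A" and rs: "0 \<le> r \<and> r \<le> s \<and> s \<le> t \<and> \<gamma> ` {r..s} \<subseteq> fst c"
    show "abs_continuous_on r s (snd c \<circ> \<gamma>)"
    proof (rule abs_continuous_on_local)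
      fix x assume x: "x \<in> {r..s}"
      then have "ac_at 0 t x (snd c \<circ> \<gamma>)"
        using rs by (intro ac_curve_chart_at[OF g _ c]) auto
      then obtain d where "0 < d"
        "\<And>r s. 0 \<le> r \<and> r \<le> x \<and> x \<le> s \<and> s \<le> t \<and> s - r < d \<Longrightarrow> abs_continuous_on r s (snd c \<circ> \<gamma>)"
        by (auto simp: ac_at_def)
      then show "\<exists>d>0. \<forall>r' s'. r \<le> r' \<and> r' \<le> x \<and> x \<le> s' \<and> s' \<le> s \<and> s' - r' < d \<longrightarrow> abs_continuous_on r' s' (snd c \<circ> \<gamma>)"
        using rs by (intro exI[of _ d]) auto
    qed
  qed
next
  assume g: "abs_continuous_curve A t \<gamma>"
  then have cont: "continuous_on {0..t} \<gamma>" by (simp add: abs_continuous_curve_def)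
  show "ac_curve 0 t \<gamma>"
    unfolding ac_curve_def
  proof (intro conjI ballI cont)
    fix u assume u: "u \<in> {0..t}"
    obtain c where c: "c \<in> A" "\<gamma> u \<in> fst c" by (rule chart_exists)
    obtain d where d: "0 < d" "\<And>r s \<tau>. 0 \<le> r \<Longrightarrow> r \<le> u \<Longrightarrow> u \<le> s \<Longrightarrow> s \<le> t \<Longrightarrow> s - r < d \<Longrightarrow> \<tau> \<in> {r..s} \<Longrightarrow> \<gamma> \<tau> \<in> fst c"
      using curve_near[OF cont u chart_facts(1)[OF c(1)] c(2)] by metis
    have "ac_at 0 t u (snd c \<circ> \<gamma>)"
      unfolding ac_at_def
    proof (intro exI[of _ d] conjI allI impI d(1))
      fix r s assume rs: "0 \<le> r \<and> r \<le> u \<and> u \<le> s \<and> s \<le> t \<and> s - r < d"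
      then have "\<gamma> ` {r..s} \<subseteq> fst c" using d(2)[of r s] by auto
      then show "abs_continuous_on r s (snd c \<circ> \<gamma>)"
        using g c(1) rs unfolding abs_continuous_curve_def by auto
    qed
    then show "\<exists>c\<in>A. \<gamma> u \<in> fst c \<and> ac_at 0 t u (snd c \<circ> \<gamma>)" using c by blast
  qed
qed

lemma ac_curve_subinterval:
  assumes g: "ac_curve a b \<gamma>" and ab: "a \<le> a'" "b' \<le> b"
  shows "ac_curve a' b' \<gamma>"
  unfolding ac_curve_def
proof (intro conjI ballI)
  show "continuous_on {a'..b'} \<gamma>"
    using g ab by (auto simp: ac_curve_def intro: continuous_on_subset)
  fix u assume u: "u \<in> {a'..b'}"
  then have "u \<in> {a..b}" using ab by auto
  then obtain c where c: "c \<in> A" "\<gamma> u \<in> fst c" "ac_at a b u (snd c \<circ> \<gamma>)"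
    using g unfolding ac_curve_def by blast
  have "ac_at a' b' u (snd c \<circ> \<gamma>)" using c(3) ab unfolding ac_at_def by (meson order_trans)
  then show "\<exists>c\<in>A. \<gamma> u \<in> fst c \<and> ac_at a' b' u (snd c \<circ> \<gamma>)" using c by blast
qed

text \<open>At the gluing point both pieces are viewed in one common chart.\<close>

lemma ac_curve_combine:
  assumes 1: "ac_curve a m \<gamma>" and 2: "ac_curve m b \<gamma>" and m: "a \<le> m" "m \<le> b"
  shows "ac_curve a b \<gamma>"
  unfolding ac_curve_def
proof (intro conjI ballI)
  have "continuous_on ({a..m} \<union> {m..b}) \<gamma>"
    using 1 2 by (intro continuous_on_closed_Un) (auto simp: ac_curve_def)
  then show "continuous_on {a..b} \<gamma>" using m by (simp add: ivl_disj_un_two_touch(4))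
  fix u assume u: "u \<in> {a..b}"
  obtain c where c: "c \<in> A" "\<gamma> u \<in> fst c" by (rule chart_exists)
  have "ac_at a b u (snd c \<circ> \<gamma>)"
  proof (cases u m rule: linorder_cases)
    case less
    then obtain d where d: "0 < d"
      "\<forall>r s. a \<le> r \<and> r \<le> u \<and> u \<le> s \<and> s \<le> m \<and> s - r < d \<longrightarrow> abs_continuous_on r s (snd c \<circ> \<gamma>)"
      using ac_curve_chart_at[OF 1 _ c] u by (auto simp: ac_at_def)
    then show ?thesis using less unfolding ac_at_def by (intro exI[of _ "min d (m - u)"]) auto
  next
    case greater
    then obtain d where d: "0 < d"
      "\<forall>r s. m \<le> r \<and> r \<le> u \<and> u \<le> s \<and> s \<le> b \<and> s - r < d \<longrightarrow> abs_continuous_on r s (snd c \<circ> \<gamma>)"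
      using ac_curve_chart_at[OF 2 _ c] u by (auto simp: ac_at_def)
    then show ?thesis using greater unfolding ac_at_def by (intro exI[of _ "min d (u - m)"]) auto
  next
    case equal
    have "ac_at a m m (snd c \<circ> \<gamma>)" using ac_curve_chart_at[OF 1 _ c] u m equal by simp
    then obtain d1 where d1: "0 < d1"
      "\<forall>r s. a \<le> r \<and> r \<le> m \<and> m \<le> s \<and> s \<le> m \<and> s - r < d1 \<longrightarrow> abs_continuous_on r s (snd c \<circ> \<gamma>)"
      by (auto simp: ac_at_def)
    have "ac_at m b m (snd c \<circ> \<gamma>)" using ac_curve_chart_at[OF 2 _ c] u m equal by simp
    then obtain d2 where d2: "0 < d2"
      "\<forall>r s. m \<le> r \<and> r \<le> m \<and> m \<le> s \<and> s \<le> b \<and> s - r < d2 \<longrightarrow> abs_continuous_on r s (snd c \<circ> \<gamma>)"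
      by (auto simp: ac_at_def)
    show ?thesis
      unfolding ac_at_def
    proof (intro exI[of _ "min d1 d2"] conjI allI impI)
      show "0 < min d1 d2" using d1 d2 by simp
      fix r s assume rs: "a \<le> r \<and> r \<le> u \<and> u \<le> s \<and> s \<le> b \<and> s - r < min d1 d2"
      have "abs_continuous_on r m (snd c \<circ> \<gamma>)" using d1(2) rs equal by auto
      moreover have "abs_continuous_on m s (snd c \<circ> \<gamma>)" using d2(2) rs equal by auto
      ultimately show "abs_continuous_on r s (snd c \<circ> \<gamma>)" by (rule abs_continuous_on_combine)
    qed
  qed
  then show "\<exists>c\<in>A. \<gamma> u \<in> fst c \<and> ac_at a b u (snd c \<circ> \<gamma>)" using c by blast
qed

lemma ac_curve_affine:
  assumes g: "ac_curve a' b' \<gamma>" and k: "k \<noteq> 0"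
    and im: "\<And>s. s \<in> {a..b} \<Longrightarrow> k * s + t \<in> {a'..b'}"
  shows "ac_curve a b (\<lambda>s. \<gamma> (k * s + t))"
  unfolding ac_curve_def
proof (intro conjI ballI)
  have "continuous_on {a'..b'} \<gamma>" using g by (simp add: ac_curve_def)
  then show "continuous_on {a..b} (\<lambda>s. \<gamma> (k * s + t))"
    by (rule continuous_on_compose2) (use im in \<open>auto intro!: continuous_intros\<close>)
  fix u assume u: "u \<in> {a..b}"
  then have "k * u + t \<in> {a'..b'}" by (rule im)
  then obtain c d where c: "c \<in> A" "\<gamma> (k * u + t) \<in> fst c" and d: "0 < d"
    "\<And>r s. a' \<le> r \<and> r \<le> k * u + t \<and> k * u + t \<le> s \<and> s \<le> b' \<and> s - r < d \<Longrightarrow> abs_continuous_on r s (snd c \<circ> \<gamma>)"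
    using g unfolding ac_curve_def ac_at_def by meson
  have "ac_at a b u (snd c \<circ> (\<lambda>s. \<gamma> (k * s + t)))"
    unfolding ac_at_def
  proof (intro exI[of _ "d / \<bar>k\<bar>"] conjI allI impI)
    show "0 < d / \<bar>k\<bar>" using d k by simp
    fix r s assume rs: "a \<le> r \<and> r \<le> u \<and> u \<le> s \<and> s \<le> b \<and> s - r < d / \<bar>k\<bar>"
    let ?l = "min (k * r + t) (k * s + t)" and ?u = "max (k * r + t) (k * s + t)"
    have btw: "k * x + t \<in> {?l..?u}" if "x \<in> {r..s}" for x
    proof (cases "0 \<le> k")
      case True
      then have "k * r \<le> k * x" "k * x \<le> k * s" using that by (auto intro: mult_left_mono)
      then show ?thesis by auto
    next
      case False
      then have "k * r \<ge> k * x" "k * x \<ge> k * s" using that by (auto intro: mult_left_mono_neg)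
      then show ?thesis by auto
    qed
    have "?u - ?l = \<bar>k * (s - r)\<bar>" by (auto simp: max_def min_def algebra_simps)
    also have "\<dots> = \<bar>k\<bar> * (s - r)" using rs by (simp add: abs_mult)
    also have "\<dots> < d" using rs k by (simp add: pos_less_divide_eq mult.commute)
    finally have "?u - ?l < d" .
    moreover have "?l \<le> k * u + t" "k * u + t \<le> ?u" using btw[of u] rs by auto
    moreover have "a' \<le> ?l" "?u \<le> b'" using im[of r] im[of s] rs by auto
    ultimately have "abs_continuous_on ?l ?u (snd c \<circ> \<gamma>)" by (intro d(2)) blast
    from abs_continuous_on_affine[OF this k btw]
    show "abs_continuous_on r s (snd c \<circ> (\<lambda>s. \<gamma> (k * s + t)))" by (simp add: comp_def)
  qed
  then show "\<exists>c\<in>A. \<gamma> (k * u + t) \<in> fst c \<and> ac_at a b u (snd c \<circ> (\<lambda>s. \<gamma> (k * s + t)))"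
    using c by blast
qed

text \<open>A property of intervals that passes to unions of adjacent intervals has to be checked only for
  pieces of the curve that stay in one chart, by bisection.\<close>

lemma curve_subdivision:
  assumes ac: "ac_curve a b \<gamma>" and ab: "a \<le> b"
    and trans: "\<And>r m s. r \<le> m \<Longrightarrow> m \<le> s \<Longrightarrow> Q r m \<Longrightarrow> Q m s \<Longrightarrow> Q r s"
    and loc: "\<And>c r s. c \<in> A \<Longrightarrow> a \<le> r \<Longrightarrow> r \<le> s \<Longrightarrow> s \<le> b \<Longrightarrow> \<gamma> ` {r..s} \<subseteq> fst c \<Longrightarrow>
       continuous_on {r..s} \<gamma> \<Longrightarrow> abs_continuous_on r s (snd c \<circ> \<gamma>) \<Longrightarrow> Q r s"
  shows "Q a b"
proof -
  define Q' where "Q' r s \<longleftrightarrow> (max a r \<le> min b s \<longrightarrow> Q (max a r) (min b s))" for r s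
  have "Q' a b"
    using ab
  proof (induction rule: Bolzano)
    case (trans r m s)
    consider "m < a" | "b < m" | "a \<le> m" "m \<le> b" by linarith
    then show ?case
    proof cases
      case 1
      then show ?thesis using trans by (auto simp: Q'_def max_def)
    next
      case 2
      then show ?thesis using trans by (auto simp: Q'_def min_def)
    next
      case 3
      then have m: "max a m = m" "min b m = m" by auto
      show ?thesis
        unfolding Q'_def
      proof
        have "max a r \<le> m" "m \<le> min b s" using 3 trans(3,4) by auto
        then show "Q (max a r) (min b s)"
          using trans(1,2) assms(3)[of "max a r" m "min b s"] by (simp add: Q'_def m)
      qed
    qed
  next
    case (local u)
    then have u: "u \<in> {a..b}" by simp
    obtain c where c: "c \<in> A" "\<gamma> u \<in> fst c" by (rule chart_exists)
    obtain d0 where d0: "0 < d0"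
      "\<forall>r s. a \<le> r \<and> r \<le> u \<and> u \<le> s \<and> s \<le> b \<and> s - r < d0 \<longrightarrow> abs_continuous_on r s (snd c \<circ> \<gamma>)"
      using ac_curve_chart_at[OF ac u c] by (auto simp: ac_at_def)
    have cg: "continuous_on {a..b} \<gamma>" using ac by (simp add: ac_curve_def)
    obtain d1 where d1: "0 < d1" "\<And>r s \<tau>. a \<le> r \<Longrightarrow> r \<le> u \<Longrightarrow> u \<le> s \<Longrightarrow> s \<le> b \<Longrightarrow> s - r < d1 \<Longrightarrow> \<tau> \<in> {r..s} \<Longrightarrow> \<gamma> \<tau> \<in> fst c"
      using curve_near[OF cg u chart_facts(1)[OF c(1)] c(2)] by metis
    show ?case
    proof (intro exI[of _ "min d0 d1"] conjI allI impI)
      show "0 < min d0 d1" using d0 d1 by simp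
      fix r s assume rs: "r \<le> u \<and> u \<le> s \<and> s - r < min d0 d1"
      let ?r = "max a r" and ?s = "min b s"
      have rs': "a \<le> ?r" "?r \<le> u" "u \<le> ?s" "?s \<le> b" "?s - ?r < d0" "?s - ?r < d1" using rs u by auto
      have "\<gamma> ` {?r..?s} \<subseteq> fst c" using d1(2)[OF rs'(1-4,6)] by blast
      moreover have "continuous_on {?r..?s} \<gamma>" using cg by (rule continuous_on_subset) auto
      moreover have "abs_continuous_on ?r ?s (snd c \<circ> \<gamma>)" using d0(2) rs' by blast
      ultimately have "Q ?r ?s"
        by (rule loc[OF c(1) rs'(1) order_trans[OF rs'(2,3)] rs'(4)])
      then show "Q' r s" by (simp add: Q'_def)
    qed
  qed
  then show ?thesis using ab by (simp add: Q'_def)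
qed

text \<open>At regular points the velocity is a tangent vector that transforms as expected; elsewhere the
  value of \<^const>\<open>velocity\<close> is meaningless.\<close>

definition regular_at :: "(real \<Rightarrow> 'm) \<Rightarrow> real \<Rightarrow> bool" where
  "regular_at \<gamma> s \<longleftrightarrow> isCont \<gamma> s \<and> (\<exists>c\<in>A. \<gamma> s \<in> fst c \<and> (snd c \<circ> \<gamma>) differentiable (at s))"

lemma ac_curve_regular_ae:
  assumes g: "ac_curve a b \<gamma>"
  shows "AE s in lebesgue. s \<in> {a<..<b} \<longrightarrow> regular_at \<gamma> s"
proof -
  have cont: "isCont \<gamma> s" if "s \<in> {a<..<b}" for s
    using g that unfolding ac_curve_def
    by (metis continuous_on_interior interior_atLeastAtMost_real)
  have "negligible {s\<in>{a<..<b}. \<not> regular_at \<gamma> s}" if "a \<le> b"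
    using g that
  proof (rule curve_subdivision[where Q = "\<lambda>r s. negligible {x\<in>{r<..<s}. \<not> regular_at \<gamma> x}"])
    fix r m s :: real
    assume Q: "negligible {x\<in>{r<..<m}. \<not> regular_at \<gamma> x}" "negligible {x\<in>{m<..<s}. \<not> regular_at \<gamma> x}"
    have "{x\<in>{r<..<s}. \<not> regular_at \<gamma> x} \<subseteq>
      {x\<in>{r<..<m}. \<not> regular_at \<gamma> x} \<union> {x\<in>{m<..<s}. \<not> regular_at \<gamma> x} \<union> {m}"
      by auto
    from negligible_subset[OF _ this] show "negligible {x\<in>{r<..<s}. \<not> regular_at \<gamma> x}"
      using Q by (simp add: negligible_Un)
  next
    fix c r s assume c: "c \<in> A" "\<gamma> ` {r..s} \<subseteq> fst c" and rs: "a \<le> r" "s \<le> b"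
      and ac: "abs_continuous_on r s (snd c \<circ> \<gamma>)"
    have "{x\<in>{r<..<s}. \<not> regular_at \<gamma> x} \<subseteq> {x\<in>{r<..<s}. \<not> (snd c \<circ> \<gamma>) differentiable (at x)}"
    proof
      fix x assume "x \<in> {x\<in>{r<..<s}. \<not> regular_at \<gamma> x}"
      then have x: "x \<in> {r<..<s}" and nr: "\<not> regular_at \<gamma> x" by auto
      have "\<gamma> x \<in> fst c" using c(2) x by auto
      moreover have "isCont \<gamma> x" using x rs by (intro cont) auto
      ultimately show "x \<in> {x\<in>{r<..<s}. \<not> (snd c \<circ> \<gamma>) differentiable (at x)}"
        using x nr c(1) unfolding regular_at_def by blast
    qed
    with abs_continuous_vector_differentiable_ae[OF ac]
    show "negligible {x\<in>{r<..<s}. \<not> regular_at \<gamma> x}" by (rule negligible_subset)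
  qed
  then have "negligible {s\<in>{a<..<b}. \<not> regular_at \<gamma> s}" by (cases "a \<le> b") auto
  then have "{s\<in>{a<..<b}. \<not> regular_at \<gamma> s} \<in> null_sets lebesgue"
    by (simp add: negligible_iff_null_sets)
  from AE_not_in[OF this] show ?thesis by eventually_elim auto
qed

lemma chart_velocity_image:
  assumes cont: "isCont \<gamma> s" and c: "c \<in> A" "\<gamma> s \<in> fst c"
    and der: "(snd c \<circ> \<gamma> has_vector_derivative v) (at s)"
    and f: "smooth_map A f" and c': "c' \<in> A" "f (\<gamma> s) \<in> fst c'"
  shows "(snd c' \<circ> (f \<circ> \<gamma>) has_vector_derivative jac f c c' (\<gamma> s) v) (at s)"
proof -
  have J: "(local_map f c c' has_derivative jac f c c' (\<gamma> s)) (at ((snd c \<circ> \<gamma>) s))"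
    using jac_has_derivative[OF f c(1) c'(1) c(2) c'(2)] by simp
  have "(local_map f c c' \<circ> (snd c \<circ> \<gamma>) has_derivative (jac f c c' (\<gamma> s) \<circ> (\<lambda>h. h *\<^sub>R v))) (at s)"
    using der J unfolding has_vector_derivative_def by (rule diff_chain_at)
  moreover have "\<forall>\<^sub>F \<tau> in at s. (local_map f c c' \<circ> (snd c \<circ> \<gamma>)) \<tau> = (snd c' \<circ> (f \<circ> \<gamma>)) \<tau>"
  proof -
    have "\<forall>\<^sub>F \<tau> in at s. \<gamma> \<tau> \<in> fst c"
      using topological_tendstoD[OF cont[unfolded isCont_def] chart_facts(1)[OF c(1)] c(2)] .
    then show ?thesis by (rule eventually_mono) (simp add: local_map_def chart_facts(5)[OF c(1)])
  qed
  moreover have "(local_map f c c' \<circ> (snd c \<circ> \<gamma>)) s = (snd c' \<circ> (f \<circ> \<gamma>)) s"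
    using chart_facts(5)[OF c] by (simp add: local_map_def)
  ultimately have "(snd c' \<circ> (f \<circ> \<gamma>) has_derivative (jac f c c' (\<gamma> s) \<circ> (\<lambda>h. h *\<^sub>R v))) (at s)"
    by (rule has_derivative_transform_eventually[OF _ _ _ UNIV_I])
  moreover have "jac f c c' (\<gamma> s) \<circ> (\<lambda>h. h *\<^sub>R v) = (\<lambda>h. h *\<^sub>R jac f c c' (\<gamma> s) v)"
    using jac_linear[OF f c(1) c'(1) c(2) c'(2)] by (simp add: fun_eq_iff linear_scale)
  ultimately show ?thesis by (simp add: has_vector_derivative_def)
qed

lemma velocity_eq:
  assumes cont: "isCont \<gamma> s" and c: "c \<in> A" "\<gamma> s \<in> fst c"
    and der: "(snd c \<circ> \<gamma> has_vector_derivative v) (at s)"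
  shows "velocity A \<gamma> s = tvec_of A c (\<gamma> s) v"
proof
  fix c'
  show "velocity A \<gamma> s c' = tvec_of A c (\<gamma> s) v c'"
  proof (cases "c' \<in> A \<and> \<gamma> s \<in> fst c'")
    case True
    then have "(snd c' \<circ> (id \<circ> \<gamma>) has_vector_derivative jac id c c' (\<gamma> s) v) (at s)"
      by (intro chart_velocity_image[OF cont c der smooth_map_id]) auto
    then have "vector_derivative (snd c' \<circ> \<gamma>) (at s) = jac id c c' (\<gamma> s) v"
      by (simp add: vector_derivative_at)
    then show ?thesis using True by (simp add: velocity_def tvec_of_eq)
  next
    case False
    then show ?thesis by (simp only: velocity_def tvec_of_eq if_False)
  qed
qed

lemma regular_atE:
  assumes "regular_at \<gamma> s"
  obtains c v where "c \<in> A" "\<gamma> s \<in> fst c" "(snd c \<circ> \<gamma> has_vector_derivative v) (at s)"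
    "velocity A \<gamma> s = tvec_of A c (\<gamma> s) v"
proof -
  obtain c where c: "c \<in> A" "\<gamma> s \<in> fst c" "(snd c \<circ> \<gamma>) differentiable (at s)" and cont: "isCont \<gamma> s"
    using assms by (auto simp: regular_at_def)
  have der: "(snd c \<circ> \<gamma> has_vector_derivative vector_derivative (snd c \<circ> \<gamma>) (at s)) (at s)"
    using c(3) by (simp add: vector_derivative_works)
  show thesis using that[OF c(1,2) der velocity_eq[OF cont c(1,2) der]] .
qed

lemma velocity_tangent: "regular_at \<gamma> s \<Longrightarrow> velocity A \<gamma> s \<in> tangent_space A (\<gamma> s)"
  by (metis regular_atE tvec_of_tangent)

lemma velocity_image:
  assumes r: "regular_at \<gamma> s" and f: "smooth_map A f"
  shows "velocity A (f \<circ> \<gamma>) s = tangent_map A f (\<gamma> s) (velocity A \<gamma> s)"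
proof
  fix c'
  define c where "c = (SOME c. c \<in> A \<and> \<gamma> s \<in> fst c)"
  have "\<exists>c. c \<in> A \<and> \<gamma> s \<in> fst c" by (meson chart_exists)
  from someI_ex[OF this] have c: "c \<in> A" "\<gamma> s \<in> fst c" unfolding c_def by auto
  have cont: "isCont \<gamma> s" using r by (simp add: regular_at_def)
  obtain c0 v0 where c0: "c0 \<in> A" "\<gamma> s \<in> fst c0" "(snd c0 \<circ> \<gamma> has_vector_derivative v0) (at s)"
    by (rule regular_atE[OF r])
  have "(snd c \<circ> (id \<circ> \<gamma>) has_vector_derivative jac id c0 c (\<gamma> s) v0) (at s)"
    by (rule chart_velocity_image[OF cont c0 smooth_map_id c(1)]) (simp add: c)
  then obtain v where der: "(snd c \<circ> \<gamma> has_vector_derivative v) (at s)" by auto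
  have vc: "velocity A \<gamma> s c = v"
    using velocity_eq[OF cont c der] tvec_of_self[OF c] by simp
  show "velocity A (f \<circ> \<gamma>) s c' = tangent_map A f (\<gamma> s) (velocity A \<gamma> s) c'"
  proof (cases "c' \<in> A \<and> f (\<gamma> s) \<in> fst c'")
    case True
    then have "(snd c' \<circ> (f \<circ> \<gamma>) has_vector_derivative jac f c c' (\<gamma> s) v) (at s)"
      by (intro chart_velocity_image[OF cont c der f]) auto
    then have "vector_derivative (snd c' \<circ> (f \<circ> \<gamma>)) (at s) = jac f c c' (\<gamma> s) v"
      by (rule vector_derivative_at)
    then have "velocity A (f \<circ> \<gamma>) s c' = jac f c c' (\<gamma> s) v" using True by (simp add: velocity_def)
    moreover have "tangent_map A f (\<gamma> s) (velocity A \<gamma> s) c' = jac f c c' (\<gamma> s) (velocity A \<gamma> s c)"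
      unfolding tangent_map_def Let_def c_def[symmetric] using True
      by (simp add: jac_def local_map_def)
    ultimately show ?thesis by (simp add: vc)
  next
    case False
    then show ?thesis by (auto simp: velocity_def tangent_map_def Let_def)
  qed
qed

text \<open>Regularity is assumed for the reparametrized curve, since the exceptional null set is the one
  of that curve; the inverse affine map carries it over to \<open>\<gamma>\<close>.\<close>

lemma velocity_affine:
  assumes r: "regular_at (\<lambda>s. \<gamma> (k * s + t)) s" and k: "k \<noteq> 0"
  shows "regular_at \<gamma> (k * s + t)"
    "velocity A (\<lambda>s. \<gamma> (k * s + t)) s = (\<lambda>c. k *\<^sub>R velocity A \<gamma> (k * s + t) c)"
proof -
  let ?h = "\<lambda>\<sigma>. (\<sigma> - t) / k"
  have unh: "k * ((\<sigma> - t) / k) + t = \<sigma>" for \<sigma> using k by simp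
  have cont: "isCont (\<lambda>s. \<gamma> (k * s + t)) s" using r by (simp add: regular_at_def)
  have hs: "?h (k * s + t) = s" using k by simp
  have "isCont (\<lambda>\<sigma>. (\<lambda>s. \<gamma> (k * s + t)) (?h \<sigma>)) (k * s + t)"
    by (rule isCont_o2[of _ ?h]) (use cont hs k in \<open>auto intro!: continuous_intros\<close>)
  then have cont': "isCont \<gamma> (k * s + t)" by (simp only: unh)
  obtain c v where c: "c \<in> A" "\<gamma> (k * s + t) \<in> fst c"
    and der: "(snd c \<circ> (\<lambda>s. \<gamma> (k * s + t)) has_vector_derivative v) (at s)"
    and vel: "velocity A (\<lambda>s. \<gamma> (k * s + t)) s = tvec_of A c (\<gamma> (k * s + t)) v"
    by (rule regular_atE[OF r])
  have "(?h has_vector_derivative (1 / k)) (at (k * s + t))"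
    unfolding has_vector_derivative_def using k
    by (auto intro!: derivative_eq_intros simp: field_simps)
  then have "((snd c \<circ> (\<lambda>s. \<gamma> (k * s + t))) \<circ> ?h has_vector_derivative (1 / k) *\<^sub>R v) (at (k * s + t))"
    using der hs by (intro vector_diff_chain_at) simp_all
  moreover have "(snd c \<circ> (\<lambda>s. \<gamma> (k * s + t))) \<circ> ?h = snd c \<circ> \<gamma>" by (simp only: comp_def unh)
  ultimately have der': "(snd c \<circ> \<gamma> has_vector_derivative (1 / k) *\<^sub>R v) (at (k * s + t))" by simp
  then show "regular_at \<gamma> (k * s + t)"
    using cont' c by (auto simp: regular_at_def intro: differentiableI_vector)
  have "velocity A \<gamma> (k * s + t) = tvec_of A c (\<gamma> (k * s + t)) ((1 / k) *\<^sub>R v)"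
    by (rule velocity_eq[OF cont' c der'])
  then show "velocity A (\<lambda>s. \<gamma> (k * s + t)) s = (\<lambda>c. k *\<^sub>R velocity A \<gamma> (k * s + t) c)"
    using k by (simp add: vel tvec_of_scale[OF c, symmetric])
qed


section \<open>Riemannian metrics in charts\<close>

lemma riem_sym:
  "riemannian_metric A g \<Longrightarrow> u \<in> tangent_space A x \<Longrightarrow> v \<in> tangent_space A x \<Longrightarrow> g x u v = g x v u"
  unfolding riemannian_metric_def by blast

lemma riem_add:
  "riemannian_metric A g \<Longrightarrow> u \<in> tangent_space A x \<Longrightarrow> v \<in> tangent_space A x \<Longrightarrow> w \<in> tangent_space A x \<Longrightarrow>
   g x (\<lambda>c. u c + v c) w = g x u w + g x v w"
  unfolding riemannian_metric_def by blast

lemma riem_scale: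
  "riemannian_metric A g \<Longrightarrow> u \<in> tangent_space A x \<Longrightarrow> v \<in> tangent_space A x \<Longrightarrow>
   g x (\<lambda>c. r *\<^sub>R u c) v = r * g x u v"
  unfolding riemannian_metric_def by blast

lemma riem_quadratic:
  assumes g: "riemannian_metric A g" and v: "v \<in> tangent_space A x"
  shows "g x (\<lambda>c. r *\<^sub>R v c) (\<lambda>c. r *\<^sub>R v c) = r\<^sup>2 * g x v v"
  using riem_scale[OF g v tangent_scale[OF v], of r r] riem_scale[OF g v v, of r]
    riem_sym[OF g v tangent_scale[OF v], of r]
  by (simp add: power2_eq_square)

lemma riem_zero:
  assumes g: "riemannian_metric A g"
  shows "g x (\<lambda>_. 0) (\<lambda>_. 0) = 0"
proof -
  obtain c where c: "c \<in> A" "x \<in> fst c" by (rule chart_exists)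
  show ?thesis using riem_quadratic[OF g tvec_of_tangent[OF c], of 0] by simp
qed

lemma riem_pos:
  "riemannian_metric A g \<Longrightarrow> v \<in> tangent_space A x \<Longrightarrow> v \<noteq> (\<lambda>_. 0) \<Longrightarrow> 0 < g x v v"
  unfolding riemannian_metric_def by blast

lemma riem_nonneg:
  "riemannian_metric A g \<Longrightarrow> v \<in> tangent_space A x \<Longrightarrow> 0 \<le> g x v v"
  using riem_pos[of g v x] riem_zero[of g x] by (cases "v = (\<lambda>_. 0)") auto

definition coeff :: "('m, 'e) metric \<Rightarrow> ('m, 'e) chart \<Rightarrow> 'e \<Rightarrow> 'e \<Rightarrow> 'e \<Rightarrow> real" where
  "coeff g c p u w = g (chart_inv c p) (tvec_of A c (chart_inv c p) u) (tvec_of A c (chart_inv c p) w)"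

lemma coeff_continuous:
  assumes "riemannian_metric A g" "c \<in> A"
  shows "continuous_on (snd c ` fst c) (\<lambda>p. coeff g c p u w)"
proof -
  have "smooth_on (snd c ` fst c) (\<lambda>p. coeff g c p u w)"
    using assms unfolding riemannian_metric_def coeff_def by blast
  then have "Ck_on 0 (snd c ` fst c) (\<lambda>p. coeff g c p u w)" unfolding smooth_on_def by blast
  then show ?thesis by simp
qed

lemma metric_tvec_linear:
  assumes g: "riemannian_metric A g" and c: "c \<in> A" "x \<in> fst c" and w: "w \<in> tangent_space A x"
  shows "linear (\<lambda>u. g x (tvec_of A c x u) w)"
  by (rule linearI)
     (simp_all add: tvec_of_add[OF c] tvec_of_scale[OF c] riem_add[OF g _ _ w] riem_scale[OF g _ w]
        tvec_of_tangent[OF c])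

lemma metric_tvec_expand:
  assumes g: "riemannian_metric A g" and c: "c \<in> A" "x \<in> fst c"
  shows "g x (tvec_of A c x u) (tvec_of A c x w) =
     (\<Sum>b\<in>ONB. \<Sum>b'\<in>ONB. inner u b * inner w b' * coeff g c (snd c x) b b')"
proof -
  have T: "tvec_of A c x y \<in> tangent_space A x" for y by (rule tvec_of_tangent[OF c])
  have 1: "g x (tvec_of A c x u) v = (\<Sum>b\<in>ONB. inner u b * g x (tvec_of A c x b) v)"
    if v: "v \<in> tangent_space A x" for u v
  proof -
    have "g x (tvec_of A c x u) v = g x (tvec_of A c x (\<Sum>b\<in>ONB. inner u b *\<^sub>R b)) v"
      using ONB(3) by metis
    also have "\<dots> = (\<Sum>b\<in>ONB. inner u b * g x (tvec_of A c x b) v)"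
      by (simp add: linear_sum[OF metric_tvec_linear[OF g c v]] linear_scale[OF metric_tvec_linear[OF g c v]])
    finally show ?thesis .
  qed
  have 2: "g x v (tvec_of A c x w) = (\<Sum>b\<in>ONB. inner w b * g x v (tvec_of A c x b))"
    if v: "v \<in> tangent_space A x" for w v
    using 1[OF v, of w] by (simp only: riem_sym[OF g T v])
  have "g x (tvec_of A c x u) (tvec_of A c x w) = (\<Sum>b\<in>ONB. inner u b * g x (tvec_of A c x b) (tvec_of A c x w))"
    by (rule 1[OF T])
  also have "\<dots> = (\<Sum>b\<in>ONB. inner u b * (\<Sum>b'\<in>ONB. inner w b' * g x (tvec_of A c x b) (tvec_of A c x b')))"
    by (simp only: 2[OF T, of _ w])
  finally show ?thesis
    by (simp only: sum_distrib_left coeff_def chart_facts(5)[OF c] mult.assoc)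
qed

lemma metric_expand:
  assumes g: "riemannian_metric A g" and c: "c \<in> A" "x \<in> fst c" and v: "v \<in> tangent_space A x"
  shows "g x v v = (\<Sum>b\<in>ONB. \<Sum>b'\<in>ONB. inner (v c) b * inner (v c) b' * coeff g c (snd c x) b b')"
  using metric_tvec_expand[OF g c, of "v c" "v c"] tangent_eq_tvec_of[OF v c] by simp

text \<open>The coordinate expression of the metric is a continuous function on the compact product of \<open>K\<close>
  and the unit sphere, and it is positive there.\<close>

lemma metric_chart_bounds:
  assumes g: "riemannian_metric A g" and c: "c \<in> A" and K: "compact K" "K \<subseteq> snd c ` fst c"
  obtains \<kappa> \<Lambda> where "0 < \<kappa>" "0 \<le> \<Lambda>"
    "\<And>x v. x \<in> fst c \<Longrightarrow> snd c x \<in> K \<Longrightarrow> v \<in> tangent_space A x \<Longrightarrow>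
       \<kappa> * (norm (v c))\<^sup>2 \<le> g x v v \<and> g x v v \<le> \<Lambda> * (norm (v c))\<^sup>2"
proof -
  define Q where "Q = (\<lambda>(p, u). \<Sum>b\<in>ONB. \<Sum>b'\<in>ONB. inner u b * inner u b' * coeff g c p b b')"
  have Q: "g x v v = Q (snd c x, v c)" if "x \<in> fst c" "v \<in> tangent_space A x" for x v
    using metric_expand[OF g c that(1,2)] by (simp add: Q_def)
  define S where "S = {u::'e. norm u = 1}"
  have S: "compact S"
    unfolding S_def
    by (rule closed_bounded_compact) (auto simp: bounded_iff intro!: closed_Collect_eq continuous_intros)
  have contQ: "continuous_on (K \<times> S) Q"
    unfolding Q_def case_prod_unfold
  proof (intro continuous_intros)
    fix b b'
    show "continuous_on (K \<times> S) (\<lambda>x. coeff g c (fst x) b b')"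
      by (rule continuous_on_compose2[OF coeff_continuous[OF g c]])
         (use K in \<open>auto intro!: continuous_intros\<close>)
  qed
  \<comment> \<open>By homogeneity it suffices to bound the quadratic form on the unit sphere.\<close>
  have scale: "g x v v = (norm (v c))\<^sup>2 * Q (snd c x, v c /\<^sub>R norm (v c))"
    if "x \<in> fst c" "v \<in> tangent_space A x" "v c \<noteq> 0" for x v
    using that by (simp add: Q Q_def sum_distrib_left power2_eq_square divide_simps)
  have zero: "g x v v = 0" if "x \<in> fst c" "v \<in> tangent_space A x" "v c = 0" for x v
    using that by (simp add: Q Q_def)
  have compKS: "compact (K \<times> S)" by (intro compact_Times K S)
  show thesis
  proof (cases "K \<times> S = {}")
    case True
    have "v c = 0" if "snd c x \<in> K" for x and v :: "('m, 'e) tvec"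
    proof (rule ccontr)
      assume "v c \<noteq> 0"
      then have "v c /\<^sub>R norm (v c) \<in> S" by (simp add: S_def)
      then show False using True that by blast
    qed
    then show thesis using zero by (intro that[of 1 0]) auto
  next
    case False
    obtain z1 where z1: "z1 \<in> K \<times> S" "\<And>z. z \<in> K \<times> S \<Longrightarrow> Q z1 \<le> Q z"
      using continuous_attains_inf[OF compKS False contQ] by blast
    obtain z2 where z2: "z2 \<in> K \<times> S" "\<And>z. z \<in> K \<times> S \<Longrightarrow> Q z \<le> Q z2"
      using continuous_attains_sup[OF compKS False contQ] by blast
    have posQ: "0 < Q z" if z: "z \<in> K \<times> S" for z
    proof -
      obtain p u where pu: "z = (p, u)" "p \<in> K" "u \<in> S" using z by auto
      let ?x = "chart_inv c p"
      have x: "?x \<in> fst c" "snd c ?x = p" using chart_facts(6,7)[OF c, of p] K pu by auto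
      have "tvec_of A c ?x u c \<noteq> 0" using tvec_of_self[OF c x(1)] pu by (auto simp: S_def)
      then have "tvec_of A c ?x u \<noteq> (\<lambda>_. 0)" by metis
      then have "0 < g ?x (tvec_of A c ?x u) (tvec_of A c ?x u)"
        by (intro riem_pos[OF g] tvec_of_tangent[OF c x(1)])
      then show ?thesis
        using Q[OF x(1) tvec_of_tangent[OF c x(1)]] x tvec_of_self[OF c x(1)] pu by simp
    qed
    show thesis
    proof (rule that[OF posQ[OF z1(1)] less_imp_le[OF posQ[OF z2(1)]]])
      fix x v assume x: "x \<in> fst c" "snd c x \<in> K" and v: "v \<in> tangent_space A x"
      show "Q z1 * (norm (v c))\<^sup>2 \<le> g x v v \<and> g x v v \<le> Q z2 * (norm (v c))\<^sup>2"
      proof (cases "v c = 0")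
        case True
        then show ?thesis using zero[OF x(1) v] by simp
      next
        case False
        then have "(snd c x, v c /\<^sub>R norm (v c)) \<in> K \<times> S" using x by (simp add: S_def)
        then have "Q z1 \<le> Q (snd c x, v c /\<^sub>R norm (v c))" "Q (snd c x, v c /\<^sub>R norm (v c)) \<le> Q z2"
          by (auto intro: z1(2) z2(2))
        then show ?thesis unfolding scale[OF x(1) v False]
          by (auto simp only: mult.commute[of _ "(norm (v c))\<^sup>2"] intro!: mult_left_mono zero_le_power2)
      qed
    qed
  qed
qed

section \<open>Energy of curves\<close>

definition speed2 :: "('m, 'e) metric \<Rightarrow> (real \<Rightarrow> 'm) \<Rightarrow> real \<Rightarrow> ennreal" where
  "speed2 g \<gamma> s = ennreal (g (\<gamma> s) (velocity A \<gamma> s) (velocity A \<gamma> s))"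

definition energy :: "('m, 'e) metric \<Rightarrow> real \<Rightarrow> real \<Rightarrow> (real \<Rightarrow> 'm) \<Rightarrow> ennreal" where
  "energy g a b \<gamma> = (\<integral>\<^sup>+s\<in>{a..b}. speed2 g \<gamma> s \<partial>lebesgue)"

lemma AE_not_eq: "AE s in lebesgue. s \<noteq> (a::real)"
proof -
  have "{a} \<in> null_sets lebesgue" using negligible_iff_null_sets[of "{a}"] by simp
  from AE_not_in[OF this] show ?thesis by simp
qed

lemma AE_interior: "AE s in lebesgue. s \<in> {a..b} \<longrightarrow> s \<in> {a<..<b::real}"
  using AE_not_eq[of a] AE_not_eq[of b] by eventually_elim auto

lemma AE_regular:
  assumes "ac_curve a b \<gamma>"
  shows "AE s in lebesgue. s \<in> {a..b} \<longrightarrow> s \<in> {a<..<b} \<and> regular_at \<gamma> s"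
  using AE_interior[of a b] ac_curve_regular_ae[OF assms] by eventually_elim auto

lemma indicator_continuous_measurable:
  fixes f :: "real \<Rightarrow> real"
  assumes "continuous_on {r..s} f"
  shows "(\<lambda>x. indicator {r..s} x * f x) \<in> borel_measurable lebesgue"
proof -
  have "(\<lambda>x. indicator {r..s} x *\<^sub>R f x) \<in> borel_measurable borel"
    by (rule borel_measurable_continuous_on_indicator) (use assms in auto)
  then have "(\<lambda>x. indicator {r..s} x * f x) \<in> borel_measurable lborel" by simp
  then show ?thesis by (rule measurable_completion)
qed

text \<open>The integrand is a polynomial in continuous functions and in the derivatives of the coordinates;
  the latter are measurable because they are integrable by the fundamental theorem.\<close>

lemma speed2_measurable_local:
  assumes g: "riemannian_metric A g" and c: "c \<in> A" and im: "\<gamma> ` {r..s} \<subseteq> fst c"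
    and cont: "continuous_on {r..s} \<gamma>" and ac: "abs_continuous_on r s (snd c \<circ> \<gamma>)"
  shows "(\<lambda>\<tau>. speed2 g \<gamma> \<tau> * indicator {r..s} \<tau>) \<in> borel_measurable lebesgue"
proof (cases "r \<le> s")
  case True
  let ?f = "snd c \<circ> \<gamma>"
  define p where "p b \<tau> = indicator {r..s} \<tau> * (if (\<lambda>\<tau>. inner (?f \<tau>) b) differentiable (at \<tau>)
     then vector_derivative (\<lambda>\<tau>. inner (?f \<tau>) b) (at \<tau>) else 0)" for b \<tau>
  have p[measurable]: "p b \<in> borel_measurable lebesgue" for b
  proof -
    have "abs_continuous_on r s (\<lambda>\<tau>. inner (?f \<tau>) b)"
    proof (rule abs_continuous_on_lipschitz[OF ac])
      fix \<sigma> \<tau>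
      show "norm (inner (?f \<tau>) b - inner (?f \<sigma>) b) \<le> norm b * norm (?f \<tau> - ?f \<sigma>)"
        using Cauchy_Schwarz_ineq2[of "?f \<tau> - ?f \<sigma>" b] by (simp add: inner_diff_left mult.commute)
    qed
    from abs_continuous_has_integral[OF this True] show ?thesis
      unfolding p_def by (intro has_integral_implies_lebesgue_measurable[THEN measurable_cong[THEN iffD1, rotated]]) auto
  qed
  define k where "k b b' \<tau> = indicator {r..s} \<tau> * coeff g c (snd c (\<gamma> \<tau>)) b b'" for b b' \<tau>
  have k[measurable]: "k b b' \<in> borel_measurable lebesgue" for b b'
    unfolding k_def
  proof (rule indicator_continuous_measurable)
    have "continuous_on {r..s} (\<lambda>\<tau>. snd c (\<gamma> \<tau>))"
      by (rule continuous_on_compose2[OF chart_facts(3)[OF c] cont]) (use im in auto)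
    then show "continuous_on {r..s} (\<lambda>\<tau>. coeff g c (snd c (\<gamma> \<tau>)) b b')"
      by (rule continuous_on_compose2[OF coeff_continuous[OF g c]]) (use im in auto)
  qed
  define h where "h \<tau> = (\<Sum>b\<in>ONB. \<Sum>b'\<in>ONB. p b \<tau> * p b' \<tau> * k b b' \<tau>)" for \<tau>
  let ?q = "\<lambda>\<tau>. g (\<gamma> \<tau>) (velocity A \<gamma> \<tau>) (velocity A \<gamma> \<tau>) * indicator {r..s} \<tau>"
  have h: "h \<in> borel_measurable lebesgue" unfolding h_def by measurable
  have "AE \<tau> in lebesgue. \<tau> \<in> {r<..<s} \<longrightarrow> ?f differentiable (at \<tau>)"
  proof -
    have "{x \<in> {r<..<s}. \<not> ?f differentiable at x} \<in> null_sets lebesgue"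
      using abs_continuous_vector_differentiable_ae[OF ac] by (simp add: negligible_iff_null_sets)
    from AE_not_in[OF this] show ?thesis by eventually_elim auto
  qed
  then have "AE \<tau> in lebesgue. h \<tau> = ?q \<tau>"
    using AE_interior[of r s]
  proof eventually_elim
    case (elim \<tau>)
    show ?case
    proof (cases "\<tau> \<in> {r..s}")
      case True
      then have \<tau>: "\<tau> \<in> {r<..<s}" "?f differentiable (at \<tau>)" using elim by auto
      have "isCont \<gamma> \<tau>" using cont \<tau> by (metis continuous_on_interior interior_atLeastAtMost_real)
      moreover have x: "\<gamma> \<tau> \<in> fst c" using im True by auto
      moreover have der: "(?f has_vector_derivative vector_derivative ?f (at \<tau>)) (at \<tau>)"
        using \<tau>(2) by (simp add: vector_derivative_works)
      ultimately have vel: "velocity A \<gamma> \<tau> = tvec_of A c (\<gamma> \<tau>) (vector_derivative ?f (at \<tau>))"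
        using velocity_eq c by blast
      have pb: "p b \<tau> = inner (vector_derivative ?f (at \<tau>)) b" for b
      proof -
        have "((\<lambda>\<tau>. inner (?f \<tau>) b) has_vector_derivative inner (vector_derivative ?f (at \<tau>)) b) (at \<tau>)"
          by (rule bounded_linear.has_vector_derivative[OF bounded_linear_inner_left der])
        then show ?thesis using True
          by (simp add: p_def vector_derivative_at differentiableI_vector)
      qed
      show ?thesis
        using True unfolding h_def pb vel metric_tvec_expand[OF g c x] by (simp add: k_def)
    next
      case False
      then show ?thesis by (simp add: h_def p_def)
    qed
  qed
  then have [measurable]: "?q \<in> borel_measurable lebesgue" by (rule borel_measurable_AE[OF h])
  have "(\<lambda>\<tau>. ennreal (?q \<tau>)) \<in> borel_measurable lebesgue" by measurable
  moreover have "ennreal (?q \<tau>) = speed2 g \<gamma> \<tau> * indicator {r..s} \<tau>" for \<tau>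
    by (simp add: speed2_def indicator_def)
  ultimately show ?thesis by simp
qed simp

lemma speed2_measurable:
  assumes g: "riemannian_metric A g" and ac: "ac_curve a b \<gamma>"
  shows "(\<lambda>\<tau>. speed2 g \<gamma> \<tau> * indicator {a..b} \<tau>) \<in> borel_measurable lebesgue"
proof (cases "a \<le> b")
  case True
  with ac show ?thesis
  proof (rule curve_subdivision)
    fix r m s :: real
    assume *: "r \<le> m" "m \<le> s" "(\<lambda>\<tau>. speed2 g \<gamma> \<tau> * indicator {r..m} \<tau>) \<in> borel_measurable lebesgue"
      "(\<lambda>\<tau>. speed2 g \<gamma> \<tau> * indicator {m..s} \<tau>) \<in> borel_measurable lebesgue"
    have "(\<lambda>\<tau>. max (speed2 g \<gamma> \<tau> * indicator {r..m} \<tau>) (speed2 g \<gamma> \<tau> * indicator {m..s} \<tau>)) \<in> borel_measurable lebesgue"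
      by (intro borel_measurable_max *(3,4))
    moreover have "max (speed2 g \<gamma> \<tau> * indicator {r..m} \<tau>) (speed2 g \<gamma> \<tau> * indicator {m..s} \<tau>) =
       speed2 g \<gamma> \<tau> * indicator {r..s} \<tau>" for \<tau>
      using *(1,2) by (auto simp: indicator_def max_def)
    ultimately show "(\<lambda>\<tau>. speed2 g \<gamma> \<tau> * indicator {r..s} \<tau>) \<in> borel_measurable lebesgue" by simp
  qed (rule speed2_measurable_local[OF g])
qed simp

lemma energy_combine:
  assumes g: "riemannian_metric A g" and 1: "ac_curve a m \<gamma>" and 2: "ac_curve m b \<gamma>"
    and m: "a \<le> m" "m \<le> b"
  shows "energy g a b \<gamma> = energy g a m \<gamma> + energy g m b \<gamma>"
proof -
  have "energy g a m \<gamma> + energy g m b \<gamma> =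
     (\<integral>\<^sup>+s. speed2 g \<gamma> s * indicator {a..m} s + speed2 g \<gamma> s * indicator {m..b} s \<partial>lebesgue)"
    unfolding energy_def by (rule nn_integral_add[symmetric]) (intro speed2_measurable g 1 2)+
  also have "\<dots> = energy g a b \<gamma>"
    unfolding energy_def
  proof (rule nn_integral_cong_AE)
    show "AE s in lebesgue. speed2 g \<gamma> s * indicator {a..m} s + speed2 g \<gamma> s * indicator {m..b} s =
       speed2 g \<gamma> s * indicator {a..b} s"
      using AE_not_eq[of m] by eventually_elim (use m in \<open>auto simp: indicator_def\<close>)
  qed
  finally show ?thesis ..
qed

lemma energy_cong:
  assumes "\<And>s. s \<in> {a<..<b} \<Longrightarrow> \<gamma> s = \<gamma>' s"
  shows "energy g a b \<gamma> = energy g a b \<gamma>'"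
  unfolding energy_def
proof (rule nn_integral_cong_AE)
  have eq: "speed2 g \<gamma> s = speed2 g \<gamma>' s" if s: "s \<in> {a<..<b}" for s
  proof -
    have ev: "\<forall>\<^sub>F \<tau> in nhds s. \<gamma> \<tau> = \<gamma>' \<tau>"
      using s assms by (auto simp: eventually_nhds intro!: exI[of _ "{a<..<b}"])
    have vd: "vector_derivative (snd c \<circ> \<gamma>) (at s) = vector_derivative (snd c \<circ> \<gamma>') (at s)" for c :: "('m, 'e) chart"
      by (rule vector_derivative_cong_eq) (use ev in \<open>auto elim: eventually_mono\<close>)
    have "velocity A \<gamma> s = velocity A \<gamma>' s"
    proof
      fix c show "velocity A \<gamma> s c = velocity A \<gamma>' s c"
        unfolding velocity_def assms[OF s] vd[of c] ..
    qed
    then show ?thesis using assms[OF s] by (simp add: speed2_def)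
  qed
  show "AE s in lebesgue. speed2 g \<gamma> s * indicator {a..b} s = speed2 g \<gamma>' s * indicator {a..b} s"
    using AE_interior[of a b] by eventually_elim (use eq in \<open>auto simp: indicator_def\<close>)
qed

text \<open>The velocity enters squared and time once, which leaves one factor \<open>\<bar>k\<bar>\<close>.\<close>

lemma energy_affine:
  assumes g: "riemannian_metric A g" and ac: "ac_curve a' b' \<gamma>" and k: "k \<noteq> 0"
    and im: "\<And>s. s \<in> {a..b} \<longleftrightarrow> k * s + t \<in> {a'..b'}"
  shows "energy g a b (\<lambda>s. \<gamma> (k * s + t)) = ennreal \<bar>k\<bar> * energy g a' b' \<gamma>"
proof -
  let ?\<gamma> = "\<lambda>s. \<gamma> (k * s + t)"
  let ?G = "\<lambda>s. speed2 g \<gamma> s * indicator {a'..b'} s"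
  have ac': "ac_curve a b ?\<gamma>" by (rule ac_curve_affine[OF ac k]) (use im in blast)
  have G[measurable]: "?G \<in> borel_measurable lebesgue" by (rule speed2_measurable[OF g ac])
  have "energy g a b ?\<gamma> = (\<integral>\<^sup>+s. ennreal (k\<^sup>2) * ?G (t + k * s) \<partial>lebesgue)"
    unfolding energy_def
  proof (rule nn_integral_cong_AE)
    show "AE s in lebesgue. speed2 g ?\<gamma> s * indicator {a..b} s = ennreal (k\<^sup>2) * ?G (t + k * s)"
      using AE_regular[OF ac']
    proof eventually_elim
      case (elim s)
      show ?case
      proof (cases "s \<in> {a..b}")
        case True
        then have r: "regular_at ?\<gamma> s" using elim by blast
        have "speed2 g ?\<gamma> s = ennreal (k\<^sup>2) * speed2 g \<gamma> (k * s + t)"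
          unfolding speed2_def velocity_affine(2)[OF r k]
            riem_quadratic[OF g velocity_tangent[OF velocity_affine(1)[OF r k]]]
          by (simp add: ennreal_mult' riem_nonneg[OF g velocity_tangent[OF velocity_affine(1)[OF r k]]])
        then show ?thesis using True im[of s] by (simp add: add.commute mult.assoc)
      next
        case False
        then have out: "t + k * s \<notin> {a'..b'}" using im[of s] by (auto simp: add.commute)
        show ?thesis
          unfolding indicator_simps(2)[OF False] indicator_simps(2)[OF out] by simp
      qed
    qed
  qed
  also have "\<dots> = ennreal (k\<^sup>2) * (\<integral>\<^sup>+s. ?G (t + k * s) \<partial>lebesgue)"
  proof (rule nn_integral_cmult)
    have "(\<lambda>s. t + k * s) \<in> lebesgue \<rightarrow>\<^sub>M lebesgue"
      using lebesgue_affine_measurable[where c = "\<lambda>x::real. k" and t = t] k by simp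
    from measurable_compose[OF this G] show "(\<lambda>s. ?G (t + k * s)) \<in> borel_measurable lebesgue" .
  qed
  also have "\<dots> = ennreal \<bar>k\<bar> * (ennreal \<bar>k\<bar> * (\<integral>\<^sup>+s. ?G (t + k * s) \<partial>lebesgue))"
    by (simp add: mult.assoc[symmetric] ennreal_mult[symmetric] power2_eq_square abs_mult_self_eq)
  also have "ennreal \<bar>k\<bar> * (\<integral>\<^sup>+s. ?G (t + k * s) \<partial>lebesgue) = energy g a' b' \<gamma>"
    unfolding energy_def by (rule nn_integral_real_affine_lebesgue[OF G k, symmetric])
  finally show ?thesis .
qed

lemma energy_mono:
  assumes g: "riemannian_metric A g2" and ac: "ac_curve a b \<gamma>" and C: "0 \<le> C"
    and le: "\<And>s v. s \<in> {a..b} \<Longrightarrow> v \<in> tangent_space A (\<gamma> s) \<Longrightarrow> g1 (\<gamma> s) v v \<le> C * g2 (\<gamma> s) v v"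
  shows "energy g1 a b \<gamma> \<le> ennreal C * energy g2 a b \<gamma>"
proof -
  have "energy g1 a b \<gamma> \<le> (\<integral>\<^sup>+s. ennreal C * (speed2 g2 \<gamma> s * indicator {a..b} s) \<partial>lebesgue)"
    unfolding energy_def
  proof (rule nn_integral_mono_AE)
    show "AE s in lebesgue. speed2 g1 \<gamma> s * indicator {a..b} s \<le> ennreal C * (speed2 g2 \<gamma> s * indicator {a..b} s)"
      using AE_regular[OF ac]
    proof eventually_elim
      case (elim s)
      show ?case
      proof (cases "s \<in> {a..b}")
        case True
        then have v: "velocity A \<gamma> s \<in> tangent_space A (\<gamma> s)" using elim velocity_tangent by blast
        then show ?thesis using True le[OF True v] C
          by (simp add: speed2_def ennreal_mult'[symmetric] ennreal_leI)
      qed simp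
    qed
  qed
  also have "\<dots> = ennreal C * energy g2 a b \<gamma>"
    unfolding energy_def by (rule nn_integral_cmult[OF speed2_measurable[OF g ac]])
  finally show ?thesis .
qed

definition is_pullback :: "('m, 'e) metric \<Rightarrow> ('m \<Rightarrow> 'm) \<Rightarrow> ('m, 'e) metric \<Rightarrow> bool" where
  "is_pullback g1 f g2 \<longleftrightarrow>
     (\<forall>x. \<forall>v\<in>tangent_space A x. g1 x v v = g2 (f x) (tangent_map A f x v) (tangent_map A f x v))"

lemma energy_image:
  assumes ac: "ac_curve a b \<gamma>" and f: "smooth_map A f" and eq: "is_pullback g1 f g2"
  shows "energy g1 a b \<gamma> = energy g2 a b (f \<circ> \<gamma>)"
  unfolding energy_def
proof (rule nn_integral_cong_AE)
  show "AE s in lebesgue. speed2 g1 \<gamma> s * indicator {a..b} s = speed2 g2 (f \<circ> \<gamma>) s * indicator {a..b} s"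
    using AE_regular[OF ac]
  proof eventually_elim
    case (elim s)
    show ?case
    proof (cases "s \<in> {a..b}")
      case True
      then have r: "regular_at \<gamma> s" using elim by blast
      show ?thesis
        using eq velocity_tangent[OF r]
        unfolding speed2_def velocity_image[OF r f] is_pullback_def by simp
    qed simp
  qed
qed


section \<open>The distance given by minimal energy\<close>

definition min_energy :: "('m, 'e) metric \<Rightarrow> 'm \<Rightarrow> 'm \<Rightarrow> ennreal" where
  "min_energy g x y = (INF \<gamma>\<in>{\<gamma>. ac_curve 0 1 \<gamma> \<and> \<gamma> 0 = x \<and> \<gamma> 1 = y}. energy g 0 1 \<gamma>)"

lemma min_energy_le: "ac_curve 0 1 \<gamma> \<Longrightarrow> min_energy g (\<gamma> 0) (\<gamma> 1) \<le> energy g 0 1 \<gamma>"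
  unfolding min_energy_def by (rule INF_lower) simp

lemma min_energy_less:
  assumes "min_energy g x y < a"
  obtains \<gamma> where "ac_curve 0 1 \<gamma>" "\<gamma> 0 = x" "\<gamma> 1 = y" "energy g 0 1 \<gamma> < a"
  using assms unfolding min_energy_def INF_less_iff by blast

text \<open>Rescale the time interval to \<open>[0, 1]\<close>.\<close>

lemma min_energy_subcurve:
  assumes g: "riemannian_metric A g" and ac: "ac_curve a b \<gamma>" and ab: "a < b"
  shows "min_energy g (\<gamma> a) (\<gamma> b) \<le> ennreal (b - a) * energy g a b \<gamma>"
proof -
  let ?k = "b - a"
  have k: "?k \<noteq> 0" "0 < ?k" using ab by auto
  have im: "s \<in> {0..1} \<longleftrightarrow> ?k * s + a \<in> {a..b}" for s
  proof -
    have "0 \<le> ?k * s \<longleftrightarrow> 0 \<le> s" using k by (simp add: zero_le_mult_iff)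
    moreover have "?k * s \<le> ?k \<longleftrightarrow> s \<le> 1" using k by simp
    ultimately show ?thesis by auto
  qed
  have "ac_curve 0 1 (\<lambda>s. \<gamma> (?k * s + a))" by (rule ac_curve_affine[OF ac k(1)]) (use im in blast)
  from min_energy_le[OF this, of g]
  have "min_energy g (\<gamma> a) (\<gamma> b) \<le> energy g 0 1 (\<lambda>s. \<gamma> (?k * s + a))" by simp
  also have "\<dots> = ennreal \<bar>?k\<bar> * energy g a b \<gamma>" by (rule energy_affine[OF g ac k(1) im])
  finally show ?thesis using k by simp
qed

lemma min_energy_sym_le:
  assumes g: "riemannian_metric A g"
  shows "min_energy g y x \<le> min_energy g x y"
proof (rule ccontr)
  assume "\<not> ?thesis"
  then have "min_energy g x y < min_energy g y x" by simp
  then obtain \<gamma> where ac: "ac_curve 0 1 \<gamma>" and e: "\<gamma> 0 = x" "\<gamma> 1 = y" "energy g 0 1 \<gamma> < min_energy g y x"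
    by (rule min_energy_less)
  have "ac_curve 0 1 (\<lambda>s. \<gamma> (- 1 * s + 1))" by (rule ac_curve_affine[OF ac]) auto
  from min_energy_le[OF this, of g] e
  have "min_energy g y x \<le> energy g 0 1 (\<lambda>s. \<gamma> (- 1 * s + 1))" by simp
  also have "\<dots> = ennreal \<bar>- 1\<bar> * energy g 0 1 \<gamma>" by (rule energy_affine[OF g ac]) auto
  finally show False using e by simp
qed

lemma min_energy_sym: "riemannian_metric A g \<Longrightarrow> min_energy g y x = min_energy g x y"
  by (intro antisym min_energy_sym_le)

lemma ac_curve_cong:
  assumes ac: "ac_curve a b \<gamma>" and eq: "\<And>s. s \<in> {a..b} \<Longrightarrow> \<gamma>' s = \<gamma> s"
  shows "ac_curve a b \<gamma>'"
  unfolding ac_curve_def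
proof (intro conjI ballI)
  show "continuous_on {a..b} \<gamma>'"
    using ac eq continuous_on_cong[of "{a..b}" "{a..b}" \<gamma>' \<gamma>] by (simp add: ac_curve_def)
  fix u assume u: "u \<in> {a..b}"
  then obtain c d where c: "c \<in> A" "\<gamma> u \<in> fst c" and d: "0 < d"
    "\<forall>r s. a \<le> r \<and> r \<le> u \<and> u \<le> s \<and> s \<le> b \<and> s - r < d \<longrightarrow> abs_continuous_on r s (snd c \<circ> \<gamma>)"
    using ac unfolding ac_curve_def ac_at_def by meson
  have "ac_at a b u (snd c \<circ> \<gamma>')"
    unfolding ac_at_def
  proof (intro exI[of _ d] conjI d(1) allI impI)
    fix r s assume rs: "a \<le> r \<and> r \<le> u \<and> u \<le> s \<and> s \<le> b \<and> s - r < d"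
    with d(2) have "abs_continuous_on r s (snd c \<circ> \<gamma>)" by blast
    then show "abs_continuous_on r s (snd c \<circ> \<gamma>')"
      by (rule abs_continuous_on_lipschitz[where K = 1]) (use rs in \<open>simp add: eq\<close>)
  qed
  then show "\<exists>c\<in>A. \<gamma>' u \<in> fst c \<and> ac_at a b u (snd c \<circ> \<gamma>')" using c eq[OF u] by metis
qed

text \<open>Follow the first curve during the time \<open>l\<close> and the second one during the remaining time.\<close>

lemma min_energy_concat:
  assumes g: "riemannian_metric A g" and l: "0 < l" "l < 1"
  shows "min_energy g x z \<le> ennreal (1 / l) * min_energy g x y + ennreal (1 / (1 - l)) * min_energy g y z"
proof -
  have main: "min_energy g x z \<le> ennreal (1 / l) * energy g 0 1 \<gamma>1 + ennreal (1 / (1 - l)) * energy g 0 1 \<gamma>2"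
    if 1: "ac_curve 0 1 \<gamma>1" "\<gamma>1 0 = x" "\<gamma>1 1 = y" and 2: "ac_curve 0 1 \<gamma>2" "\<gamma>2 0 = y" "\<gamma>2 1 = z" for \<gamma>1 \<gamma>2
  proof -
    define \<delta>1 where "\<delta>1 s = \<gamma>1 (1 / l * s + 0)" for s
    define \<delta>2 where "\<delta>2 s = \<gamma>2 (1 / (1 - l) * s + (- l / (1 - l)))" for s
    define \<delta> where "\<delta> s = (if s \<le> l then \<delta>1 s else \<delta>2 s)" for s
    have im1: "s \<in> {0..l} \<longleftrightarrow> 1 / l * s + 0 \<in> {0..1}" for s
      using l by (auto simp: field_simps zero_le_divide_iff)
    have eq2: "1 / (1 - l) * s + (- l / (1 - l)) = (s - l) / (1 - l)" for s
      by (simp add: diff_divide_distrib)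
    have im2: "s \<in> {l..1} \<longleftrightarrow> 1 / (1 - l) * s + (- l / (1 - l)) \<in> {0..1}" for s
      unfolding eq2 using l by (auto simp: zero_le_divide_iff divide_le_eq_1)
    have \<delta>1: "ac_curve 0 l \<delta>1" unfolding \<delta>1_def
      by (rule ac_curve_affine[OF 1(1)]) (use im1 l in auto)
    have \<delta>2: "ac_curve l 1 \<delta>2" unfolding \<delta>2_def
      by (rule ac_curve_affine[OF 2(1)]) (use l in simp, use im2 in blast)
    have ends: "\<delta>1 0 = x" "\<delta>1 l = y" "\<delta>2 l = y" "\<delta>2 1 = z"
      unfolding \<delta>1_def \<delta>2_def eq2 using 1 2 l by simp_all
    have a1: "ac_curve 0 l \<delta>" by (rule ac_curve_cong[OF \<delta>1]) (simp add: \<delta>_def)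
    have a2: "ac_curve l 1 \<delta>" by (rule ac_curve_cong[OF \<delta>2]) (use ends in \<open>auto simp: \<delta>_def\<close>)
    have ac: "ac_curve 0 1 \<delta>" by (rule ac_curve_combine[OF a1 a2]) (use l in auto)
    have "\<delta> 0 = x" "\<delta> 1 = z" using ends l by (auto simp: \<delta>_def)
    then have "min_energy g x z \<le> energy g 0 1 \<delta>" using min_energy_le[OF ac] by metis
    also have "\<dots> = energy g 0 l \<delta> + energy g l 1 \<delta>"
      by (rule energy_combine[OF g a1 a2]) (use l in auto)
    also have "energy g 0 l \<delta> = energy g 0 l \<delta>1" by (rule energy_cong) (simp add: \<delta>_def)
    also have "energy g l 1 \<delta> = energy g l 1 \<delta>2" by (rule energy_cong) (simp add: \<delta>_def)
    also have "energy g 0 l \<delta>1 = ennreal \<bar>1 / l\<bar> * energy g 0 1 \<gamma>1"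
      unfolding \<delta>1_def by (rule energy_affine[OF g 1(1) _ im1]) (use l in simp)
    also have "energy g l 1 \<delta>2 = ennreal \<bar>1 / (1 - l)\<bar> * energy g 0 1 \<gamma>2"
      unfolding \<delta>2_def by (rule energy_affine[OF g 2(1) _ im2]) (use l in simp)
    finally show ?thesis using l by simp
  qed
  show ?thesis
  proof (cases "min_energy g x y = \<infinity> \<or> min_energy g y z = \<infinity>")
    case True
    then show ?thesis using l by (auto simp: ennreal_mult_top)
  next
    case False
    then obtain p q where pq: "min_energy g x y = ennreal p" "0 \<le> p" "min_energy g y z = ennreal q" "0 \<le> q"
      by (metis ennreal_cases infinity_ennreal_def)
    have l': "0 < 1 / l + 1 / (1 - l)" using l by (simp add: add_pos_pos)
    show ?thesis
    proof (rule ennreal_le_epsilon)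
      fix e :: real assume e: "0 < e"
      define e' where "e' = e / (1 / l + 1 / (1 - l))"
      have e': "0 < e'" using e l' by (simp add: e'_def)
      have "min_energy g x y < ennreal (p + e')" "min_energy g y z < ennreal (q + e')"
        using pq e' by (simp_all add: ennreal_lessI)
      then obtain \<gamma>1 \<gamma>2 where \<gamma>: "ac_curve 0 1 \<gamma>1" "\<gamma>1 0 = x" "\<gamma>1 1 = y" "energy g 0 1 \<gamma>1 < ennreal (p + e')"
        "ac_curve 0 1 \<gamma>2" "\<gamma>2 0 = y" "\<gamma>2 1 = z" "energy g 0 1 \<gamma>2 < ennreal (q + e')"
        by (metis min_energy_less)
      have "min_energy g x z \<le> ennreal (1 / l) * energy g 0 1 \<gamma>1 + ennreal (1 / (1 - l)) * energy g 0 1 \<gamma>2"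
        by (rule main) (use \<gamma> in auto)
      also have "\<dots> \<le> ennreal (1 / l) * ennreal (p + e') + ennreal (1 / (1 - l)) * ennreal (q + e')"
        by (intro add_mono mult_left_mono) (use \<gamma> in auto)
      also have "\<dots> = ennreal ((1 / l) * (p + e') + (1 / (1 - l)) * (q + e'))"
        using l pq e' by (simp add: ennreal_mult[symmetric] ennreal_plus[symmetric] del: ennreal_plus)
      also have "(1 / l) * (p + e') + (1 / (1 - l)) * (q + e') = (1 / l) * p + (1 / (1 - l)) * q + e' * (1 / l + 1 / (1 - l))"
        by (simp add: algebra_simps add_divide_distrib)
      also have "e' * (1 / l + 1 / (1 - l)) = e" using l' by (simp add: e'_def)
      also have "ennreal ((1 / l) * p + (1 / (1 - l)) * q + e) =
          ennreal (1 / l) * min_energy g x y + ennreal (1 / (1 - l)) * min_energy g y z + ennreal e"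
        using l pq e by (simp add: ennreal_mult[symmetric] ennreal_plus[symmetric] del: ennreal_plus)
      finally show "min_energy g x z \<le> ennreal (1 / l) * min_energy g x y + ennreal (1 / (1 - l)) * min_energy g y z + ennreal e" .
    qed
  qed
qed

lemma min_energy_mono:
  assumes g: "riemannian_metric A g2" and C: "0 < C"
    and le: "\<And>x v. v \<in> tangent_space A x \<Longrightarrow> g1 x v v \<le> C * g2 x v v"
  shows "min_energy g1 x y \<le> ennreal C * min_energy g2 x y"
proof (rule ccontr)
  assume "\<not> ?thesis"
  then have lt: "ennreal C * min_energy g2 x y < min_energy g1 x y" by simp
  have "min_energy g2 x y < min_energy g1 x y / ennreal C"
  proof (rule ccontr)
    assume "\<not> ?thesis"
    then have "ennreal C * (min_energy g1 x y / ennreal C) \<le> ennreal C * min_energy g2 x y"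
      by (intro mult_left_mono) auto
    moreover have "ennreal C * (min_energy g1 x y / ennreal C) = min_energy g1 x y"
      using C by (simp add: ennreal_times_divide ennreal_mult_divide_eq mult.commute[of "ennreal C"] top_neq_ennreal)
    ultimately show False using lt by simp
  qed
  then obtain \<gamma> where ac: "ac_curve 0 1 \<gamma>" and e: "\<gamma> 0 = x" "\<gamma> 1 = y" "energy g2 0 1 \<gamma> < min_energy g1 x y / ennreal C"
    by (rule min_energy_less)
  have "min_energy g1 x y \<le> energy g1 0 1 \<gamma>" using min_energy_le[OF ac] e by metis
  also have "\<dots> \<le> ennreal C * energy g2 0 1 \<gamma>" by (rule energy_mono[OF g ac]) (use C le in auto)
  also have "\<dots> < ennreal C * (min_energy g1 x y / ennreal C)"
    using e(3) C by (intro ennreal_mult_strict_left_mono) auto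
  also have "\<dots> = min_energy g1 x y"
    using C by (simp add: ennreal_times_divide ennreal_mult_divide_eq mult.commute[of "ennreal C"] top_neq_ennreal)
  finally show False by simp
qed

lemma min_energy_image_le:
  assumes f: "smooth_map A f"
    and eq: "is_pullback g1 f g2"
  shows "min_energy g2 (f x) (f y) \<le> min_energy g1 x y"
proof (rule ccontr)
  assume "\<not> ?thesis"
  then have "min_energy g1 x y < min_energy g2 (f x) (f y)" by simp
  then obtain \<gamma> where ac: "ac_curve 0 1 \<gamma>" and e: "\<gamma> 0 = x" "\<gamma> 1 = y" "energy g1 0 1 \<gamma> < min_energy g2 (f x) (f y)"
    by (rule min_energy_less)
  have "min_energy g2 (f x) (f y) \<le> energy g2 0 1 (f \<circ> \<gamma>)"
    using min_energy_le[OF ac_curve_image[OF ac f], of g2] e by simp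
  also have "\<dots> = energy g1 0 1 \<gamma>" by (rule energy_image[OF ac f eq, symmetric])
  finally show False using e by simp
qed

lemma min_energy_image:
  assumes f: "smooth_map A f" and f': "smooth_map A f'" "\<And>x. f (f' x) = x" "\<And>x. f' (f x) = x"
    and eq: "is_pullback g1 f g2"
  shows "min_energy g1 x y = min_energy g2 (f x) (f y)"
proof (rule antisym)
  show "min_energy g2 (f x) (f y) \<le> min_energy g1 x y" by (rule min_energy_image_le[OF f eq])
  show "min_energy g1 x y \<le> min_energy g2 (f x) (f y)"
  proof (rule ccontr)
    assume "\<not> ?thesis"
    then have "min_energy g2 (f x) (f y) < min_energy g1 x y" by simp
    then obtain \<gamma> where ac: "ac_curve 0 1 \<gamma>" and e: "\<gamma> 0 = f x" "\<gamma> 1 = f y" "energy g2 0 1 \<gamma> < min_energy g1 x y"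
      by (rule min_energy_less)
    have ac': "ac_curve 0 1 (f' \<circ> \<gamma>)" by (rule ac_curve_image[OF ac f'(1)])
    have "f \<circ> (f' \<circ> \<gamma>) = \<gamma>" using f'(2) by (simp add: fun_eq_iff)
    then have "energy g1 0 1 (f' \<circ> \<gamma>) = energy g2 0 1 \<gamma>" using energy_image[OF ac' f eq] by simp
    moreover have "min_energy g1 x y \<le> energy g1 0 1 (f' \<circ> \<gamma>)"
      using min_energy_le[OF ac', of g1] e f'(3) by simp
    ultimately show False using e by simp
  qed
qed

text \<open>The competitor is a coordinate segment: its energy is at most a constant times the square of its
  coordinate length.\<close>

lemma min_energy_small_near:
  assumes g: "riemannian_metric A g" and e: "0 < e"
  obtains U where "open U" "y \<in> U" "\<And>z. z \<in> U \<Longrightarrow> min_energy g y z < ennreal e"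
proof -
  obtain c where c: "c \<in> A" "y \<in> fst c" by (rule chart_exists)
  define p where "p = snd c y"
  have "p \<in> snd c ` fst c" using c by (simp add: p_def)
  then obtain \<rho> where \<rho>: "0 < \<rho>" "cball p \<rho> \<subseteq> snd c ` fst c"
    using chart_facts(2)[OF c(1)] open_contains_cball by blast
  have comp: "compact (cball p \<rho>)" by (rule closed_bounded_compact) auto
  obtain \<kappa> \<Lambda> where \<Lambda>: "0 < \<kappa>" "0 \<le> \<Lambda>"
    "\<And>x v. x \<in> fst c \<Longrightarrow> snd c x \<in> cball p \<rho> \<Longrightarrow> v \<in> tangent_space A x \<Longrightarrow>
       \<kappa> * (norm (v c))\<^sup>2 \<le> g x v v \<and> g x v v \<le> \<Lambda> * (norm (v c))\<^sup>2"
    by (rule metric_chart_bounds[OF g c(1) comp \<rho>(2)]) blast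
  define r where "r = min \<rho> (sqrt (e / (\<Lambda> + 1)))"
  have r: "0 < r" "r \<le> \<rho>" using \<rho> e \<Lambda> by (auto simp: r_def)
  have r2: "\<Lambda> * r\<^sup>2 < e"
  proof -
    have "r\<^sup>2 \<le> (sqrt (e / (\<Lambda> + 1)))\<^sup>2" using r(1) by (intro power_mono) (auto simp: r_def)
    also have "\<dots> = e / (\<Lambda> + 1)" using e \<Lambda> by simp
    finally have "\<Lambda> * r\<^sup>2 \<le> \<Lambda> * (e / (\<Lambda> + 1))" using \<Lambda> by (intro mult_left_mono)
    also have "\<dots> < e" using e \<Lambda> by (simp add: field_simps)
    finally show ?thesis .
  qed
  have sub: "ball p r \<subseteq> snd c ` fst c" using r \<rho>(2) by (meson ball_subset_cball order_trans subset_ball)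
  show thesis
  proof (rule that)
    show "open (chart_inv c ` ball p r)" by (rule open_chart_inv_image[OF c(1) open_ball sub])
    show "y \<in> chart_inv c ` ball p r"
      using chart_facts(5)[OF c] r by (intro image_eqI[of _ _ p]) (auto simp: p_def)
    fix z assume "z \<in> chart_inv c ` ball p r"
    then obtain q where q: "q \<in> ball p r" "z = chart_inv c q" by blast
    define \<sigma> where "\<sigma> s = p + s *\<^sub>R (q - p)" for s :: real
    define \<gamma> where "\<gamma> s = chart_inv c (\<sigma> s)" for s
    have inb: "\<sigma> s \<in> ball p r" if "s \<in> {0..1}" for s
    proof -
      have "norm (s *\<^sub>R (q - p)) \<le> norm (q - p)" using that by (simp add: mult_left_le_one_le)
      then show ?thesis using q(1) by (simp add: \<sigma>_def dist_norm norm_minus_commute)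
    qed
    have in_c: "\<gamma> s \<in> fst c" "snd c (\<gamma> s) = \<sigma> s" if "s \<in> {0..1}" for s
      using chart_facts(6,7)[OF c(1), of "\<sigma> s"] inb[OF that] sub by (auto simp: \<gamma>_def)
    have cont\<sigma>: "continuous_on S \<sigma>" for S unfolding \<sigma>_def by (intro continuous_intros)
    have cont: "continuous_on {0..1} \<gamma>"
      unfolding \<gamma>_def by (rule continuous_on_compose2[OF chart_facts(4)[OF c(1)] cont\<sigma>]) (use inb sub in blast)
    have ac: "ac_curve 0 1 \<gamma>"
      unfolding ac_curve_def
    proof (intro conjI ballI cont bexI[of _ c] c(1))
      fix u :: real assume u: "u \<in> {0..1}"
      show "\<gamma> u \<in> fst c" by (rule in_c(1)[OF u])
      show "ac_at 0 1 u (snd c \<circ> \<gamma>)"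
        unfolding ac_at_def
      proof (intro exI[of _ 1] conjI allI impI)
        fix r' s' :: real assume rs: "0 \<le> r' \<and> r' \<le> u \<and> u \<le> s' \<and> s' \<le> 1 \<and> s' - r' < 1"
        show "abs_continuous_on r' s' (snd c \<circ> \<gamma>)"
        proof (rule abs_continuous_on_lipschitz[OF abs_continuous_on_ident])
          fix s t assume "s \<in> {r'..s'}" "t \<in> {r'..s'}"
          then have "(snd c \<circ> \<gamma>) t - (snd c \<circ> \<gamma>) s = (t - s) *\<^sub>R (q - p)"
            using rs in_c(2)[of s] in_c(2)[of t] by (simp add: \<sigma>_def algebra_simps)
          then show "norm ((snd c \<circ> \<gamma>) t - (snd c \<circ> \<gamma>) s) \<le> norm (q - p) * norm (t - s)" by simp
        qed
      qed simp
    qed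
    have "\<gamma> 0 = y" "\<gamma> 1 = z" using chart_facts(5)[OF c] by (simp_all add: \<gamma>_def \<sigma>_def p_def q)
    then have "min_energy g y z \<le> energy g 0 1 \<gamma>" using min_energy_le[OF ac] by metis
    also have "\<dots> \<le> (\<integral>\<^sup>+s. ennreal (\<Lambda> * r\<^sup>2) * indicator {0..1} s \<partial>(lebesgue :: real measure))"
      unfolding energy_def
    proof (rule nn_integral_mono_AE)
      show "AE s in lebesgue. speed2 g \<gamma> s * indicator {0..1} s \<le> ennreal (\<Lambda> * r\<^sup>2) * indicator {0..1} s"
        using AE_interior[of 0 1]
      proof eventually_elim
        case (elim s)
        show ?case
        proof (cases "s \<in> {0..1}")
          case True
          then have s: "s \<in> {0<..<1}" using elim by blast
          have isc: "isCont \<gamma> s" using cont s by (metis continuous_on_interior interior_atLeastAtMost_real)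
          have "(\<sigma> has_vector_derivative (q - p)) (at s)"
            unfolding \<sigma>_def has_vector_derivative_def by (auto intro!: derivative_eq_intros)
          then have der: "(snd c \<circ> \<gamma> has_vector_derivative (q - p)) (at s)"
            by (rule has_vector_derivative_transform_within_open[of _ _ _ "{0<..<1}"])
               (use s in_c(2) in auto)
          have vel: "velocity A \<gamma> s = tvec_of A c (\<gamma> s) (q - p)"
            by (rule velocity_eq[OF isc c(1) in_c(1)[OF True] der])
          have "g (\<gamma> s) (velocity A \<gamma> s) (velocity A \<gamma> s) \<le> \<Lambda> * (norm (q - p))\<^sup>2"
            using \<Lambda>(3)[OF in_c(1)[OF True] _ tvec_of_tangent[OF c(1) in_c(1)[OF True]], of "q - p"]
              inb[OF True] r in_c(2)[OF True] tvec_of_self[OF c(1) in_c(1)[OF True]]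
            by (simp add: vel)
          also have "\<dots> \<le> \<Lambda> * r\<^sup>2"
            using q(1) \<Lambda> by (intro mult_left_mono power_mono) (auto simp: dist_norm norm_minus_commute)
          finally show ?thesis using True by (simp add: speed2_def ennreal_leI)
        qed simp
      qed
    qed
    also have "\<dots> = ennreal (\<Lambda> * r\<^sup>2)" by (simp add: nn_integral_cmult_indicator)
    also have "\<dots> < ennreal e" using r2 e by (simp add: ennreal_lessI)
    finally show "min_energy g y z < ennreal e" .
  qed
qed

text \<open>A curve that leaves a coordinate ball has crossed it before its first exit time \<open>t\<close>, while it was
  still inside the chart; by Cauchy--Schwarz this costs a definite energy, since \<open>t \<le> 1\<close>.\<close>

lemma min_energy_ball_in_open:
  assumes g: "riemannian_metric A g" and U: "open U" "y \<in> U"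
  obtains r where "0 < r" "\<And>z. min_energy g y z < ennreal r \<Longrightarrow> z \<in> U"
proof -
  obtain c where c: "c \<in> A" "y \<in> fst c" by (rule chart_exists)
  define p where "p = snd c y"
  have "p \<in> snd c ` (fst c \<inter> U)" using c U by (simp add: p_def)
  then obtain \<rho> where \<rho>: "0 < \<rho>" "cball p \<rho> \<subseteq> snd c ` (fst c \<inter> U)"
    using open_chart_image[OF c(1) U(1)] open_contains_cball by blast
  have sub: "cball p \<rho> \<subseteq> snd c ` fst c" using \<rho>(2) by blast
  have comp: "compact (cball p \<rho>)" by (rule closed_bounded_compact) auto
  obtain \<kappa> \<Lambda> where \<kappa>: "0 < \<kappa>" "0 \<le> \<Lambda>"
    "\<And>x v. x \<in> fst c \<Longrightarrow> snd c x \<in> cball p \<rho> \<Longrightarrow> v \<in> tangent_space A x \<Longrightarrow>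
       \<kappa> * (norm (v c))\<^sup>2 \<le> g x v v \<and> g x v v \<le> \<Lambda> * (norm (v c))\<^sup>2"
    by (rule metric_chart_bounds[OF g c(1) comp sub]) blast
  let ?W = "chart_inv c ` ball p \<rho>" and ?K = "chart_inv c ` cball p \<rho>"
  have bsub: "ball p \<rho> \<subseteq> snd c ` fst c" using sub by (meson ball_subset_cball order_trans)
  have W: "open ?W" by (rule open_chart_inv_image[OF c(1) open_ball bsub])
  have K: "closed ?K"
    by (intro compact_imp_closed compact_continuous_image comp continuous_on_subset[OF chart_facts(4)[OF c(1)] sub])
  have KU: "?K \<subseteq> U"
  proof clarify
    fix q assume "q \<in> cball p \<rho>"
    then obtain x where "x \<in> fst c" "x \<in> U" "q = snd c x" using \<rho>(2) by blast
    then show "chart_inv c q \<in> U" using chart_facts(5)[OF c(1)] by simp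
  qed
  have Kc: "x \<in> fst c \<and> snd c x \<in> cball p \<rho>" if x: "x \<in> ?K" for x
  proof -
    obtain q where q: "x = chart_inv c q" "q \<in> cball p \<rho>" using x by blast
    then have "q \<in> snd c ` fst c" using sub by blast
    then show ?thesis using chart_facts(6,7)[OF c(1)] q by simp
  qed
  show thesis
  proof (rule that)
    show "0 < \<kappa> * \<rho>\<^sup>2" using \<kappa> \<rho> by simp
    fix z assume lt: "min_energy g y z < ennreal (\<kappa> * \<rho>\<^sup>2)"
    show "z \<in> U"
    proof (rule ccontr)
      assume "z \<notin> U"
      then have zW: "z \<notin> ?W" using KU by (meson ball_subset_cball image_mono subsetD)
      obtain \<gamma> where ac: "ac_curve 0 1 \<gamma>" and \<gamma>: "\<gamma> 0 = y" "\<gamma> 1 = z" "energy g 0 1 \<gamma> < ennreal (\<kappa> * \<rho>\<^sup>2)"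
        using lt by (rule min_energy_less)
      have cont: "continuous_on {0..1} \<gamma>" using ac by (simp add: ac_curve_def)
      define S where "S = {0..1} \<inter> \<gamma> -` (- ?W)"
      have clS: "closed S"
        unfolding S_def by (rule continuous_closed_preimage[OF cont]) (use W in \<open>auto simp: closed_def\<close>)
      have "1 \<in> S" using \<gamma> zW by (simp add: S_def)
      then have neS: "S \<noteq> {}" by blast
      have bdS: "bdd_below S" by (rule bdd_belowI[of _ 0]) (auto simp: S_def)
      define t where "t = Inf S"
      have tS: "t \<in> S" unfolding t_def by (rule closed_contains_Inf[OF neS bdS clS])
      have yW: "y \<in> ?W" using chart_facts(5)[OF c] \<rho> by (intro image_eqI[of _ _ p]) (auto simp: p_def)
      have t: "0 < t" "t \<le> 1"
      proof -
        have "t \<noteq> 0" using tS \<gamma>(1) yW by (auto simp: S_def)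
        then show "0 < t" "t \<le> 1" using tS by (auto simp: S_def)
      qed
      have before: "\<gamma> s \<in> ?W" if "0 \<le> s" "s < t" for s
      proof (rule ccontr)
        assume "\<gamma> s \<notin> ?W"
        then have "s \<in> S" using that t by (auto simp: S_def)
        then have "t \<le> s" unfolding t_def by (rule cInf_lower[OF _ bdS])
        then show False using that by simp
      qed
      have inK: "\<gamma> s \<in> ?K" if "s \<in> {0..t}" for s
      proof -
        have "closed ({0..1} \<inter> \<gamma> -` ?K)" by (rule continuous_closed_preimage[OF cont closed_atLeastAtMost K])
        moreover have "{0..<t} \<subseteq> {0..1} \<inter> \<gamma> -` ?K"
        proof
          fix r assume "r \<in> {0..<t}"
          then have "\<gamma> r \<in> ?W" "r \<in> {0..1}" using before[of r] t by auto
          then show "r \<in> {0..1} \<inter> \<gamma> -` ?K" using image_mono[OF ball_subset_cball[of p \<rho>], of "chart_inv c"] by blast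
        qed
        ultimately have "closure {0..<t} \<subseteq> {0..1} \<inter> \<gamma> -` ?K" by (rule closure_minimal[rotated])
        then show ?thesis using that t by auto
      qed
      have ac': "ac_curve 0 t \<gamma>" by (rule ac_curve_subinterval[OF ac]) (use t in auto)
      then have acc: "abs_continuous_on 0 t (snd c \<circ> \<gamma>)"
        using ac_curve_iff[of t \<gamma>] c(1) t inK Kc unfolding abs_continuous_curve_def
        by (auto simp: image_subset_iff)
      have aee: "AE s in lebesgue. s \<in> {0<..<t} \<longrightarrow> (snd c \<circ> \<gamma>) differentiable (at s) \<and>
         ennreal ((norm (vector_derivative (snd c \<circ> \<gamma>) (at s)))\<^sup>2) \<le> ennreal (1 / \<kappa>) * speed2 g \<gamma> s"
        using AE_regular[OF ac']
      proof eventually_elim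
        case (elim s)
        show ?case
        proof
          assume "s \<in> {0<..<t}"
          then have s: "s \<in> {0..t}" and r: "regular_at \<gamma> s" using elim by auto
          have x: "\<gamma> s \<in> fst c" "snd c (\<gamma> s) \<in> cball p \<rho>" using Kc[OF inK[OF s]] by auto
          obtain c0 v0 where c0: "c0 \<in> A" "\<gamma> s \<in> fst c0" "(snd c0 \<circ> \<gamma> has_vector_derivative v0) (at s)"
            by (rule regular_atE[OF r])
          have isc: "isCont \<gamma> s" using r by (simp add: regular_at_def)
          have "(snd c \<circ> (id \<circ> \<gamma>) has_vector_derivative jac id c0 c (\<gamma> s) v0) (at s)"
            by (rule chart_velocity_image[OF isc c0 smooth_map_id c(1)]) (simp add: x)
          then obtain v where der: "(snd c \<circ> \<gamma> has_vector_derivative v) (at s)" by auto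
          have vel: "velocity A \<gamma> s = tvec_of A c (\<gamma> s) v" by (rule velocity_eq[OF isc c(1) x(1) der])
          have "\<kappa> * (norm v)\<^sup>2 \<le> g (\<gamma> s) (velocity A \<gamma> s) (velocity A \<gamma> s)"
            using \<kappa>(3)[OF x velocity_tangent[OF r]] by (simp add: vel tvec_of_self[OF c(1) x(1)])
          then have "(norm v)\<^sup>2 \<le> 1 / \<kappa> * g (\<gamma> s) (velocity A \<gamma> s) (velocity A \<gamma> s)"
            using \<kappa>(1) by (simp add: field_simps)
          then have "ennreal ((norm v)\<^sup>2) \<le> ennreal (1 / \<kappa>) * speed2 g \<gamma> s"
            using \<kappa>(1) by (simp add: speed2_def ennreal_mult'[symmetric] ennreal_leI)
          then show "(snd c \<circ> \<gamma>) differentiable (at s) \<and>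
             ennreal ((norm (vector_derivative (snd c \<circ> \<gamma>) (at s)))\<^sup>2) \<le> ennreal (1 / \<kappa>) * speed2 g \<gamma> s"
            using der by (simp add: vector_derivative_at differentiableI_vector)
        qed
      qed
      have "ennreal ((norm ((snd c \<circ> \<gamma>) t - (snd c \<circ> \<gamma>) 0))\<^sup>2) \<le>
          ennreal (t - 0) * (\<integral>\<^sup>+s\<in>{0..t}. ennreal (1 / \<kappa>) * speed2 g \<gamma> s \<partial>lebesgue)"
        by (rule abs_continuous_increment_le[OF acc _ aee]) (use t in simp)
      also have "\<dots> \<le> 1 * (ennreal (1 / \<kappa>) * energy g 0 t \<gamma>)"
      proof (rule mult_mono)
        show "(\<integral>\<^sup>+s\<in>{0..t}. ennreal (1 / \<kappa>) * speed2 g \<gamma> s \<partial>lebesgue) \<le> ennreal (1 / \<kappa>) * energy g 0 t \<gamma>"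
          unfolding energy_def
          by (subst nn_integral_cmult[OF speed2_measurable[OF g ac'], symmetric]) (simp add: mult.assoc)
      qed (use t in auto)
      also have "energy g 0 t \<gamma> \<le> energy g 0 1 \<gamma>"
        unfolding energy_def by (rule nn_integral_mono) (use t in \<open>auto simp: indicator_def\<close>)
      finally have "ennreal ((norm ((snd c \<circ> \<gamma>) t - (snd c \<circ> \<gamma>) 0))\<^sup>2) \<le> ennreal (1 / \<kappa>) * energy g 0 1 \<gamma>"
        by (simp add: mult_left_mono)
      also have "\<dots> < ennreal (1 / \<kappa>) * ennreal (\<kappa> * \<rho>\<^sup>2)"
        using \<gamma>(3) \<kappa>(1) by (intro ennreal_mult_strict_left_mono) auto
      also have "\<dots> = ennreal (\<rho>\<^sup>2)" using \<kappa>(1) by (simp add: ennreal_mult'[symmetric])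
      finally have "(norm (snd c (\<gamma> t) - p))\<^sup>2 < \<rho>\<^sup>2"
        using \<gamma>(1) by (simp add: p_def ennreal_less_iff)
      then have "snd c (\<gamma> t) \<in> ball p \<rho>"
        using \<rho> by (simp add: dist_norm norm_minus_commute power_less_imp_less_base)
      moreover have "\<gamma> t \<in> fst c" using Kc[OF inK[of t]] t by auto
      ultimately have "\<gamma> t \<in> ?W" using chart_facts(5)[OF c(1)] by (metis imageI)
      then show False using tS by (auto simp: S_def)
    qed
  qed
qed

end

lemma (in smooth_manifold) min_energy_refl:
  assumes "riemannian_metric A g"
  shows "min_energy g x x = 0"
proof -
  have "min_energy g x x \<le> 0 + ennreal e" if "0 < e" for e
  proof -
    obtain U where "open U" "x \<in> U" "\<And>z. z \<in> U \<Longrightarrow> min_energy g x z < ennreal e"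
      by (rule min_energy_small_near[OF assms \<open>0 < e\<close>]) blast
    then show ?thesis by (simp add: less_imp_le)
  qed
  then have "min_energy g x x \<le> 0" by (rule ennreal_le_epsilon)
  then show ?thesis by simp
qed

locale connected_manifold = smooth_manifold A
  for A :: "('m::{t2_space,second_countable_topology}, 'e::real_inner) chart set" +
  assumes conn: "connected (UNIV :: 'm set)"
begin

text \<open>The points that can be reached with finite energy form an open set, and so do the others, because
  nearby points can be reached from each other.\<close>

lemma min_energy_finite:
  assumes g: "riemannian_metric A g"
  shows "min_energy g x y < \<top>"
proof -
  have tri: "min_energy g x z < \<top>" if "min_energy g x y < \<top>" "min_energy g y z < \<top>" for y z
  proof -
    have "min_energy g x z \<le> ennreal (1 / (1/2)) * min_energy g x y + ennreal (1 / (1 - 1/2)) * min_energy g y z"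
      by (rule min_energy_concat[OF g]) auto
    also have "\<dots> < \<top>" using that by (auto simp: ennreal_mult_less_top)
    finally show ?thesis .
  qed
  have near: "\<exists>U. open U \<and> y \<in> U \<and> (\<forall>z\<in>U. min_energy g y z < \<top>)" for y
  proof -
    obtain U where U: "open U" "y \<in> U" "\<And>z. z \<in> U \<Longrightarrow> min_energy g y z < ennreal 1"
      by (rule min_energy_small_near[OF g zero_less_one]) blast
    have "min_energy g y z < \<top>" if "z \<in> U" for z
      using less_trans[OF U(3)[OF that] ennreal_less_top] .
    then show ?thesis using U by blast
  qed
  let ?S = "{y. min_energy g x y < \<top>}"
  have 1: "open ?S"
    unfolding open_subopen[of ?S] using near tri by (metis (mono_tags, lifting) mem_Collect_eq subsetI)
  have 2: "open (- ?S)"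
    unfolding open_subopen[of "- ?S"]
  proof
    fix y assume y: "y \<in> - ?S"
    obtain U where U: "open U" "y \<in> U" "\<forall>z\<in>U. min_energy g y z < \<top>" using near by blast
    have "z \<in> - ?S" if "z \<in> U" for z
    proof
      assume "z \<in> ?S"
      moreover have "min_energy g z y < \<top>" using U(3) that min_energy_sym[OF g, of z y] by auto
      ultimately show False using tri[of z y] y by simp
    qed
    then show "\<exists>T. open T \<and> y \<in> T \<and> T \<subseteq> - ?S" using U by blast
  qed
  have "x \<in> ?S" by (simp add: min_energy_refl[OF g])
  then have "- ?S \<inter> UNIV = {}" using connectedD[OF conn 1 2] by auto
  then show ?thesis by blast
qed

definition energy_dist :: "('m, 'e) metric \<Rightarrow> 'm \<Rightarrow> 'm \<Rightarrow> real" where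
  "energy_dist g x y = sqrt (enn2real (min_energy g x y))"

lemma energy_dist_nonneg: "0 \<le> energy_dist g x y"
  by (simp add: energy_dist_def)

lemma min_energy_edist: "riemannian_metric A g \<Longrightarrow> min_energy g x y = ennreal ((energy_dist g x y)\<^sup>2)"
  by (simp add: energy_dist_def min_energy_finite)

lemma energy_dist_less_iff:
  assumes "riemannian_metric A g" "0 < a"
  shows "energy_dist g x y < a \<longleftrightarrow> min_energy g x y < ennreal (a\<^sup>2)"
proof -
  have "energy_dist g x y < a \<longleftrightarrow> (energy_dist g x y)\<^sup>2 < a\<^sup>2"
    using energy_dist_nonneg assms(2) by (auto intro: power_strict_mono power_less_imp_less_base)
  then show ?thesis using assms by (simp add: min_energy_edist ennreal_less_iff)
qed

lemma energy_dist_refl: "riemannian_metric A g \<Longrightarrow> energy_dist g x x = 0"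
  by (simp add: energy_dist_def min_energy_refl)

lemma energy_dist_sym: "riemannian_metric A g \<Longrightarrow> energy_dist g y x = energy_dist g x y"
  by (simp add: energy_dist_def min_energy_sym[of g y x])

text \<open>Running along the two curves with times proportional to their lengths turns the bound for
  energies of concatenations into the triangle inequality.\<close>

lemma energy_dist_triangle:
  assumes g: "riemannian_metric A g"
  shows "energy_dist g x z \<le> energy_dist g x y + energy_dist g y z"
proof (rule field_le_epsilon)
  fix e :: real assume e: "0 < e"
  define a b where "a = energy_dist g x y + e / 2" and "b = energy_dist g y z + e / 2"
  have ab: "0 < a" "0 < b" using energy_dist_nonneg e by (auto simp: a_def b_def add_nonneg_pos)
  let ?l = "a / (a + b)"
  have l: "0 < ?l" "?l < 1" using ab by auto
  have l1: "1 - ?l = b / (a + b)" using ab by (simp add: field_simps)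
  have "min_energy g x z \<le> ennreal (1 / ?l) * min_energy g x y + ennreal (1 / (1 - ?l)) * min_energy g y z"
    by (rule min_energy_concat[OF g l])
  also have "\<dots> \<le> ennreal (1 / ?l) * ennreal (a\<^sup>2) + ennreal (1 / (1 - ?l)) * ennreal (b\<^sup>2)"
    unfolding min_energy_edist[OF g]
    using e energy_dist_nonneg by (intro add_mono mult_left_mono ennreal_leI power_mono) (auto simp: a_def b_def)
  also have "\<dots> = ennreal ((1 / ?l) * a\<^sup>2 + (1 / (1 - ?l)) * b\<^sup>2)"
  proof -
    have p: "0 \<le> 1 / ?l" "0 \<le> 1 / (1 - ?l)" using l by (auto simp only: zero_le_divide_1_iff diff_ge_0_iff_ge)
    show ?thesis
      by (simp only: ennreal_mult[OF p(1) zero_le_power2] ennreal_mult[OF p(2) zero_le_power2]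
          ennreal_plus[OF mult_nonneg_nonneg[OF p(1) zero_le_power2] mult_nonneg_nonneg[OF p(2) zero_le_power2]])
  qed
  also have "(1 / ?l) * a\<^sup>2 + (1 / (1 - ?l)) * b\<^sup>2 = (a + b) * a + (a + b) * b"
  proof -
    have cancel: "1 / (u / w) * u\<^sup>2 = w * u" if "u \<noteq> 0" for u w :: real
      using that by (simp add: power2_eq_square)
    show ?thesis unfolding l1 cancel[OF less_imp_neq[OF ab(1), symmetric]] cancel[OF less_imp_neq[OF ab(2), symmetric]] ..
  qed
  also have "\<dots> = (a + b)\<^sup>2" by (simp add: power2_eq_square algebra_simps)
  finally have "(energy_dist g x z)\<^sup>2 \<le> (a + b)\<^sup>2"
    by (simp add: min_energy_edist[OF g])
  then have "energy_dist g x z \<le> a + b" by (rule power2_le_imp_le) (use ab in simp)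
  then show "energy_dist g x z \<le> energy_dist g x y + energy_dist g y z + e" by (simp add: a_def b_def)
qed

lemma energy_dist_mono:
  assumes g: "riemannian_metric A g1" "riemannian_metric A g2" and C: "0 < C"
    and le: "\<And>x v. v \<in> tangent_space A x \<Longrightarrow> g1 x v v \<le> C\<^sup>2 * g2 x v v"
  shows "energy_dist g1 x y \<le> C * energy_dist g2 x y"
proof -
  have "min_energy g1 x y \<le> ennreal (C\<^sup>2) * min_energy g2 x y"
  proof (rule min_energy_mono[OF g(2)])
    show "0 < C\<^sup>2" using C by simp
  qed (rule le)
  then have "(energy_dist g1 x y)\<^sup>2 \<le> (C * energy_dist g2 x y)\<^sup>2"
    unfolding min_energy_edist[OF g(1)] min_energy_edist[OF g(2)]
      ennreal_mult[OF zero_le_power2 zero_le_power2, symmetric] power_mult_distrib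
    by (subst (asm) ennreal_le_iff) simp_all
  then show ?thesis by (rule power2_le_imp_le) (simp add: C less_imp_le energy_dist_nonneg)
qed

lemma energy_dist_image:
  assumes "smooth_map A f" "smooth_map A f'" "\<And>x. f (f' x) = x" "\<And>x. f' (f x) = x"
    and "is_pullback g1 f g2"
  shows "energy_dist g1 x y = energy_dist g2 (f x) (f y)"
  using min_energy_image[OF assms] by (simp add: energy_dist_def)

lemma energy_dist_near:
  assumes g: "riemannian_metric A g" and e: "0 < e"
  obtains U where "open U" "y \<in> U" "\<And>z. z \<in> U \<Longrightarrow> energy_dist g y z < e"
proof -
  have "0 < e\<^sup>2" using e by simp
  then obtain U where "open U" "y \<in> U" "\<And>z. z \<in> U \<Longrightarrow> min_energy g y z < ennreal (e\<^sup>2)"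
    by (rule min_energy_small_near[OF g]) blast
  then show thesis using that energy_dist_less_iff[OF g e] by blast
qed

lemma energy_dist_in_open:
  assumes g: "riemannian_metric A g" and U: "open U" "y \<in> U"
  obtains r where "0 < r" "\<And>z. energy_dist g y z < r \<Longrightarrow> z \<in> U"
proof -
  obtain r where r: "0 < r" "\<And>z. min_energy g y z < ennreal r \<Longrightarrow> z \<in> U"
    by (rule min_energy_ball_in_open[OF g U]) blast
  show thesis
  proof (rule that[of "sqrt r"])
    show "0 < sqrt r" using r by simp
    fix z assume "energy_dist g y z < sqrt r"
    then have "min_energy g y z < ennreal ((sqrt r)\<^sup>2)" using energy_dist_less_iff[OF g] r(1) by simp
    then show "z \<in> U" using r by simp
  qed
qed

lemma energy_dist_continuous:
  assumes g: "riemannian_metric A g"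
  shows "continuous_on S (energy_dist g p)"
proof -
  have "isCont (energy_dist g p) y" for y
    unfolding continuous_at_open
  proof (intro allI impI)
    fix V assume V: "open V \<and> energy_dist g p y \<in> V"
    then obtain e where e: "0 < e" "ball (energy_dist g p y) e \<subseteq> V" using open_contains_ball by blast
    obtain U where U: "open U" "y \<in> U" "\<And>z. z \<in> U \<Longrightarrow> energy_dist g y z < e"
      by (rule energy_dist_near[OF g e(1)]) blast
    have "energy_dist g p z \<in> V" if "z \<in> U" for z
    proof -
      have "\<bar>energy_dist g p y - energy_dist g p z\<bar> < e"
        using energy_dist_triangle[OF g, of p z y] energy_dist_triangle[OF g, of p y z] energy_dist_sym[OF g, of y z] U(3)[OF that]
        by linarith
      then show ?thesis using e(2) by (auto simp: dist_real_def)
    qed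
    then show "\<exists>S. open S \<and> y \<in> S \<and> (\<forall>x'\<in>S. energy_dist g p x' \<in> V)" using U by blast
  qed
  then show ?thesis by (simp add: continuous_at_imp_continuous_on)
qed

text \<open>The energy distance is a length distance: on a nearly minimal curve the intermediate value
  theorem finds a point at prescribed distance from \<open>p\<close>.\<close>

lemma energy_dist_split:
  assumes g: "riemannian_metric A g" and ab: "0 < a" "0 < b" and lt: "energy_dist g p q < a + b"
  obtains m where "energy_dist g p m < a" "energy_dist g m q < b"
proof (cases "energy_dist g p q < a")
  case True
  then show thesis using that[of q] ab energy_dist_refl[OF g] by simp
next
  case False
  have "min_energy g p q < ennreal ((a + b)\<^sup>2)" using energy_dist_less_iff[OF g] lt ab by simp
  then obtain \<gamma> where ac: "ac_curve 0 1 \<gamma>" and \<gamma>: "\<gamma> 0 = p" "\<gamma> 1 = q" "energy g 0 1 \<gamma> < ennreal ((a + b)\<^sup>2)"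
    by (rule min_energy_less)
  define R where "R = sqrt (enn2real (energy g 0 1 \<gamma>))"
  have fin: "energy g 0 1 \<gamma> < \<top>" using \<gamma>(3) ennreal_less_top less_trans by blast
  have R0: "0 \<le> R" by (simp add: R_def)
  have R: "energy g 0 1 \<gamma> = ennreal (R\<^sup>2)" using fin by (simp add: R_def)
  have "R\<^sup>2 < (a + b)\<^sup>2" using \<gamma>(3) by (simp add: R ennreal_less_iff)
  then have Rab: "R < a + b" using ab by (simp add: power_less_imp_less_base)
  \<comment> \<open>Any value strictly between \<open>max 0 (R - b)\<close> and \<open>a\<close> will do.\<close>
  define a' where "a' = max (a / 2) ((a + R - b) / 2)"
  have a': "0 < a'" "a' < a" "R - b < a'"
  proof -
    have 1: "R - b < (a + R - b) / 2" "(a + R - b) / 2 < a" using Rab by (simp_all add: field_simps)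
    have 2: "0 < a / 2" "a / 2 < a" using ab by simp_all
    show "0 < a'" unfolding a'_def by (rule less_le_trans[OF 2(1) max.cobounded1])
    show "a' < a" unfolding a'_def by (rule max_less_iff_conj[THEN iffD2, OF conjI[OF 2(2) 1(2)]])
    show "R - b < a'" unfolding a'_def by (rule less_le_trans[OF 1(1) max.cobounded2])
  qed
  have "continuous_on {0..1} \<gamma>" using ac by (simp add: ac_curve_def)
  then have "continuous_on {0..1} (\<lambda>s. energy_dist g p (\<gamma> s))"
    by (rule continuous_on_compose2[OF energy_dist_continuous[OF g, of UNIV]]) auto
  then obtain s where s: "0 \<le> s" "s \<le> 1" "energy_dist g p (\<gamma> s) = a'"
    using IVT'[of "\<lambda>s. energy_dist g p (\<gamma> s)" 0 a' 1] \<gamma> a' False energy_dist_refl[OF g] by auto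
  have "s \<noteq> 0" "s \<noteq> 1" using s(3) \<gamma> a' False energy_dist_refl[OF g] by auto
  then have s01: "0 < s" "s < 1" using s by auto
  have ac1: "ac_curve 0 s \<gamma>" and ac2: "ac_curve s 1 \<gamma>"
    using s01 by (auto intro: ac_curve_subinterval[OF ac])
  have sum: "energy g 0 1 \<gamma> = energy g 0 s \<gamma> + energy g s 1 \<gamma>"
    by (rule energy_combine[OF g ac1 ac2]) (use s01 in auto)
  then have "energy g 0 s \<gamma> < \<top>" "energy g s 1 \<gamma> < \<top>" using fin by (auto simp: ennreal_add_less_top)
  then obtain e1 e2 where e: "energy g 0 s \<gamma> = ennreal e1" "0 \<le> e1" "energy g s 1 \<gamma> = ennreal e2" "0 \<le> e2"
    by (metis ennreal_cases less_irrefl)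
  have eR: "e1 + e2 = R\<^sup>2" using sum e by (simp add: R ennreal_plus[symmetric] del: ennreal_plus)
  let ?d = "energy_dist g (\<gamma> s) q"
  have "ennreal (a'\<^sup>2) \<le> ennreal (s - 0) * energy g 0 s \<gamma>"
    using min_energy_subcurve[OF g ac1 s01(1)] min_energy_edist[OF g] s(3) \<gamma> by metis
  then have 1: "a'\<^sup>2 \<le> s * e1" using e s01 by (simp add: ennreal_mult[symmetric])
  have "ennreal (?d\<^sup>2) \<le> ennreal (1 - s) * energy g s 1 \<gamma>"
    using min_energy_subcurve[OF g ac2 s01(2)] min_energy_edist[OF g] \<gamma> by metis
  then have 2: "?d\<^sup>2 \<le> (1 - s) * e2" using e s01 by (simp add: ennreal_mult[symmetric])
  have "s * (1 - s) * (a' + ?d)\<^sup>2 \<le> (1 - s) * a'\<^sup>2 + s * ?d\<^sup>2"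
  proof -
    have "(1 - s) * a'\<^sup>2 + s * ?d\<^sup>2 - s * (1 - s) * (a' + ?d)\<^sup>2 = ((1 - s) * a' - s * ?d)\<^sup>2"
      by (simp add: power2_eq_square algebra_simps)
    then show ?thesis by (metis diff_ge_0_iff_ge zero_le_power2)
  qed
  also have "\<dots> \<le> (1 - s) * (s * e1) + s * ((1 - s) * e2)"
    using 1 2 s01 by (intro add_mono mult_left_mono) auto
  also have "\<dots> = s * (1 - s) * R\<^sup>2" by (simp add: eR[symmetric] algebra_simps)
  finally have "(a' + ?d)\<^sup>2 \<le> R\<^sup>2" using s01 by (simp add: mult_le_cancel_left_pos)
  then have "a' + ?d \<le> R" using R0 by (rule power2_le_imp_le)
  then have "?d < b" using a' by simp
  then show thesis using that[of "\<gamma> s"] s(3) a' by simp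
qed

end

section \<open>Cocompact isometric actions\<close>

locale cocompact_isometric_action = connected_manifold A
  for A :: "('m::{t2_space,second_countable_topology}, 'e::real_inner) chart set" +
  fixes g0 :: "('m, 'e) metric" and G :: "('g, 'z) monoid_scheme" and act :: "'g \<Rightarrow> 'm \<Rightarrow> 'm"
  assumes g0: "riemannian_metric A g0" and grp: "group G" and action: "group_action G UNIV act"
    and isom: "\<forall>a\<in>carrier G. riemannian_isometry A g0 (act a)"
    and free: "free_action G act" and td: "totally_discontinuous G act" and cc: "cocompact_action G act"
begin

lemma act_mult: "a \<in> carrier G \<Longrightarrow> b \<in> carrier G \<Longrightarrow> act (a \<otimes>\<^bsub>G\<^esub> b) x = act a (act b x)"
  by (rule group_action.composition_rule[OF action]) auto

lemma act_one: "act \<one>\<^bsub>G\<^esub> x = x"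
  using group_action.id_eq_one[OF action] by (metis UNIV_I restrict_apply)

lemma act_inv: "a \<in> carrier G \<Longrightarrow> act (inv\<^bsub>G\<^esub> a) (act a x) = x" "a \<in> carrier G \<Longrightarrow> act a (act (inv\<^bsub>G\<^esub> a) x) = x"
  using act_mult[of "inv\<^bsub>G\<^esub> a" a x] act_mult[of a "inv\<^bsub>G\<^esub> a" x] grp act_one
  by (simp_all add: group.l_inv group.r_inv group.inv_closed)

lemma act_smooth: "a \<in> carrier G \<Longrightarrow> smooth_map A (act a)"
  using isom by (auto simp: riemannian_isometry_def)

lemma act_pullback: "a \<in> carrier G \<Longrightarrow> is_pullback g0 (act a) g0"
  using isom by (auto simp: riemannian_isometry_def is_pullback_def)

lemma energy_dist_act_pullback:
  "a \<in> carrier G \<Longrightarrow> is_pullback g1 (act a) g2 \<Longrightarrow> energy_dist g1 x y = energy_dist g2 (act a x) (act a y)"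
  by (rule energy_dist_image[of "act a" "act (inv\<^bsub>G\<^esub> a)"])
     (simp_all add: act_smooth act_inv group.inv_closed[OF grp])

lemma energy_dist_act: "a \<in> carrier G \<Longrightarrow> energy_dist g0 (act a x) (act a y) = energy_dist g0 x y"
  using energy_dist_act_pullback[OF _ act_pullback] by metis

text \<open>The orbits that meet \<open>U y\<close> form an open set in the compact orbit space.\<close>

lemma finite_orbit_cover:
  assumes U: "\<And>y. open (U y)" "\<And>y. y \<in> U y"
  obtains F where "finite F" "\<And>x. \<exists>a\<in>carrier G. \<exists>y\<in>F. act a x \<in> U y"
proof -
  let ?X = "orbit_space_topology G act"
  define W where "W y = {o' \<in> orbits G UNIV act. o' \<inter> U y \<noteq> {}}" for y
  have pre: "{x. orbit G act x \<in> W y} = (\<Union>a\<in>carrier G. act a -` U y)" for y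
    by (auto simp: W_def orbits_def orbit_def)
  have "open (\<Union>a\<in>carrier G. act a -` U y)" for y
    using act_smooth U(1) by (auto intro!: open_UN open_vimage simp: smooth_map_def)
  then have oW: "openin ?X (W y)" for y
    unfolding openin_orbit_space_topology pre by (auto simp: W_def)
  have "topspace ?X \<subseteq> orbits G UNIV act"
    using openin_topspace[of ?X] unfolding openin_orbit_space_topology by blast
  also have "\<dots> \<subseteq> \<Union> (range W)"
  proof
    fix o' assume o: "o' \<in> orbits G UNIV act"
    then obtain x where "o' = orbit G act x" by (auto simp: orbits_def)
    then have "x \<in> o'" using act_one[of x] group.is_monoid[OF grp]
      by (auto simp: orbit_def intro!: exI[of _ "\<one>\<^bsub>G\<^esub>"])
    then have "o' \<in> W x" using o U(2)[of x] by (auto simp: W_def)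
    then show "o' \<in> \<Union> (range W)" by blast
  qed
  finally have cover: "topspace ?X \<subseteq> \<Union> (range W)" .
  have comp: "compactin ?X (topspace ?X)" using cc by (simp add: cocompact_action_def compact_space_def)
  have "\<exists>\<F>. finite \<F> \<and> \<F> \<subseteq> range W \<and> topspace ?X \<subseteq> \<Union>\<F>"
    by (rule compactinD[OF comp _ cover]) (use oW in auto)
  then obtain \<F> where \<F>: "finite \<F>" "\<F> \<subseteq> range W" "topspace ?X \<subseteq> \<Union>\<F>" by blast
  obtain F where F: "finite F" "topspace ?X \<subseteq> \<Union> (W ` F)"
    using finite_subset_image[OF \<F>(1,2)] \<F>(3) by blast
  have "{x. orbit G act x \<in> orbits G UNIV act} = UNIV" by (auto simp: orbits_def)
  then have "openin ?X (orbits G UNIV act)"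
    unfolding openin_orbit_space_topology by simp
  then have top: "orbits G UNIV act \<subseteq> topspace ?X" by (rule openin_subset)
  show thesis
  proof (rule that[OF F(1)])
    fix x
    have "orbit G act x \<in> orbits G UNIV act" by (auto simp: orbits_def)
    then obtain y where "y \<in> F" "orbit G act x \<in> W y" using top F(2) by blast
    then show "\<exists>a\<in>carrier G. \<exists>y\<in>F. act a x \<in> U y" by (auto simp: W_def orbit_def)
  qed
qed

text \<open>Near each point, total discontinuity bounds the displacements from below, because energy balls lie
  inside the neighborhoods that are moved off themselves. The displacement of \<open>x\<close> by \<open>a\<close> is that
  of \<open>c x\<close> by a conjugate of \<open>a\<close>, so that finitely many orbits of neighborhoods suffice.\<close>

lemma minimal_displacement:
  obtains r where "0 < r" "\<And>x a. a \<in> carrier G \<Longrightarrow> a \<noteq> \<one>\<^bsub>G\<^esub> \<Longrightarrow> r \<le> energy_dist g0 x (act a x)"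
proof -
  have "\<exists>V r. open V \<and> y \<in> V \<and> 0 < r \<and>
      (\<forall>z\<in>V. \<forall>a\<in>carrier G. a \<noteq> \<one>\<^bsub>G\<^esub> \<longrightarrow> r \<le> energy_dist g0 z (act a z))" for y
  proof -
    obtain U where U: "open U" "y \<in> U" "\<And>a. a \<in> carrier G \<Longrightarrow> act a y \<noteq> y \<Longrightarrow> act a ` U \<inter> U = {}"
      using td unfolding totally_discontinuous_def by meson
    obtain r where r: "0 < r" "\<And>z. energy_dist g0 y z < r \<Longrightarrow> z \<in> U"
      by (rule energy_dist_in_open[OF g0 U(1,2)]) blast
    obtain V where V: "open V" "y \<in> V" "\<And>z. z \<in> V \<Longrightarrow> energy_dist g0 y z < r / 2"
      by (rule energy_dist_near[OF g0 half_gt_zero[OF r(1)]]) blast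
    have "r / 2 \<le> energy_dist g0 z (act a z)" if z: "z \<in> V" "a \<in> carrier G" "a \<noteq> \<one>\<^bsub>G\<^esub>" for z a
    proof (rule ccontr)
      assume "\<not> ?thesis"
      then have "energy_dist g0 y (act a z) < r"
        using energy_dist_triangle[OF g0, of y "act a z" z] V(3)[OF z(1)] by linarith
      then have "act a z \<in> U" by (rule r(2))
      moreover have "z \<in> U" using V(3)[OF z(1)] r by auto
      moreover have "act a y \<noteq> y" using free z unfolding free_action_def by blast
      ultimately show False using U(3)[OF z(2)] by blast
    qed
    then show ?thesis using V r(1) by (intro exI[of _ V] exI[of _ "r / 2"]) auto
  qed
  then obtain V r where Vr: "\<And>y. open (V y)" "\<And>y. y \<in> V y" "\<And>y. 0 < r y"
      "\<And>y z a. z \<in> V y \<Longrightarrow> a \<in> carrier G \<Longrightarrow> a \<noteq> \<one>\<^bsub>G\<^esub> \<Longrightarrow> r y \<le> energy_dist g0 z (act a z)"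
    by metis
  obtain F where F: "finite F" "\<And>x. \<exists>a\<in>carrier G. \<exists>y\<in>F. act a x \<in> V y"
    by (rule finite_orbit_cover[of V, OF Vr(1,2)]) blast
  define R where "R = Min (insert 1 (r ` F))"
  show thesis
  proof (rule that[of R])
    show "0 < R" using F(1) Vr(3) by (auto simp: R_def)
    fix x a assume a: "a \<in> carrier G" "a \<noteq> \<one>\<^bsub>G\<^esub>"
    obtain c y where c: "c \<in> carrier G" "y \<in> F" "act c x \<in> V y" using F(2) by blast
    let ?a' = "c \<otimes>\<^bsub>G\<^esub> a \<otimes>\<^bsub>G\<^esub> inv\<^bsub>G\<^esub> c"
    have cl: "?a' \<in> carrier G" "inv\<^bsub>G\<^esub> c \<in> carrier G" "c \<otimes>\<^bsub>G\<^esub> a \<in> carrier G"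
      using a c grp by (auto intro!: group.inv_closed monoid.m_closed group.is_monoid)
    have "?a' \<noteq> \<one>\<^bsub>G\<^esub>"
    proof
      assume "?a' = \<one>\<^bsub>G\<^esub>"
      then have "act ?a' (act c x) = act c x" using act_one by simp
      then have "act c (act a x) = act c x" using act_mult cl a c act_inv by simp
      then have "act a x = x" using act_inv(1)[OF c(1)] by metis
      then show False using free a unfolding free_action_def by blast
    qed
    then have "r y \<le> energy_dist g0 (act c x) (act ?a' (act c x))" by (intro Vr(4) c cl)
    also have "act ?a' (act c x) = act c (act a x)" using act_mult cl a c act_inv by simp
    also have "energy_dist g0 (act c x) (act c (act a x)) = energy_dist g0 x (act a x)" by (rule energy_dist_act[OF c(1)])
    finally have "r y \<le> energy_dist g0 x (act a x)" .
    moreover have "R \<le> r y" using F(1) c(2) by (auto simp: R_def)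
    ultimately show "R \<le> energy_dist g0 x (act a x)" by simp
  qed
qed

text \<open>A Svarc--Milnor bound: follow a chain of short steps from \<open>x\<close> to \<open>a x\<close>, which exists by
  \<open>energy_dist_split\<close>, and note near which translate of a finite net each point lies. Consecutive
  translates differ by an element of a finite set, so a homomorphism to the integers changes by a
  bounded amount in each step. That set is finite because displacements are bounded from below.\<close>

lemma displacement_bound:
  fixes \<phi> :: "'g \<Rightarrow> int"
  assumes \<phi>: "\<And>a b. a \<in> carrier G \<Longrightarrow> b \<in> carrier G \<Longrightarrow> \<phi> (a \<otimes>\<^bsub>G\<^esub> b) = \<phi> a + \<phi> b"
  obtains B \<delta> where "0 \<le> B" "0 < \<delta>"
    "\<And>x a. a \<in> carrier G \<Longrightarrow> real_of_int \<bar>\<phi> a\<bar> \<le> B * (energy_dist g0 x (act a x) / \<delta> + 1)"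
proof -
  interpret G: group G by (rule grp)
  obtain r where r: "0 < r" "\<And>x a. a \<in> carrier G \<Longrightarrow> a \<noteq> \<one>\<^bsub>G\<^esub> \<Longrightarrow> r \<le> energy_dist g0 x (act a x)"
    by (rule minimal_displacement) blast
  \<comment> \<open>Two translates of one net point within \<open>3 * \<delta>\<close> of another net point have distance less than
    \<open>6 * \<delta> = r\<close> and therefore coincide.\<close>
  define \<delta> where "\<delta> = r / 6"
  have \<delta>: "0 < \<delta>" using r by (simp add: \<delta>_def)
  have "\<exists>U. open U \<and> y \<in> U \<and> (\<forall>z\<in>U. energy_dist g0 y z < \<delta>)" for y
    by (rule energy_dist_near[OF g0 \<delta>, of y]) blast
  then obtain U where U: "\<And>y. open (U y)" "\<And>y. y \<in> U y" "\<And>y z. z \<in> U y \<Longrightarrow> energy_dist g0 y z < \<delta>"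
    by metis
  obtain F where F: "finite F" "\<And>x. \<exists>a\<in>carrier G. \<exists>y\<in>F. act a x \<in> U y"
    by (rule finite_orbit_cover[of U, OF U(1,2)]) blast
  have net: "\<exists>a\<in>carrier G. \<exists>y\<in>F. energy_dist g0 x (act a y) < \<delta>" for x
  proof -
    obtain a y where a: "a \<in> carrier G" "y \<in> F" "act a x \<in> U y" using F(2) by blast
    have "energy_dist g0 (act (inv\<^bsub>G\<^esub> a) y) (act (inv\<^bsub>G\<^esub> a) (act a x)) < \<delta>"
      using U(3)[OF a(3)] energy_dist_act[of "inv\<^bsub>G\<^esub> a"] a(1) by simp
    then have "energy_dist g0 x (act (inv\<^bsub>G\<^esub> a) y) < \<delta>"
      using act_inv(1)[OF a(1)] energy_dist_sym[OF g0] by metis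
    then show ?thesis using a by blast
  qed
  define S where "S y y' = {k\<in>carrier G. energy_dist g0 y (act k y') < 3 * \<delta>}" for y y'
  have "finite (S y y')" for y y'
  proof -
    have same: "k = k'" if k: "k \<in> S y y'" "k' \<in> S y y'" for k k'
    proof (rule ccontr)
      assume ne: "k \<noteq> k'"
      have kc: "k \<in> carrier G" "k' \<in> carrier G" using k by (auto simp: S_def)
      let ?m = "inv\<^bsub>G\<^esub> k \<otimes>\<^bsub>G\<^esub> k'"
      have "k \<otimes>\<^bsub>G\<^esub> ?m = k'" using kc by (simp add: G.m_assoc[symmetric])
      then have "?m \<noteq> \<one>\<^bsub>G\<^esub>" using ne kc by auto
      then have "r \<le> energy_dist g0 y' (act ?m y')" using kc by (intro r(2)) auto
      also have "\<dots> = energy_dist g0 (act k y') (act k' y')"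
        using energy_dist_act[OF kc(1), of y' "act ?m y'"] act_mult[OF kc(1), of ?m y'] kc
        by (simp add: G.m_assoc[symmetric])
      also have "\<dots> < 6 * \<delta>"
        using energy_dist_triangle[OF g0, of "act k y'" "act k' y'" y] k energy_dist_sym[OF g0, of y "act k y'"]
        by (simp add: S_def)
      finally show False by (simp add: \<delta>_def)
    qed
    show ?thesis
    proof (cases "S y y' = {}")
      case False
      then obtain k0 where "k0 \<in> S y y'" by blast
      then have "S y y' \<subseteq> {k0}" using same by blast
      then show ?thesis by (rule finite_subset) simp
    qed simp
  qed
  then have finS: "finite (\<Union>y\<in>F. \<Union>y'\<in>F. S y y')" using F(1) by auto
  define B where "B = Max (insert 0 ((\<lambda>k. real_of_int \<bar>\<phi> k\<bar>) ` (\<Union>y\<in>F. \<Union>y'\<in>F. S y y')))"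
  have B0: "0 \<le> B" unfolding B_def using finS by (intro Max_ge) auto
  have B: "real_of_int \<bar>\<phi> k\<bar> \<le> B" if "y \<in> F" "y' \<in> F" "k \<in> S y y'" for k y y'
    unfolding B_def using finS that by (intro Max_ge) auto
  have base: "real_of_int \<bar>\<phi> h - \<phi> g\<bar> \<le> B"
    if y: "y \<in> F" "y' \<in> F" and gh: "g \<in> carrier G" "h \<in> carrier G"
      and near: "energy_dist g0 p (act g y) < \<delta>" "energy_dist g0 q (act h y') < \<delta>" "energy_dist g0 p q < \<delta>" for g h y y' p q
  proof -
    let ?k = "inv\<^bsub>G\<^esub> g \<otimes>\<^bsub>G\<^esub> h"
    have kc: "?k \<in> carrier G" using gh by auto
    have gk: "g \<otimes>\<^bsub>G\<^esub> ?k = h" using gh by (simp add: G.m_assoc[symmetric])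
    have "energy_dist g0 y (act ?k y') = energy_dist g0 (act g y) (act h y')"
      using energy_dist_act[OF gh(1), of y "act ?k y'"] act_mult[OF gh(1) kc, of y'] gk by simp
    also have "\<dots> < 3 * \<delta>"
      using energy_dist_triangle[OF g0, of "act g y" "act h y'" p] energy_dist_triangle[OF g0, of p "act h y'" q]
        energy_dist_sym[OF g0, of p "act g y"] near by linarith
    finally have "?k \<in> S y y'" using kc by (simp add: S_def)
    then have "real_of_int \<bar>\<phi> ?k\<bar> \<le> B" by (rule B[OF y])
    moreover have "\<phi> h = \<phi> g + \<phi> ?k" using \<phi>[OF gh(1) kc] gk by simp
    ultimately show ?thesis by simp
  qed
  have chain: "real_of_int \<bar>\<phi> h - \<phi> g\<bar> \<le> B * (real N + 1)"
    if y: "y \<in> F" "y' \<in> F" and gh: "g \<in> carrier G" "h \<in> carrier G"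
      and near: "energy_dist g0 p (act g y) < \<delta>" "energy_dist g0 q (act h y') < \<delta>"
      and pq: "energy_dist g0 p q < (real N + 1) * \<delta>" for N g h y y' p q
    using y(2) gh(2) near(2) pq
  proof (induction N arbitrary: q h y')
    case 0
    then show ?case using base[OF y(1) 0(1) gh(1) 0(2) near(1) 0(3)] by simp
  next
    case (Suc N)
    have "energy_dist g0 p q < (real N + 1) * \<delta> + \<delta>" using Suc(5) by (simp add: algebra_simps)
    moreover have "0 < (real N + 1) * \<delta>" using \<delta> by simp
    ultimately obtain m where m: "energy_dist g0 p m < (real N + 1) * \<delta>" "energy_dist g0 m q < \<delta>"
      using energy_dist_split[OF g0 _ \<delta>] by metis
    obtain k z where k: "k \<in> carrier G" "z \<in> F" "energy_dist g0 m (act k z) < \<delta>" using net by blast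
    have "real_of_int \<bar>\<phi> k - \<phi> g\<bar> \<le> B * (real N + 1)" by (rule Suc(1)[OF k(2,1,3) m(1)])
    moreover have "real_of_int \<bar>\<phi> h - \<phi> k\<bar> \<le> B" by (rule base[OF k(2) Suc(2) k(1) Suc(3) k(3) Suc(4) m(2)])
    ultimately show ?case by (simp add: algebra_simps)
  qed
  show thesis
  proof (rule that[OF B0 \<delta>])
    fix x a assume a: "a \<in> carrier G"
    obtain g y where g: "g \<in> carrier G" "y \<in> F" "energy_dist g0 x (act g y) < \<delta>" using net by blast
    have ag: "a \<otimes>\<^bsub>G\<^esub> g \<in> carrier G" using a g by simp
    have near: "energy_dist g0 (act a x) (act (a \<otimes>\<^bsub>G\<^esub> g) y) < \<delta>"
      using g(3) energy_dist_act[OF a] act_mult[OF a g(1)] by simp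
    define N where "N = nat \<lfloor>energy_dist g0 x (act a x) / \<delta>\<rfloor>"
    have q0: "0 \<le> energy_dist g0 x (act a x) / \<delta>" using energy_dist_nonneg \<delta> by simp
    have "energy_dist g0 x (act a x) / \<delta> < real N + 1" using q0 by (simp add: N_def)
    then have lt: "energy_dist g0 x (act a x) < (real N + 1) * \<delta>" using \<delta> by (simp add: pos_divide_less_eq)
    have N: "real N \<le> energy_dist g0 x (act a x) / \<delta>" using q0 by (simp add: N_def)
    have "real_of_int \<bar>\<phi> (a \<otimes>\<^bsub>G\<^esub> g) - \<phi> g\<bar> \<le> B * (real N + 1)"
      by (rule chain[OF g(2,2,1) ag g(3) near lt])
    then have "real_of_int \<bar>\<phi> a\<bar> \<le> B * (real N + 1)" using \<phi>[OF a g(1)] by simp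
    also have "\<dots> \<le> B * (energy_dist g0 x (act a x) / \<delta> + 1)" using N B0 by (intro mult_left_mono) auto
    finally show "real_of_int \<bar>\<phi> a\<bar> \<le> B * (energy_dist g0 x (act a x) / \<delta> + 1)" .
  qed
qed

end

section \<open>Measurability of the distance\<close>

context smooth_manifold
begin

definition frame_at :: "('m, 'e) chart \<Rightarrow> 'e \<Rightarrow> 'e \<Rightarrow> 'e \<Rightarrow> 'm \<times> ('m, 'e) tvec \<times> ('m, 'e) tvec" where
  "frame_at c u w p = (chart_inv c p, tvec_of A c (chart_inv c p) u, tvec_of A c (chart_inv c p) w)"

lemma tangent_sum_open: "openin (tangent_sum_topology A) (tangent_sum A)"
proof -
  have "tangent_sum_chart_image A c (tangent_sum A) = (snd c ` fst c) \<times> UNIV" if "c \<in> A" for c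
    using tvec_of_tangent[OF that chart_facts(7)[OF that]]
    by (auto simp: tangent_sum_chart_image_def tangent_sum_def)
  then show ?thesis
    by (auto simp: openin_tangent_sum_topology chart_facts(2) open_Times)
qed

lemma continuous_map_frame:
  assumes c: "c \<in> A"
  shows "continuous_map (top_of_set (snd c ` fst c)) (tangent_sum_topology A) (frame_at c u w)"
  unfolding continuous_map_def
proof (intro conjI allI impI)
  have sub: "tangent_sum A \<subseteq> topspace (tangent_sum_topology A)" by (rule openin_subset[OF tangent_sum_open])
  show "frame_at c u w \<in> topspace (top_of_set (snd c ` fst c)) \<rightarrow> topspace (tangent_sum_topology A)"
  proof
    fix p assume "p \<in> topspace (top_of_set (snd c ` fst c))"
    then have "chart_inv c p \<in> fst c" using chart_facts(7)[OF c] by simp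
    then have "frame_at c u w p \<in> tangent_sum A"
      by (simp add: frame_at_def tangent_sum_def tvec_of_tangent[OF c])
    then show "frame_at c u w p \<in> topspace (tangent_sum_topology A)" using sub by blast
  qed
  fix W assume "openin (tangent_sum_topology A) W"
  then have W: "open (tangent_sum_chart_image A c W)" using c by (simp add: openin_tangent_sum_topology)
  have "{p \<in> topspace (top_of_set (snd c ` fst c)). frame_at c u w p \<in> W} =
     (\<lambda>p. (p, u, w)) -` tangent_sum_chart_image A c W"
    by (auto simp: tangent_sum_chart_image_def frame_at_def)
  moreover have "open ((\<lambda>p. (p, u, w)) -` tangent_sum_chart_image A c W)"
    by (rule open_vimage[OF W]) (intro continuous_intros)
  ultimately show "openin (top_of_set (snd c ` fst c)) {p \<in> topspace (top_of_set (snd c ` fst c)). frame_at c u w p \<in> W}"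
    by (auto simp: openin_open_eq[OF chart_facts(2)[OF c]] tangent_sum_chart_image_def)
qed

text \<open>A compact set of pairs of tangent vectors whose uniform closeness controls the quadratic forms
  of two metrics along the curve. The error is measured in units of the reference metric, so that
  it can be absorbed into either metric.\<close>

definition test_set :: "('m, 'e) metric \<Rightarrow> (real \<Rightarrow> 'm) \<Rightarrow> real set \<Rightarrow> ('m \<times> ('m, 'e) tvec \<times> ('m, 'e) tvec) set \<Rightarrow> real \<Rightarrow> bool" where
  "test_set g0 \<gamma> S K D \<longleftrightarrow> compactin (tangent_sum_topology A) K \<and> 0 \<le> D \<and>
     (\<forall>g1 g2 e. riemannian_metric A g1 \<longrightarrow> riemannian_metric A g2 \<longrightarrow> 0 \<le> e \<longrightarrow>
       (\<forall>(x, u, w)\<in>K. \<bar>g1 x u w - g2 x u w\<bar> \<le> e) \<longrightarrow>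
       (\<forall>s\<in>S. \<forall>v\<in>tangent_space A (\<gamma> s). g1 (\<gamma> s) v v \<le> g2 (\<gamma> s) v v + D * e * g0 (\<gamma> s) v v))"

text \<open>The frames of basis vectors along the curve depend continuously on the point, so they form a
  compact set, and the values on them are the coefficients of the metric.\<close>

lemma test_set_chart:
  assumes g0: "riemannian_metric A g0" and c: "c \<in> A" and im: "\<gamma> ` {r..s} \<subseteq> fst c"
    and cont: "continuous_on {r..s} \<gamma>"
  shows "\<exists>K D. test_set g0 \<gamma> {r..s} K D"
proof -
  define C where "C = snd c ` \<gamma> ` {r..s}"
  have comp: "compact C"
    unfolding C_def
    by (intro compact_continuous_image cont compact_Icc continuous_on_subset[OF chart_facts(3)[OF c] im])
  have sub: "C \<subseteq> snd c ` fst c" using im by (auto simp: C_def)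
  obtain \<kappa> \<Lambda> where \<kappa>: "0 < \<kappa>" "0 \<le> \<Lambda>"
    "\<And>x v. x \<in> fst c \<Longrightarrow> snd c x \<in> C \<Longrightarrow> v \<in> tangent_space A x \<Longrightarrow>
       \<kappa> * (norm (v c))\<^sup>2 \<le> g0 x v v \<and> g0 x v v \<le> \<Lambda> * (norm (v c))\<^sup>2"
    by (rule metric_chart_bounds[OF g0 c comp sub]) blast
  define K where "K = (\<Union>b\<in>ONB. \<Union>b'\<in>ONB. frame_at c b b' ` C)"
  have fr: "compactin (tangent_sum_topology A) (frame_at c b b' ` C)" for b b'
  proof -
    have "compactin (top_of_set (snd c ` fst c)) C" using comp sub by (simp add: compactin_subtopology)
    then show ?thesis
      by (rule image_compactin[OF _ continuous_map_frame[OF c]])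
  qed
  have K: "compactin (tangent_sum_topology A) K"
    unfolding K_def by (auto intro!: compactin_Union simp: ONB(1) fr)
  define n where "n = real (card ONB)"
  define D where "D = n\<^sup>2 / \<kappa>"
  have D: "0 \<le> D" using \<kappa> by (simp add: D_def)
  have "g1 (\<gamma> t) v v \<le> g2 (\<gamma> t) v v + D * e * g0 (\<gamma> t) v v"
    if g: "riemannian_metric A g1" "riemannian_metric A g2" and e: "0 \<le> e"
      and close: "\<forall>(x, u, w)\<in>K. \<bar>g1 x u w - g2 x u w\<bar> \<le> e"
      and t: "t \<in> {r..s}" and v: "v \<in> tangent_space A (\<gamma> t)" for g1 g2 e t v
  proof -
    have x: "\<gamma> t \<in> fst c" using im t by blast
    have p: "snd c (\<gamma> t) \<in> C" using t by (auto simp: C_def)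
    have cf: "\<bar>coeff g1 c (snd c (\<gamma> t)) b b' - coeff g2 c (snd c (\<gamma> t)) b b'\<bar> \<le> e"
      if b: "b \<in> ONB" "b' \<in> ONB" for b b'
    proof -
      have "frame_at c b b' (snd c (\<gamma> t)) \<in> K" using p b by (auto simp: K_def)
      then show ?thesis using close by (auto simp: frame_at_def coeff_def)
    qed
    have "g1 (\<gamma> t) v v - g2 (\<gamma> t) v v = (\<Sum>b\<in>ONB. \<Sum>b'\<in>ONB. inner (v c) b * inner (v c) b' *
        (coeff g1 c (snd c (\<gamma> t)) b b' - coeff g2 c (snd c (\<gamma> t)) b b'))"
      by (simp add: metric_expand[OF g(1) c x v] metric_expand[OF g(2) c x v] sum_subtractf right_diff_distrib)
    also have "\<dots> \<le> (\<Sum>b\<in>ONB. \<Sum>b'\<in>ONB. norm (v c) * norm (v c) * e)"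
    proof (intro sum_mono)
      fix b b' assume b: "b \<in> ONB" "b' \<in> ONB"
      let ?d = "coeff g1 c (snd c (\<gamma> t)) b b' - coeff g2 c (snd c (\<gamma> t)) b b'"
      have "inner (v c) b * inner (v c) b' * ?d \<le> \<bar>inner (v c) b\<bar> * \<bar>inner (v c) b'\<bar> * \<bar>?d\<bar>"
        by (metis abs_ge_self abs_mult)
      also have "\<dots> \<le> norm (v c) * norm (v c) * e"
        by (intro mult_mono abs_inner_ONB b cf mult_nonneg_nonneg) auto
      finally show "inner (v c) b * inner (v c) b' * ?d \<le> norm (v c) * norm (v c) * e" .
    qed
    also have "\<dots> = n\<^sup>2 * e * (norm (v c))\<^sup>2" by (simp add: n_def power2_eq_square)
    also have "\<dots> \<le> n\<^sup>2 * e * (g0 (\<gamma> t) v v / \<kappa>)"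
      using \<kappa>(3)[OF x p v] \<kappa>(1) e by (intro mult_left_mono) (auto simp: pos_le_divide_eq mult.commute)
    also have "\<dots> = D * e * g0 (\<gamma> t) v v" by (simp add: D_def)
    finally show ?thesis by simp
  qed
  then have "test_set g0 \<gamma> {r..s} K D" unfolding test_set_def using K D by blast
  then show ?thesis by blast
qed

lemma test_set_mono:
  assumes g0: "riemannian_metric A g0" and t: "test_set g0 \<gamma> S K D" and D: "D \<le> D'" and K: "K \<subseteq> K'"
    "compactin (tangent_sum_topology A) K'"
  shows "test_set g0 \<gamma> S K' D'"
  unfolding test_set_def
proof (intro conjI allI impI ballI K(2))
  show "0 \<le> D'" using t D by (simp add: test_set_def)
  fix g1 g2 :: "('m, 'e) metric" and e s v
  assume *: "riemannian_metric A g1" "riemannian_metric A g2" "0 \<le> e"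
    "\<forall>(x, u, w)\<in>K'. \<bar>g1 x u w - g2 x u w\<bar> \<le> e" "s \<in> S" "v \<in> tangent_space A (\<gamma> s)"
  then have "\<forall>(x, u, w)\<in>K. \<bar>g1 x u w - g2 x u w\<bar> \<le> e" using K(1) by blast
  then have "g1 (\<gamma> s) v v \<le> g2 (\<gamma> s) v v + D * e * g0 (\<gamma> s) v v"
    using t * unfolding test_set_def by blast
  also have "\<dots> \<le> g2 (\<gamma> s) v v + D' * e * g0 (\<gamma> s) v v"
    using D *(3) riem_nonneg[OF g0 *(6)] by (intro add_left_mono mult_right_mono) auto
  finally show "g1 (\<gamma> s) v v \<le> g2 (\<gamma> s) v v + D' * e * g0 (\<gamma> s) v v" .
qed

lemma test_set_exists:
  assumes g0: "riemannian_metric A g0" and ac: "ac_curve a b \<gamma>" and ab: "a \<le> b"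
  shows "\<exists>K D. test_set g0 \<gamma> {a..b} K D"
  using ac ab
proof (rule curve_subdivision)
  fix r m s assume rs: "r \<le> m" "m \<le> s"
    and "\<exists>K D. test_set g0 \<gamma> {r..m} K D" "\<exists>K D. test_set g0 \<gamma> {m..s} K D"
  then obtain K1 D1 K2 D2 where 1: "test_set g0 \<gamma> {r..m} K1 D1" and 2: "test_set g0 \<gamma> {m..s} K2 D2" by blast
  have K: "compactin (tangent_sum_topology A) (K1 \<union> K2)"
    using 1 2 by (auto simp: test_set_def intro: compactin_Un)
  have "test_set g0 \<gamma> {r..m} (K1 \<union> K2) (max D1 D2)" "test_set g0 \<gamma> {m..s} (K1 \<union> K2) (max D1 D2)"
    using test_set_mono[OF g0 1 _ _ K] test_set_mono[OF g0 2 _ _ K] by auto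
  moreover have "{r..s} = {r..m} \<union> {m..s}" using rs by auto
  ultimately have "test_set g0 \<gamma> {r..s} (K1 \<union> K2) (max D1 D2)"
    unfolding test_set_def by blast
  then show "\<exists>K D. test_set g0 \<gamma> {r..s} K D" by blast
qed (rule test_set_chart[OF g0])

lemma ucc_open_in_borel: "ucc_open X F \<Longrightarrow> F \<in> sets (ucc_borel X)"
  unfolding ucc_borel_def by (subst sets_measure_of) (auto simp: ucc_open_def)

lemma ucc_open_Union: "(\<And>U. U \<in> \<U> \<Longrightarrow> ucc_open X U) \<Longrightarrow> ucc_open X (\<Union>\<U>)"
proof -
  assume U: "\<And>U. U \<in> \<U> \<Longrightarrow> ucc_open X U"
  show ?thesis
    unfolding ucc_open_def
  proof (intro conjI ballI)
    show "\<Union>\<U> \<subseteq> continuous_functions X"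
      using U by (auto simp: ucc_open_def)
    fix f assume "f \<in> \<Union>\<U>"
    then obtain V where V: "V \<in> \<U>" "f \<in> V" by blast
    then obtain K e where "compactin X K" "0 < e"
      "\<forall>h\<in>continuous_functions X. (\<forall>z\<in>K. \<bar>h z - f z\<bar> < e) \<longrightarrow> h \<in> V"
      using U[OF V(1)] unfolding ucc_open_def by meson
    then show "\<exists>K e. compactin X K \<and> 0 < e \<and>
        (\<forall>h\<in>continuous_functions X. (\<forall>z\<in>K. \<bar>h z - f z\<bar> < e) \<longrightarrow> h \<in> \<Union>\<U>)"
      using V(1) by (intro exI[of _ K] exI[of _ e]) blast
  qed
qed

text \<open>The gap between the bound \<open>e'\<close> and \<open>e\<close> makes the ball open even when \<open>K\<close> is empty, where no supremum
  of differences exists.\<close>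

lemma ucc_open_ball:
  assumes K: "compactin X K"
  shows "ucc_open X {f \<in> continuous_functions X. \<exists>e'<e. \<forall>z\<in>K. \<bar>f z - f0 z\<bar> \<le> (e'::real)}"
  unfolding ucc_open_def
proof (intro conjI ballI)
  fix f assume "f \<in> {f \<in> continuous_functions X. \<exists>e'<e. \<forall>z\<in>K. \<bar>f z - f0 z\<bar> \<le> e'}"
  then obtain e' where e': "e' < e" "\<And>z. z \<in> K \<Longrightarrow> \<bar>f z - f0 z\<bar> \<le> e'" by blast
  show "\<exists>K' e''. compactin X K' \<and> 0 < e'' \<and> (\<forall>h\<in>continuous_functions X. (\<forall>z\<in>K'. \<bar>h z - f z\<bar> < e'') \<longrightarrow>
      h \<in> {f \<in> continuous_functions X. \<exists>e'<e. \<forall>z\<in>K. \<bar>f z - f0 z\<bar> \<le> e'})"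
  proof (intro exI[of _ K] exI[of _ "(e - e') / 2"] conjI K ballI impI)
    show "0 < (e - e') / 2" using e' by simp
    fix h assume h: "h \<in> continuous_functions X" "\<forall>z\<in>K. \<bar>h z - f z\<bar> < (e - e') / 2"
    have "\<bar>h z - f0 z\<bar> \<le> (e + e') / 2" if "z \<in> K" for z
    proof -
      have "\<bar>h z - f z\<bar> < (e - e') / 2" "\<bar>f z - f0 z\<bar> \<le> e'" using h(2) e'(2) that by auto
      moreover have "\<bar>h z - f0 z\<bar> \<le> \<bar>h z - f z\<bar> + \<bar>f z - f0 z\<bar>" by linarith
      moreover have "(e + e') / 2 = (e - e') / 2 + e'" by (simp add: field_simps)
      ultimately show ?thesis by linarith
    qed
    moreover have "(e + e') / 2 < e" using e'(1) by simp
    ultimately show "h \<in> {f \<in> continuous_functions X. \<exists>e'<e. \<forall>z\<in>K. \<bar>f z - f0 z\<bar> \<le> e'}"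
      using h(1) by blast
  qed
qed blast

text \<open>The sublevel sets of the minimal energy are open for uniform convergence on compact sets: a
  competitor for one metric remains one for all metrics that are close on its test set. The set
  below is the largest open set of functions that contains no metric of the family outside the
  sublevel set.\<close>

lemma min_energy_less_measurable:
  assumes g0: "riemannian_metric A g0" and g: "\<And>\<omega>. \<omega> \<in> space P \<Longrightarrow> riemannian_metric A (g \<omega>)"
    and crm: "continuous_random_metric A P g" and C: "0 < C"
    and le: "\<And>\<omega> x v. \<omega> \<in> space P \<Longrightarrow> v \<in> tangent_space A x \<Longrightarrow> g0 x v v \<le> C * g \<omega> x v v"
  shows "{\<omega>\<in>space P. min_energy (g \<omega>) x y < a} \<in> sets P"
proof -
  let ?X = "tangent_sum_topology A"
  define \<Psi> where "\<Psi> \<omega> = (\<lambda>(x, v, w). g \<omega> x v w)" for \<omega>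
  have \<Psi>: "\<Psi> \<in> measurable P (ucc_borel ?X)"
    using crm unfolding continuous_random_metric_def \<Psi>_def .
  have sp: "space (ucc_borel ?X) = continuous_functions ?X"
    by (simp add: ucc_borel_def space_measure_of_conv)
  define \<U> where "\<U> = {U. ucc_open ?X U \<and> (\<forall>\<omega>\<in>space P. \<Psi> \<omega> \<in> U \<longrightarrow> min_energy (g \<omega>) x y < a)}"
  have "ucc_open ?X (\<Union>\<U>)" by (rule ucc_open_Union) (simp add: \<U>_def)
  then have "\<Psi> -` \<Union>\<U> \<inter> space P \<in> sets P"
    by (rule measurable_sets[OF \<Psi> ucc_open_in_borel])
  moreover have "\<Psi> -` \<Union>\<U> \<inter> space P = {\<omega>\<in>space P. min_energy (g \<omega>) x y < a}"
  proof (intro equalityI subsetI)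
    fix \<omega> assume "\<omega> \<in> \<Psi> -` \<Union>\<U> \<inter> space P"
    then show "\<omega> \<in> {\<omega>\<in>space P. min_energy (g \<omega>) x y < a}" by (auto simp: \<U>_def)
  next
    fix \<omega>0 assume "\<omega>0 \<in> {\<omega>\<in>space P. min_energy (g \<omega>) x y < a}"
    then have \<omega>0: "\<omega>0 \<in> space P" and lt: "min_energy (g \<omega>0) x y < a" by auto
    obtain \<gamma> where ac: "ac_curve 0 1 \<gamma>" and \<gamma>: "\<gamma> 0 = x" "\<gamma> 1 = y" "energy (g \<omega>0) 0 1 \<gamma> < a"
      by (rule min_energy_less[OF lt])
    obtain K D where KD: "test_set g0 \<gamma> {0..1} K D" using test_set_exists[OF g0 ac] by auto
    then have K: "compactin ?X K" and D: "0 \<le> D" by (auto simp: test_set_def)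
    obtain a' where a': "energy (g \<omega>0) 0 1 \<gamma> < a'" "a' < a" using dense[OF \<gamma>(3)] by blast
    then have "a' < \<top>" "energy (g \<omega>0) 0 1 \<gamma> < \<top>" by (auto simp: top.not_eq_extremum intro: less_le_trans)
    then obtain R r where Rr: "energy (g \<omega>0) 0 1 \<gamma> = ennreal R" "0 \<le> R" "a' = ennreal r" "0 \<le> r"
      by (metis ennreal_cases less_irrefl)
    have Rr': "R < r" using a'(1) Rr by (simp add: ennreal_less_iff)
    \<comment> \<open>Closeness \<open>e\<close> on the test set multiplies the energy by at most \<open>1 + D * e * C\<close>, which must
      not carry \<open>R\<close> beyond \<open>r\<close>.\<close>
    define e where "e = (r - R) / (D * C * R + 1)"
    have DCR: "0 \<le> D * C * R" using D C Rr by simp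
    have e: "0 < e" using Rr' DCR by (simp add: e_def)
    have eR: "(1 + D * e * C) * R \<le> r"
    proof -
      have "e * (D * C * R) \<le> e * (D * C * R + 1)" using e by simp
      also have "\<dots> = r - R" using DCR by (simp add: e_def)
      finally show ?thesis by (simp add: algebra_simps)
    qed
    define U where "U = {f \<in> continuous_functions ?X. \<exists>e'<e. \<forall>z\<in>K. \<bar>f z - \<Psi> \<omega>0 z\<bar> \<le> e'}"
    have "ucc_open ?X U" unfolding U_def by (rule ucc_open_ball[OF K])
    moreover have "min_energy (g \<omega>) x y < a" if \<omega>: "\<omega> \<in> space P" and in_U: "\<Psi> \<omega> \<in> U" for \<omega>
    proof -
      obtain e' where e': "e' < e" "\<forall>z\<in>K. \<bar>\<Psi> \<omega> z - \<Psi> \<omega>0 z\<bar> \<le> e'" using in_U by (auto simp: U_def)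
      have close: "\<forall>(x, u, w)\<in>K. \<bar>g \<omega> x u w - g \<omega>0 x u w\<bar> \<le> e"
      proof clarify
        fix x u w assume "(x, u, w) \<in> K"
        from bspec[OF e'(2) this] show "\<bar>g \<omega> x u w - g \<omega>0 x u w\<bar> \<le> e"
          using e'(1) by (simp add: \<Psi>_def)
      qed
      have "g \<omega> (\<gamma> s) v v \<le> (1 + D * e * C) * g \<omega>0 (\<gamma> s) v v"
        if s: "s \<in> {0..1}" and v: "v \<in> tangent_space A (\<gamma> s)" for s v
      proof -
        have "g \<omega> (\<gamma> s) v v \<le> g \<omega>0 (\<gamma> s) v v + D * e * g0 (\<gamma> s) v v"
          using KD g[OF \<omega>] g[OF \<omega>0] e close s v unfolding test_set_def by (meson less_imp_le)
        also have "\<dots> \<le> g \<omega>0 (\<gamma> s) v v + D * e * (C * g \<omega>0 (\<gamma> s) v v)"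
          using le[OF \<omega>0 v] D e by (intro add_left_mono mult_left_mono) auto
        finally show ?thesis by (simp add: algebra_simps)
      qed
      then have "energy (g \<omega>) 0 1 \<gamma> \<le> ennreal (1 + D * e * C) * energy (g \<omega>0) 0 1 \<gamma>"
        using D e C by (intro energy_mono[OF g[OF \<omega>0] ac]) auto
      also have "\<dots> = ennreal ((1 + D * e * C) * R)"
        unfolding Rr(1) by (rule ennreal_mult[symmetric]) (use D e C Rr in auto)
      also have "\<dots> \<le> ennreal r" using eR by (rule ennreal_leI)
      also have "\<dots> < a" using a'(2) Rr by simp
      finally have "energy (g \<omega>) 0 1 \<gamma> < a" .
      then show ?thesis using min_energy_le[OF ac, of "g \<omega>"] \<gamma> by simp
    qed
    moreover have "\<Psi> \<omega>0 \<in> U"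
    proof -
      have "\<Psi> \<omega>0 \<in> continuous_functions ?X" using measurable_space[OF \<Psi> \<omega>0] sp by simp
      then show ?thesis using e by (auto simp: U_def intro!: exI[of _ 0])
    qed
    ultimately have "U \<in> \<U>" "\<Psi> \<omega>0 \<in> U" by (auto simp: \<U>_def)
    then show "\<omega>0 \<in> \<Psi> -` \<Union>\<U> \<inter> space P" using \<omega>0 by blast
  qed
  ultimately show ?thesis by simp
qed

end

lemma (in connected_manifold) energy_dist_measurable:
  assumes g0: "riemannian_metric A g0" and g: "\<And>\<omega>. \<omega> \<in> space P \<Longrightarrow> riemannian_metric A (g \<omega>)"
    and crm: "continuous_random_metric A P g" and C: "0 < C"
    and le: "\<And>\<omega> x v. \<omega> \<in> space P \<Longrightarrow> v \<in> tangent_space A x \<Longrightarrow> g0 x v v \<le> C * g \<omega> x v v"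
  shows "(\<lambda>\<omega>. energy_dist (g \<omega>) x y) \<in> borel_measurable P"
  unfolding borel_measurable_iff_less
proof
  fix a :: real
  show "{\<omega>\<in>space P. energy_dist (g \<omega>) x y < a} \<in> sets P"
  proof (cases "0 < a")
    case True
    have "{\<omega>\<in>space P. energy_dist (g \<omega>) x y < a} = {\<omega>\<in>space P. min_energy (g \<omega>) x y < ennreal (a\<^sup>2)}"
      using energy_dist_less_iff[OF g True] by blast
    then show ?thesis using min_energy_less_measurable[OF g0 g crm C le] by simp
  next
    case False
    then have "\<not> energy_dist (g \<omega>) x y < a" for \<omega> using energy_dist_nonneg[of "g \<omega>" x y] by linarith
    then have "{\<omega>\<in>space P. energy_dist (g \<omega>) x y < a} = {}" by blast
    then show ?thesis by (simp only: sets.empty_sets)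
  qed
qed

section \<open>Comparison of the random metrics with the reference metric\<close>

text \<open>A quadratic form is determined by its values on vectors of one fixed length, where the lower bound
  is positive if that length is large.\<close>

lemma (in smooth_manifold) superlinear_bounds_comparable:
  assumes g0: "riemannian_metric A g0" and g: "\<And>\<omega>. \<omega> \<in> space P \<Longrightarrow> riemannian_metric A (g \<omega>)"
    and sb: "superlinear_bounds A g0 P g"
  obtains C where "1 \<le> C"
    "\<And>\<omega> x v. \<omega> \<in> space P \<Longrightarrow> v \<in> tangent_space A x \<Longrightarrow> g0 x v v \<le> C\<^sup>2 * g \<omega> x v v"
    "\<And>\<omega> x v. \<omega> \<in> space P \<Longrightarrow> v \<in> tangent_space A x \<Longrightarrow> g \<omega> x v v \<le> C\<^sup>2 * g0 x v v"
proof -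
  obtain \<theta> \<Theta> where th: "convex_superlinear \<theta>" and
    bd: "\<And>\<omega> x v. \<omega> \<in> space P \<Longrightarrow> v \<in> tangent_space A x \<Longrightarrow>
       \<theta> (tnorm g0 x v) \<le> g \<omega> x v v \<and> g \<omega> x v v \<le> \<Theta> (tnorm g0 x v)"
    using sb unfolding superlinear_bounds_def by blast
  have "filterlim (\<lambda>r. \<theta> r / r) at_top at_top" using th by (simp add: convex_superlinear_def)
  then have "\<forall>\<^sub>F r in at_top. 1 \<le> \<theta> r / r" by (simp add: filterlim_at_top)
  then have "\<forall>\<^sub>F r in at_top. 1 \<le> \<theta> r / r \<and> 1 \<le> r"
    using eventually_ge_at_top[of "1::real"] by eventually_elim simp
  then obtain r0 where r0: "1 \<le> \<theta> r0 / r0" "1 \<le> r0"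
    by (auto simp: eventually_at_top_linorder)
  have th1: "1 \<le> \<theta> r0"
  proof -
    have "r0 \<le> \<theta> r0" using r0 by (simp add: pos_le_divide_eq)
    then show ?thesis using r0 by simp
  qed
  define C where "C = r0 + \<bar>\<Theta> 1\<bar>"
  have C: "1 \<le> C" "r0 \<le> C" "\<Theta> 1 \<le> C" using r0 by (auto simp: C_def)
  have CC: "C \<le> C\<^sup>2" using C(1) by (simp add: power2_eq_square)
  \<comment> \<open>Rescale a tangent vector to a fixed length, where the bounds are mere constants.\<close>
  have unit: "tnorm g0 x (\<lambda>c. (\<rho> / sqrt (g0 x v v)) *\<^sub>R v c) = \<rho>"
      "g' x (\<lambda>c. (\<rho> / sqrt (g0 x v v)) *\<^sub>R v c) (\<lambda>c. (\<rho> / sqrt (g0 x v v)) *\<^sub>R v c) = \<rho>\<^sup>2 / g0 x v v * g' x v v"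
    if v: "v \<in> tangent_space A x" "0 < g0 x v v" and \<rho>: "0 < \<rho>" and g': "riemannian_metric A g'" for x v \<rho> g'
    using v(2) \<rho> by (simp_all add: tnorm_def riem_quadratic[OF g0 v(1)] riem_quadratic[OF g' v(1)]
        power_divide real_sqrt_mult real_sqrt_divide)
  show thesis
  proof (rule that[OF C(1)])
    fix \<omega> x v assume \<omega>: "\<omega> \<in> space P" and v: "v \<in> tangent_space A x"
    show "g0 x v v \<le> C\<^sup>2 * g \<omega> x v v"
    proof (cases "g0 x v v = 0")
      case False
      then have pos: "0 < g0 x v v" using riem_nonneg[OF g0 v] by simp
      have "\<theta> r0 \<le> r0\<^sup>2 / g0 x v v * g \<omega> x v v"
        using bd[OF \<omega> tangent_scale[OF v], of "r0 / sqrt (g0 x v v)"] unit[OF v pos _ g[OF \<omega>], of r0] r0 by simp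
      then have "1 \<le> r0\<^sup>2 / g0 x v v * g \<omega> x v v" using th1 by simp
      then have "g0 x v v \<le> r0\<^sup>2 * g \<omega> x v v" using pos by (simp add: pos_le_divide_eq)
      also have "\<dots> \<le> C\<^sup>2 * g \<omega> x v v"
        using C r0 riem_nonneg[OF g[OF \<omega>] v] by (intro mult_right_mono power_mono) auto
      finally show ?thesis .
    qed (simp add: riem_nonneg[OF g[OF \<omega>] v])
    show "g \<omega> x v v \<le> C\<^sup>2 * g0 x v v"
    proof (cases "v = (\<lambda>_. 0)")
      case True
      then show ?thesis using riem_zero[OF g[OF \<omega>]] riem_zero[OF g0] by simp
    next
      case False
      then have pos: "0 < g0 x v v" by (rule riem_pos[OF g0 v])
      have "1\<^sup>2 / g0 x v v * g \<omega> x v v \<le> \<Theta> 1"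
        using bd[OF \<omega> tangent_scale[OF v], of "1 / sqrt (g0 x v v)"] unit[OF v pos zero_less_one g[OF \<omega>]] by simp
      also have "\<Theta> 1 \<le> C\<^sup>2" using C CC by simp
      finally show ?thesis using pos by (simp add: pos_divide_le_eq)
    qed
  qed
qed

section \<open>The dynamical system preserves the measure of preimages\<close>

text \<open>The map \<open>\<tau>\<close> of the neutral element is a retraction onto a set of full measure, on which all
  the maps \<open>\<tau> a\<close> are bijective.\<close>

lemma dynamical_system_preimage:
  assumes ds: "dynamical_system G TG P \<tau>" and G: "group G" and P: "prob_space P"
    and a: "a \<in> carrier G" and S: "S \<in> sets P"
  shows "measure P (\<tau> a -` S \<inter> space P) = measure P S"
proof -
  interpret G: group G by fact
  interpret P: prob_space P by fact
  have comp: "\<tau> (x \<otimes>\<^bsub>G\<^esub> y) \<omega> = \<tau> x (\<tau> y \<omega>)" if "x \<in> carrier G" "y \<in> carrier G" "\<omega> \<in> space P" for x y \<omega>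
    using ds that unfolding dynamical_system_def by blast
  have meas: "\<tau> x \<in> measurable P P" if "x \<in> carrier G" for x
    using ds that unfolding dynamical_system_def by blast
  have im: "\<tau> x ` E \<in> sets P" "measure P (\<tau> x ` E) = measure P E" if "x \<in> carrier G" "E \<in> sets P" for x E
    using ds that unfolding dynamical_system_def by blast+
  let ?e = "\<one>\<^bsub>G\<^esub>" and ?b = "inv\<^bsub>G\<^esub> a"
  define Q where "Q = \<tau> ?e ` space P"
  have Q: "Q \<in> sets P" "measure P Q = 1"
    using im[OF G.one_closed sets.top] P.prob_space by (simp_all add: Q_def)
  have sub: "Q \<subseteq> space P" using Q(1) by (rule sets.sets_into_space)
  have eQ: "\<tau> ?e \<omega> = \<omega>" if "\<omega> \<in> Q" for \<omega>
    using that comp[of ?e ?e] by (auto simp: Q_def)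
  have inQ: "\<tau> x \<omega> \<in> Q" if "x \<in> carrier G" "\<omega> \<in> space P" for x \<omega>
    using comp[OF G.one_closed that] that measurable_space[OF meas[OF that(1)] that(2)] by (auto simp: Q_def)
  have ab: "\<tau> a (\<tau> ?b \<omega>) = \<omega>" if "\<omega> \<in> Q" for \<omega>
    using comp[OF a, of ?b \<omega>] a eQ[OF that] that sub by auto
  define D where "D = (\<tau> a -` S \<inter> space P) \<inter> Q"
  have pre: "\<tau> a -` S \<inter> space P \<in> sets P" using meas[OF a] S by (rule measurable_sets)
  have D: "D \<in> sets P" unfolding D_def using pre Q by blast
  have full: "measure P (X \<inter> Q) = measure P X" if X: "X \<in> sets P" for X
  proof -
    have "AE \<omega> in P. \<omega> \<in> Q" using P.AE_prob_1[OF Q(2)] .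
    then show ?thesis using X Q by (intro P.finite_measure_eq_AE) auto
  qed
  have "\<tau> a ` D = S \<inter> Q"
  proof (intro equalityI subsetI)
    fix \<omega> assume "\<omega> \<in> \<tau> a ` D"
    then show "\<omega> \<in> S \<inter> Q" using inQ[OF a] by (auto simp: D_def)
  next
    fix \<omega> assume \<omega>: "\<omega> \<in> S \<inter> Q"
    then have "\<omega> \<in> space P" using sub by blast
    then have "\<tau> ?b \<omega> \<in> Q" using inQ[of ?b] a by simp
    moreover have "\<tau> a (\<tau> ?b \<omega>) = \<omega>" using ab \<omega> by blast
    ultimately have "\<tau> ?b \<omega> \<in> D" using \<omega> sub by (auto simp: D_def)
    then show "\<omega> \<in> \<tau> a ` D" using ab \<omega> by force
  qed
  then have "measure P D = measure P (S \<inter> Q)" using im(2)[OF a D] by simp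
  then show ?thesis using full[OF pre] full[OF S] by (simp add: D_def)
qed

section \<open>Minimal action and distance\<close>

text \<open>The velocity is a tangent vector almost everywhere, so the factor \<open>\<epsilon>\<close> leaves the integral squared.\<close>

lemma (in connected_manifold) min_action_eq:
  assumes g: "riemannian_metric A (g \<omega>)" and \<epsilon>: "0 < \<epsilon>"
  shows "min_action A (metric_lagrangian g) \<epsilon> x y 1 \<omega> = ereal (\<epsilon>\<^sup>2 * (energy_dist (g \<omega>) x y)\<^sup>2)"
proof -
  let ?S = "{\<gamma>. abs_continuous_curve A 1 \<gamma> \<and> \<gamma> 0 = x \<and> \<gamma> 1 = y}"
  let ?act = "\<lambda>\<gamma>. \<integral>\<^sup>+s\<in>{0..1}. ennreal (metric_lagrangian g (\<gamma> s) (\<lambda>c. \<epsilon> *\<^sub>R velocity A \<gamma> s c) \<omega>) \<partial>lebesgue"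
  have e2: "0 < \<epsilon>\<^sup>2" using \<epsilon> by simp
  have act: "?act \<gamma> = ennreal (\<epsilon>\<^sup>2) * energy (g \<omega>) 0 1 \<gamma>" if ac: "ac_curve 0 1 \<gamma>" for \<gamma>
  proof -
    have "?act \<gamma> = (\<integral>\<^sup>+s. ennreal (\<epsilon>\<^sup>2) * (speed2 (g \<omega>) \<gamma> s * indicator {0..1} s) \<partial>lebesgue)"
    proof (rule nn_integral_cong_AE)
      show "AE s in lebesgue. ennreal (metric_lagrangian g (\<gamma> s) (\<lambda>c. \<epsilon> *\<^sub>R velocity A \<gamma> s c) \<omega>) * indicator {0..1} s =
          ennreal (\<epsilon>\<^sup>2) * (speed2 (g \<omega>) \<gamma> s * indicator {0..1} s)"
        using AE_regular[OF ac]
      proof eventually_elim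
        case (elim s)
        show ?case
        proof (cases "s \<in> {0..1}")
          case True
          then have v: "velocity A \<gamma> s \<in> tangent_space A (\<gamma> s)" using elim velocity_tangent by blast
          then show ?thesis using True
            by (simp add: metric_lagrangian_def speed2_def riem_quadratic[OF g v] ennreal_mult' mult.assoc)
        qed simp
      qed
    qed
    also have "\<dots> = ennreal (\<epsilon>\<^sup>2) * energy (g \<omega>) 0 1 \<gamma>"
      unfolding energy_def by (rule nn_integral_cmult[OF speed2_measurable[OF g ac]])
    finally show ?thesis .
  qed
  have val: "enn2ereal (ennreal (\<epsilon>\<^sup>2 * (energy_dist (g \<omega>) x y)\<^sup>2)) = ereal (\<epsilon>\<^sup>2 * (energy_dist (g \<omega>) x y)\<^sup>2)"
    by (rule enn2ereal_ennreal) simp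
  show ?thesis
    unfolding min_action_def
  proof (rule INF_eqI)
    fix \<gamma> assume "\<gamma> \<in> ?S"
    then have ac: "ac_curve 0 1 \<gamma>" and \<gamma>: "\<gamma> 0 = x" "\<gamma> 1 = y" by (auto simp: ac_curve_iff)
    have "ennreal (\<epsilon>\<^sup>2 * (energy_dist (g \<omega>) x y)\<^sup>2) = ennreal (\<epsilon>\<^sup>2) * min_energy (g \<omega>) x y"
      by (simp add: min_energy_edist[OF g] ennreal_mult)
    also have "\<dots> \<le> ennreal (\<epsilon>\<^sup>2) * energy (g \<omega>) 0 1 \<gamma>"
      using min_energy_le[OF ac, of "g \<omega>"] \<gamma> by (intro mult_left_mono) auto
    finally have "ennreal (\<epsilon>\<^sup>2 * (energy_dist (g \<omega>) x y)\<^sup>2) \<le> ?act \<gamma>" by (simp only: act[OF ac])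
    then have "enn2ereal (ennreal (\<epsilon>\<^sup>2 * (energy_dist (g \<omega>) x y)\<^sup>2)) \<le> enn2ereal (?act \<gamma>)"
      by (simp only: less_eq_ennreal.rep_eq)
    then show "ereal (\<epsilon>\<^sup>2 * (energy_dist (g \<omega>) x y)\<^sup>2) \<le> enn2ereal (?act \<gamma>)" by (simp only: val)
  next
    fix z assume z: "\<And>\<gamma>. \<gamma> \<in> ?S \<Longrightarrow> z \<le> enn2ereal (?act \<gamma>)"
    show "z \<le> ereal (\<epsilon>\<^sup>2 * (energy_dist (g \<omega>) x y)\<^sup>2)"
    proof (rule ccontr)
      assume "\<not> ?thesis"
      then have "ereal (\<epsilon>\<^sup>2 * (energy_dist (g \<omega>) x y)\<^sup>2) < z" by simp
      from ereal_dense2[OF this] obtain r where r: "\<epsilon>\<^sup>2 * (energy_dist (g \<omega>) x y)\<^sup>2 < r" "ereal r < z"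
        by auto
      have r0: "0 \<le> r" using r(1) by (smt (verit) mult_nonneg_nonneg zero_le_power2)
      have "(energy_dist (g \<omega>) x y)\<^sup>2 < r / \<epsilon>\<^sup>2" using r(1) e2 by (simp add: pos_less_divide_eq mult.commute)
      then have "min_energy (g \<omega>) x y < ennreal (r / \<epsilon>\<^sup>2)"
        by (simp add: min_energy_edist[OF g] ennreal_less_iff)
      then obtain \<gamma> where ac: "ac_curve 0 1 \<gamma>" and \<gamma>: "\<gamma> 0 = x" "\<gamma> 1 = y" "energy (g \<omega>) 0 1 \<gamma> < ennreal (r / \<epsilon>\<^sup>2)"
        by (rule min_energy_less)
      have "?act \<gamma> \<le> ennreal (\<epsilon>\<^sup>2) * ennreal (r / \<epsilon>\<^sup>2)"
        unfolding act[OF ac] using \<gamma>(3) by (intro mult_left_mono) auto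
      also have "\<dots> = ennreal r" using e2 r0 by (simp add: ennreal_mult[symmetric])
      finally have "enn2ereal (?act \<gamma>) \<le> enn2ereal (ennreal r)" by (simp only: less_eq_ennreal.rep_eq)
      then have "enn2ereal (?act \<gamma>) \<le> ereal r" using r0 by simp
      moreover have "z \<le> enn2ereal (?act \<gamma>)" using ac \<gamma> by (intro z) (simp add: ac_curve_iff)
      ultimately show False using r(2) by auto
    qed
  qed
qed

section \<open>The stable norm\<close>

locale stationary_metric_setting = cocompact_isometric_action A g0 G act
  for A :: "('m::{t2_space,second_countable_topology}, 'e::real_inner) chart set"
    and g0 :: "('m, 'e) metric" and G :: "('g, 'z) monoid_scheme" and act :: "'g \<Rightarrow> 'm \<Rightarrow> 'm" +
  fixes T :: "('k, 'y) monoid_scheme" and \<iota> :: "(nat \<Rightarrow> int) \<times> 'k \<Rightarrow> 'g" and b :: nat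
    and TG :: "'g topology" and P :: "'w measure" and \<tau> :: "'g \<Rightarrow> 'w \<Rightarrow> 'w"
    and g :: "'w \<Rightarrow> ('m, 'e) metric"
    and \<Phi> :: "real \<Rightarrow> (nat \<Rightarrow> real) \<Rightarrow> nat \<Rightarrow> int" and Cf :: "real \<Rightarrow> real"
    and Lbar :: "(nat \<Rightarrow> real) \<Rightarrow> real"
  assumes T: "group T" and \<iota>: "\<iota> \<in> iso (Zb b \<times>\<times> T) G"
    and P: "prob_space P" and ds: "dynamical_system G TG P \<tau>"
    and g: "\<And>\<omega>. \<omega> \<in> space P \<Longrightarrow> riemannian_metric A (g \<omega>)"
    and crm: "continuous_random_metric A P g" and sb: "superlinear_bounds A g0 P g"
    and stat: "stationary_metric A G act P \<tau> g"
    and lat: "lattice_approximation b \<Phi> Cf"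
    and eff: "effective_lagrangian A b T \<iota> act P \<Phi> (metric_lagrangian g) Lbar"
begin

sublocale G: group G by (rule grp)
sublocale P: prob_space P by (rule P)

text \<open>Integer vectors are arbitrary sequences, cut off only on entering \<open>G\<close>. Sums and multiples
  are then pointwise operations that do not involve the extensional functions of the product
  group.\<close>

definition shift :: "(nat \<Rightarrow> int) \<Rightarrow> 'g" where
  "shift n = \<iota> (restrict n {..<b}, \<one>\<^bsub>T\<^esub>)"

lemma Zb_restrict: "restrict n {..<b} \<in> carrier (Zb b)"
  by (simp add: carrier_product_group)

lemma shift_mult: "shift (\<lambda>i. n i + m i) = shift n \<otimes>\<^bsub>G\<^esub> shift m"
proof -
  interpret T: group T by (rule T)
  have "\<iota> ((restrict n {..<b}, \<one>\<^bsub>T\<^esub>) \<otimes>\<^bsub>Zb b \<times>\<times> T\<^esub> (restrict m {..<b}, \<one>\<^bsub>T\<^esub>)) = shift n \<otimes>\<^bsub>G\<^esub> shift m"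
    unfolding shift_def
    using \<iota> Zb_restrict by (intro hom_mult[of \<iota> "Zb b \<times>\<times> T" G]) (auto simp: iso_def DirProd_def)
  moreover have "(restrict n {..<b}, \<one>\<^bsub>T\<^esub>) \<otimes>\<^bsub>Zb b \<times>\<times> T\<^esub> (restrict m {..<b}, \<one>\<^bsub>T\<^esub>) =
      (restrict (\<lambda>i. n i + m i) {..<b}, \<one>\<^bsub>T\<^esub>)"
    by (auto simp: mult_product_group intro!: restrict_ext)
  ultimately show ?thesis by (simp add: shift_def)
qed

lemma shift_closed: "shift n \<in> carrier G"
proof -
  interpret T: group T by (rule T)
  have "\<iota> \<in> carrier (Zb b \<times>\<times> T) \<rightarrow> carrier G" using \<iota> by (simp add: iso_def hom_def)
  moreover have "(restrict n {..<b}, \<one>\<^bsub>T\<^esub>) \<in> carrier (Zb b \<times>\<times> T)"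
    using Zb_restrict by (auto simp: DirProd_def)
  ultimately show ?thesis unfolding shift_def by (rule funcset_mem)
qed

lemma shift_zero: "shift (\<lambda>_. 0) = \<one>\<^bsub>G\<^esub>"
proof -
  have "shift (\<lambda>_. 0) \<otimes>\<^bsub>G\<^esub> shift (\<lambda>_. 0) = shift (\<lambda>_. 0)"
    using shift_mult[of "\<lambda>_. 0" "\<lambda>_. 0"] by simp
  then show ?thesis using shift_closed G.l_cancel_one[OF shift_closed shift_closed] by metis
qed

lemma shift_carrier: "n \<in> carrier (Zb b) \<Longrightarrow> shift n = \<iota> (n, \<one>\<^bsub>T\<^esub>)"
  by (auto simp: shift_def carrier_product_group PiE_def extensional_restrict)

definition coord :: "nat \<Rightarrow> 'g \<Rightarrow> int" where
  "coord i a = fst (inv_into (carrier (Zb b \<times>\<times> T)) \<iota> a) i"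

lemma coord_mult:
  assumes i: "i < b" and a: "a \<in> carrier G" "a' \<in> carrier G"
  shows "coord i (a \<otimes>\<^bsub>G\<^esub> a') = coord i a + coord i a'"
proof -
  let ?D = "Zb b \<times>\<times> T"
  interpret T: group T by (rule T)
  interpret Z: group "Zb b" by (rule product_group) simp
  interpret D: group ?D by (rule DirProd_group) unfold_locales
  have bij: "bij_betw \<iota> (carrier ?D) (carrier G)" and hom: "\<iota> \<in> hom ?D G" using \<iota> by (auto simp: iso_def)
  obtain p p' where p: "p \<in> carrier ?D" "a = \<iota> p" "p' \<in> carrier ?D" "a' = \<iota> p'"
    using bij a unfolding bij_betw_def by blast
  have inj: "inj_on \<iota> (carrier ?D)" using bij by (simp add: bij_betw_def)
  have "a \<otimes>\<^bsub>G\<^esub> a' = \<iota> (p \<otimes>\<^bsub>?D\<^esub> p')" using hom p by (simp add: hom_mult)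
  then have "coord i (a \<otimes>\<^bsub>G\<^esub> a') = fst (p \<otimes>\<^bsub>?D\<^esub> p') i"
    unfolding coord_def by (simp only: inv_into_f_f[OF inj D.m_closed[OF p(1,3)]])
  also have "\<dots> = fst p i + fst p' i" using i by (cases p; cases p') (simp add: mult_product_group)
  finally show ?thesis unfolding coord_def using p inj by (simp add: inv_into_f_f)
qed

lemma coord_shift:
  assumes "i < b"
  shows "coord i (shift n) = n i"
proof -
  interpret T: group T by (rule T)
  have "inj_on \<iota> (carrier (Zb b \<times>\<times> T))" using \<iota> by (auto simp: iso_def bij_betw_def)
  moreover have "(restrict n {..<b}, \<one>\<^bsub>T\<^esub>) \<in> carrier (Zb b \<times>\<times> T)"
    using Zb_restrict by (auto simp: DirProd_def)
  ultimately show ?thesis using assms by (simp add: coord_def shift_def inv_into_f_f)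
qed

definition distortion :: real where
  "distortion = (SOME C. 1 \<le> C \<and>
    (\<forall>\<omega>\<in>space P. \<forall>x. \<forall>v\<in>tangent_space A x. g0 x v v \<le> C\<^sup>2 * g \<omega> x v v \<and> g \<omega> x v v \<le> C\<^sup>2 * g0 x v v))"

lemma distortion: "1 \<le> distortion"
  "\<omega> \<in> space P \<Longrightarrow> v \<in> tangent_space A x \<Longrightarrow> g0 x v v \<le> distortion\<^sup>2 * g \<omega> x v v"
  "\<omega> \<in> space P \<Longrightarrow> v \<in> tangent_space A x \<Longrightarrow> g \<omega> x v v \<le> distortion\<^sup>2 * g0 x v v"
proof -
  have "\<exists>C. 1 \<le> C \<and>
    (\<forall>\<omega>\<in>space P. \<forall>x. \<forall>v\<in>tangent_space A x. g0 x v v \<le> C\<^sup>2 * g \<omega> x v v \<and> g \<omega> x v v \<le> C\<^sup>2 * g0 x v v)"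
  proof (rule superlinear_bounds_comparable[OF g0 g sb])
    fix C :: real
    assume "1 \<le> C"
      "\<And>\<omega> x v. \<omega> \<in> space P \<Longrightarrow> v \<in> tangent_space A x \<Longrightarrow> g0 x v v \<le> C\<^sup>2 * g \<omega> x v v"
      "\<And>\<omega> x v. \<omega> \<in> space P \<Longrightarrow> v \<in> tangent_space A x \<Longrightarrow> g \<omega> x v v \<le> C\<^sup>2 * g0 x v v"
    then show ?thesis by (intro exI[of _ C]) auto
  qed
  from someI_ex[OF this]
  have "1 \<le> distortion \<and>
    (\<forall>\<omega>\<in>space P. \<forall>x. \<forall>v\<in>tangent_space A x. g0 x v v \<le> distortion\<^sup>2 * g \<omega> x v v \<and> g \<omega> x v v \<le> distortion\<^sup>2 * g0 x v v)"
    unfolding distortion_def .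
  then show "1 \<le> distortion"
    "\<omega> \<in> space P \<Longrightarrow> v \<in> tangent_space A x \<Longrightarrow> g0 x v v \<le> distortion\<^sup>2 * g \<omega> x v v"
    "\<omega> \<in> space P \<Longrightarrow> v \<in> tangent_space A x \<Longrightarrow> g \<omega> x v v \<le> distortion\<^sup>2 * g0 x v v" by blast+
qed

lemma distortion_pos: "0 < distortion" using distortion(1) by simp

lemma energy_dist_upper: "\<omega> \<in> space P \<Longrightarrow> energy_dist (g \<omega>) x y \<le> distortion * energy_dist g0 x y"
  by (rule energy_dist_mono[OF g g0 distortion_pos distortion(3)])

lemma energy_dist_lower: "\<omega> \<in> space P \<Longrightarrow> energy_dist g0 x y \<le> distortion * energy_dist (g \<omega>) x y"
  by (rule energy_dist_mono[OF g0 g distortion_pos distortion(2)])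

text \<open>Any base point serves, since the limit is the same for all of them.\<close>

definition x0 :: 'm where "x0 = undefined"

definition disp :: "(nat \<Rightarrow> int) \<Rightarrow> real" where
  "disp n = energy_dist g0 x0 (act (shift n) x0)"

lemma disp_zero: "disp (\<lambda>_. 0) = 0"
  by (simp add: disp_def shift_zero act_one energy_dist_refl[OF g0])

lemma energy_dist_shift_diff:
  "energy_dist g0 (act (shift n) x0) (act (shift m) x0) = disp (\<lambda>i. m i - n i)"
proof -
  have "shift m = shift n \<otimes>\<^bsub>G\<^esub> shift (\<lambda>i. m i - n i)"
    using shift_mult[of n "\<lambda>i. m i - n i"] by simp
  then have "act (shift m) x0 = act (shift n) (act (shift (\<lambda>i. m i - n i)) x0)"
    by (simp add: act_mult shift_closed)
  then show ?thesis by (simp add: disp_def energy_dist_act shift_closed)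
qed

lemma disp_add: "disp (\<lambda>i. n i + m i) \<le> disp n + disp m"
  using energy_dist_triangle[OF g0, of x0 "act (shift (\<lambda>i. n i + m i)) x0" "act (shift n) x0"]
    energy_dist_shift_diff[of n "\<lambda>i. n i + m i"] by (simp add: disp_def)

lemma disp_minus: "disp (\<lambda>i. - n i) = disp n"
  using energy_dist_shift_diff[of n "\<lambda>_. 0"] energy_dist_sym[OF g0]
  by (simp add: disp_def shift_zero act_one)

definition unit :: "nat \<Rightarrow> nat \<Rightarrow> int" where "unit i = (\<lambda>j. if j = i then 1 else 0)"

lemma disp_multiple: "disp (\<lambda>j. k * unit i j) \<le> real_of_int \<bar>k\<bar> * disp (unit i)"
proof -
  have nat: "disp (\<lambda>j. int n * unit i j) \<le> real n * disp (unit i)" for n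
  proof (induction n)
    case (Suc n)
    have "(\<lambda>j. int (Suc n) * unit i j) = (\<lambda>j. int n * unit i j + unit i j)" by (simp add: algebra_simps)
    then show ?case using disp_add[of "\<lambda>j. int n * unit i j" "unit i"] Suc by (simp add: algebra_simps)
  qed (simp add: disp_zero)
  show ?thesis
  proof (cases "0 \<le> k")
    case True
    then show ?thesis using nat[of "nat k"] by simp
  next
    case False
    then show ?thesis using nat[of "nat (- k)"] disp_minus[of "\<lambda>j. k * unit i j"] by simp
  qed
qed

text \<open>Subadditivity and symmetry of the displacement, one coordinate at a time.\<close>

lemma disp_le: "disp n \<le> (\<Sum>i<b. real_of_int \<bar>n i\<bar> * disp (unit i))"
proof -
  have "disp (\<lambda>j. if j < k then n j else 0) \<le> (\<Sum>i<k. real_of_int \<bar>n i\<bar> * disp (unit i))" for k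
  proof (induction k)
    case (Suc k)
    have "(\<lambda>j. if j < Suc k then n j else 0) = (\<lambda>j. (if j < k then n j else 0) + n k * unit k j)"
      by (auto simp: unit_def less_Suc_eq fun_eq_iff)
    then show ?case
      using disp_add[of "\<lambda>j. if j < k then n j else 0" "\<lambda>j. n k * unit k j"] disp_multiple[of "n k" k] Suc
      by simp
  qed (simp add: disp_zero)
  moreover have "disp (\<lambda>j. if j < b then n j else 0) = disp n"
  proof -
    have "shift (\<lambda>j. if j < b then n j else 0) = shift n"
      unfolding shift_def by (auto intro!: arg_cong[of _ _ \<iota>] restrict_ext)
    then show ?thesis by (simp add: disp_def)
  qed
  ultimately show ?thesis by metis
qed

definition rdist :: "(nat \<Rightarrow> int) \<Rightarrow> 'w \<Rightarrow> real" where
  "rdist n \<omega> = energy_dist (g \<omega>) x0 (act (shift n) x0)"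

lemma rdist_nonneg: "0 \<le> rdist n \<omega>" by (simp add: rdist_def energy_dist_nonneg)

lemma rdist_lipschitz:
  assumes \<omega>: "\<omega> \<in> space P"
  shows "\<bar>rdist n \<omega> - rdist m \<omega>\<bar> \<le> distortion * (\<Sum>i<b. real_of_int \<bar>m i - n i\<bar> * disp (unit i))"
proof -
  have "\<bar>rdist n \<omega> - rdist m \<omega>\<bar> \<le> energy_dist (g \<omega>) (act (shift n) x0) (act (shift m) x0)"
    using energy_dist_triangle[OF g[OF \<omega>], of x0 "act (shift n) x0" "act (shift m) x0"]
      energy_dist_triangle[OF g[OF \<omega>], of x0 "act (shift m) x0" "act (shift n) x0"]
      energy_dist_sym[OF g[OF \<omega>], of "act (shift n) x0" "act (shift m) x0"]
    by (simp add: rdist_def)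
  also have "\<dots> \<le> distortion * disp (\<lambda>i. m i - n i)"
    using energy_dist_upper[OF \<omega>] by (simp add: energy_dist_shift_diff[symmetric])
  also have "\<dots> \<le> distortion * (\<Sum>i<b. real_of_int \<bar>m i - n i\<bar> * disp (unit i))"
    using disp_le[of "\<lambda>i. m i - n i"] distortion_pos by (intro mult_left_mono) auto
  finally show ?thesis .
qed

lemma rdist_measurable: "rdist n \<in> borel_measurable P"
  unfolding rdist_def[abs_def]
  by (rule energy_dist_measurable[OF g0 g crm _ distortion(2)]) (use distortion_pos in auto)

lemma tau_space: "a \<in> carrier G \<Longrightarrow> \<omega> \<in> space P \<Longrightarrow> \<tau> a \<omega> \<in> space P"
  using ds unfolding dynamical_system_def by (meson measurable_space)

lemma energy_dist_tau:
  assumes "a \<in> carrier G" "\<omega> \<in> space P"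
  shows "energy_dist (g (\<tau> a \<omega>)) x y = energy_dist (g \<omega>) (act a x) (act a y)"
proof (rule energy_dist_act_pullback[OF assms(1)])
  show "is_pullback (g (\<tau> a \<omega>)) (act a) (g \<omega>)"
    using stat assms unfolding stationary_metric_def is_pullback_def by blast
qed

lemma rdist_tau:
  assumes \<omega>: "\<omega> \<in> space P"
  shows "rdist m (\<tau> (shift n) \<omega>) = energy_dist (g \<omega>) (act (shift n) x0) (act (shift (\<lambda>i. n i + m i)) x0)"
  by (simp add: rdist_def energy_dist_tau[OF shift_closed \<omega>] shift_mult act_mult shift_closed)

definition limit_event :: "'w set" where
  "limit_event = (SOME E. E \<in> sets P \<and> measure P E = 1 \<and>
        (\<forall>\<omega>\<in>E. \<forall>x. \<forall>k\<in>carrier T. \<forall>h\<in>Rb b.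
           ((\<lambda>\<epsilon>. min_action A (metric_lagrangian g) \<epsilon> (act (\<iota> (\<one>\<^bsub>Zb b\<^esub>, k)) x) (act (\<iota> (\<Phi> \<epsilon> h, k)) x) 1 \<omega>)
              \<longlongrightarrow> ereal (Lbar h)) (at_right 0)))"

lemma limit_event: "limit_event \<in> sets P" "measure P limit_event = 1"
  "\<omega> \<in> limit_event \<Longrightarrow> k \<in> carrier T \<Longrightarrow> h \<in> Rb b \<Longrightarrow>
     ((\<lambda>\<epsilon>. min_action A (metric_lagrangian g) \<epsilon> (act (\<iota> (\<one>\<^bsub>Zb b\<^esub>, k)) x) (act (\<iota> (\<Phi> \<epsilon> h, k)) x) 1 \<omega>)
              \<longlongrightarrow> ereal (Lbar h)) (at_right 0)"
proof -
  have "\<exists>E. E \<in> sets P \<and> measure P E = 1 \<and>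
        (\<forall>\<omega>\<in>E. \<forall>x. \<forall>k\<in>carrier T. \<forall>h\<in>Rb b.
           ((\<lambda>\<epsilon>. min_action A (metric_lagrangian g) \<epsilon> (act (\<iota> (\<one>\<^bsub>Zb b\<^esub>, k)) x) (act (\<iota> (\<Phi> \<epsilon> h, k)) x) 1 \<omega>)
              \<longlongrightarrow> ereal (Lbar h)) (at_right 0))"
    using eff unfolding effective_lagrangian_def by (simp only: Bex_def conj_assoc)
  from someI_ex[OF this] show "limit_event \<in> sets P" "measure P limit_event = 1"
    "\<omega> \<in> limit_event \<Longrightarrow> k \<in> carrier T \<Longrightarrow> h \<in> Rb b \<Longrightarrow>
     ((\<lambda>\<epsilon>. min_action A (metric_lagrangian g) \<epsilon> (act (\<iota> (\<one>\<^bsub>Zb b\<^esub>, k)) x) (act (\<iota> (\<Phi> \<epsilon> h, k)) x) 1 \<omega>)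
              \<longlongrightarrow> ereal (Lbar h)) (at_right 0)"
    unfolding limit_event_def by blast+
qed

lemma limit_event_space: "\<omega> \<in> limit_event \<Longrightarrow> \<omega> \<in> space P"
  using sets.sets_into_space[OF limit_event(1)] by blast

abbreviation N :: "(nat \<Rightarrow> real) \<Rightarrow> real" where "N \<equiv> stable_norm Lbar"

lemma rdist_limit_\<Phi>:
  assumes \<omega>: "\<omega> \<in> limit_event" and h: "h \<in> Rb b"
  shows "((\<lambda>\<epsilon>. \<epsilon> * rdist (\<Phi> \<epsilon> h) \<omega>) \<longlongrightarrow> N h) (at_right 0)"
proof -
  interpret T: group T by (rule T)
  have \<omega>': "\<omega> \<in> space P" by (rule limit_event_space[OF \<omega>])
  have one: "\<iota> (\<one>\<^bsub>Zb b\<^esub>, \<one>\<^bsub>T\<^esub>) = \<one>\<^bsub>G\<^esub>"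
    using shift_zero by (simp add: shift_def one_product_group)
  have ev: "\<forall>\<^sub>F \<epsilon> in at_right 0. (0::real) < \<epsilon>" by (simp add: eventually_at_right_less)
  have "\<forall>\<^sub>F \<epsilon> in at_right 0. min_action A (metric_lagrangian g) \<epsilon> (act (\<iota> (\<one>\<^bsub>Zb b\<^esub>, \<one>\<^bsub>T\<^esub>)) x0)
      (act (\<iota> (\<Phi> \<epsilon> h, \<one>\<^bsub>T\<^esub>)) x0) 1 \<omega> = ereal ((\<epsilon> * rdist (\<Phi> \<epsilon> h) \<omega>)\<^sup>2)"
    using ev
  proof eventually_elim
    case (elim \<epsilon>)
    have \<Phi>: "\<Phi> \<epsilon> h \<in> carrier (Zb b)" using lat elim h unfolding lattice_approximation_def by blast
    show ?case
      by (simp only: min_action_eq[of g \<omega> \<epsilon>, OF g[OF \<omega>'] elim] one act_one rdist_def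
          shift_carrier[OF \<Phi>] power_mult_distrib)
  qed
  from Lim_transform_eventually[OF limit_event(3)[OF \<omega> T.one_closed h] this]
  have "((\<lambda>\<epsilon>. ereal ((\<epsilon> * rdist (\<Phi> \<epsilon> h) \<omega>)\<^sup>2)) \<longlongrightarrow> ereal (Lbar h)) (at_right 0)" .
  then have "((\<lambda>\<epsilon>. (\<epsilon> * rdist (\<Phi> \<epsilon> h) \<omega>)\<^sup>2) \<longlongrightarrow> Lbar h) (at_right 0)" by simp
  then have "((\<lambda>\<epsilon>. sqrt ((\<epsilon> * rdist (\<Phi> \<epsilon> h) \<omega>)\<^sup>2)) \<longlongrightarrow> sqrt (Lbar h)) (at_right 0)"
    by (rule tendsto_real_sqrt)
  moreover have "\<forall>\<^sub>F \<epsilon> in at_right 0. sqrt ((\<epsilon> * rdist (\<Phi> \<epsilon> h) \<omega>)\<^sup>2) = \<epsilon> * rdist (\<Phi> \<epsilon> h) \<omega>"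
    using ev by eventually_elim (simp add: rdist_nonneg)
  ultimately show ?thesis
    unfolding stable_norm_def by (rule Lim_transform_eventually)
qed

text \<open>Lattice points at distance \<open>o(1 / \<epsilon>)\<close> from each other have scaled distances with the same limit, so
  that \<open>\<Phi>\<close> may be replaced by any other approximation, along any sequence of scales.\<close>

lemma rdist_limit:
  assumes \<omega>: "\<omega> \<in> limit_event" and h: "h \<in> Rb b" and e: "\<And>j. 0 < e j" "e \<longlonglongrightarrow> 0"
    and n: "\<And>i. i < b \<Longrightarrow> (\<lambda>j. e j * real_of_int (n j i)) \<longlonglongrightarrow> h i"
  shows "(\<lambda>j. e j * rdist (n j) \<omega>) \<longlonglongrightarrow> N h"
proof -
  have fl: "filterlim e (at_right 0) sequentially"
    unfolding filterlim_at using e(2) by (simp add: e(1) less_imp_neq[OF e(1), symmetric])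
  have 1: "(\<lambda>j. e j * rdist (\<Phi> (e j) h) \<omega>) \<longlonglongrightarrow> N h"
    by (rule filterlim_compose[OF rdist_limit_\<Phi>[OF \<omega> h] fl])
  have Cf: "(\<lambda>j. Cf (e j)) \<longlonglongrightarrow> 0"
    using lat fl unfolding lattice_approximation_def by (blast intro: filterlim_compose)
  have \<Phi>: "(\<lambda>j. e j * real_of_int (\<Phi> (e j) h i) - h i) \<longlonglongrightarrow> 0" if i: "i < b" for i
  proof (rule Lim_null_comparison[OF _ Cf], rule always_eventually, rule allI)
    fix j
    have "\<bar>e j * real_of_int (\<Phi> (e j) h i) - h i\<bar> \<le> L2_set (\<lambda>i. \<bar>e j * real_of_int (\<Phi> (e j) h i) - h i\<bar>) {..<b}"
      by (rule member_le_L2_set) (use i in auto)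
    also have "\<dots> = L2_set (\<lambda>i. e j * real_of_int (\<Phi> (e j) h i) - h i) {..<b}"
      by (simp add: L2_set_def)
    also have "\<dots> \<le> Cf (e j)" using lat e(1)[of j] h unfolding lattice_approximation_def by blast
    finally show "norm (e j * real_of_int (\<Phi> (e j) h i) - h i) \<le> Cf (e j)" by simp
  qed
  have "(\<lambda>j. distortion * (\<Sum>i<b. \<bar>(e j * real_of_int (\<Phi> (e j) h i) - h i) - (e j * real_of_int (n j i) - h i)\<bar> * disp (unit i))) \<longlonglongrightarrow>
     distortion * (\<Sum>i<b. \<bar>0 - (h i - h i)\<bar> * disp (unit i))"
    by (intro tendsto_intros \<Phi> n) auto
  then have lim0: "(\<lambda>j. distortion * (\<Sum>i<b. \<bar>(e j * real_of_int (\<Phi> (e j) h i) - h i) - (e j * real_of_int (n j i) - h i)\<bar> * disp (unit i))) \<longlonglongrightarrow> 0"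
    by simp
  have 2: "(\<lambda>j. e j * rdist (n j) \<omega> - e j * rdist (\<Phi> (e j) h) \<omega>) \<longlonglongrightarrow> 0"
  proof (rule Lim_null_comparison[OF _ lim0], rule always_eventually, rule allI)
    fix j
    have "norm (e j * rdist (n j) \<omega> - e j * rdist (\<Phi> (e j) h) \<omega>) = e j * \<bar>rdist (n j) \<omega> - rdist (\<Phi> (e j) h) \<omega>\<bar>"
      using e(1)[of j] by (simp add: right_diff_distrib[symmetric] abs_mult)
    also have "\<dots> \<le> e j * (distortion * (\<Sum>i<b. real_of_int \<bar>\<Phi> (e j) h i - n j i\<bar> * disp (unit i)))"
      using e(1)[of j] by (intro mult_left_mono rdist_lipschitz limit_event_space \<omega>) auto
    also have "\<dots> = distortion * (\<Sum>i<b. \<bar>(e j * real_of_int (\<Phi> (e j) h i) - h i) - (e j * real_of_int (n j i) - h i)\<bar> * disp (unit i))"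
    proof -
      have "\<bar>(e j * real_of_int (\<Phi> (e j) h i) - h i) - (e j * real_of_int (n j i) - h i)\<bar> =
          e j * real_of_int \<bar>\<Phi> (e j) h i - n j i\<bar>" for i
        using e(1)[of j] by (simp add: right_diff_distrib[symmetric] abs_mult)
      then show ?thesis by (simp add: sum_distrib_left mult.assoc mult.left_commute)
    qed
    finally show "norm (e j * rdist (n j) \<omega> - e j * rdist (\<Phi> (e j) h) \<omega>) \<le>
      distortion * (\<Sum>i<b. \<bar>(e j * real_of_int (\<Phi> (e j) h i) - h i) - (e j * real_of_int (n j i) - h i)\<bar> * disp (unit i))" .
  qed
  show ?thesis using tendsto_add[OF 1 2] by simp
qed

definition scale :: "nat \<Rightarrow> real" where "scale j = inverse (real (Suc j))"

definition approx :: "(nat \<Rightarrow> real) \<Rightarrow> nat \<Rightarrow> nat \<Rightarrow> int" where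
  "approx h j i = \<lfloor>real (Suc j) * h i\<rfloor>"

lemma scale: "0 < scale j" "scale \<longlonglongrightarrow> 0"
  unfolding scale_def[abs_def] by (simp, rule LIMSEQ_inverse_real_of_nat)

lemma approx_limit: "(\<lambda>j. scale j * real_of_int (approx h j i)) \<longlonglongrightarrow> h i"
proof -
  have "(\<lambda>j. scale j * real_of_int (approx h j i) - h i) \<longlonglongrightarrow> 0"
  proof (rule Lim_null_comparison[OF _ scale(2)], rule always_eventually, rule allI)
    fix j
    have "real_of_int (approx h j i) \<le> real (Suc j) * h i" "real (Suc j) * h i \<le> real_of_int (approx h j i) + 1"
      unfolding approx_def by linarith+
    then have "\<bar>real_of_int (approx h j i) - real (Suc j) * h i\<bar> \<le> 1" by linarith
    then have "scale j * \<bar>real_of_int (approx h j i) - real (Suc j) * h i\<bar> \<le> scale j * 1"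
      using scale(1)[of j] by (intro mult_left_mono) auto
    moreover have "norm (scale j * real_of_int (approx h j i) - h i) = scale j * \<bar>real_of_int (approx h j i) - real (Suc j) * h i\<bar>"
    proof -
      have "h i = scale j * (real (Suc j) * h i)" by (simp add: scale_def)
      then have "scale j * real_of_int (approx h j i) - h i = scale j * (real_of_int (approx h j i) - real (Suc j) * h i)"
        by (simp only: right_diff_distrib)
      then show ?thesis using scale(1)[of j] by (simp add: abs_mult)
    qed
    ultimately show "norm (scale j * real_of_int (approx h j i) - h i) \<le> scale j" by simp
  qed
  then show ?thesis by (simp add: LIM_zero_cancel)
qed

lemma rdist_limit_approx:
  assumes "\<omega> \<in> limit_event" "h \<in> Rb b"
  shows "(\<lambda>j. scale j * rdist (approx h j) \<omega>) \<longlonglongrightarrow> N h"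
  by (rule rdist_limit[OF assms]) (rule scale approx_limit)+

lemma limit_event_nonempty: obtains \<omega> where "\<omega> \<in> limit_event"
  using limit_event(2) by fastforce

lemma N_nonneg:
  assumes h: "h \<in> Rb b"
  shows "0 \<le> N h"
proof -
  obtain \<omega> where \<omega>: "\<omega> \<in> limit_event" by (rule limit_event_nonempty)
  have "(\<lambda>j. scale j * rdist (approx h j) \<omega>) \<longlonglongrightarrow> N h"
    by (rule rdist_limit_approx[OF \<omega> h])
  then show ?thesis by (rule LIMSEQ_le_const) (use scale(1) rdist_nonneg in \<open>auto intro!: mult_nonneg_nonneg simp: less_imp_le\<close>)
qed

lemma N_zero: "N (\<lambda>_. 0) = 0"
proof -
  obtain \<omega> where \<omega>: "\<omega> \<in> limit_event" by (rule limit_event_nonempty)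
  have "(\<lambda>j. scale j * rdist (\<lambda>_. 0) \<omega>) \<longlonglongrightarrow> N (\<lambda>_. 0)"
    by (rule rdist_limit[OF \<omega> _ scale]) auto
  moreover have "rdist (\<lambda>_. 0) \<omega> = 0"
    using energy_dist_refl[OF g[OF limit_event_space[OF \<omega>]]] by (simp add: rdist_def shift_zero act_one)
  ultimately show ?thesis by (simp add: LIMSEQ_const_iff)
qed

text \<open>The approximations of \<open>h\<close> at the scales \<open>\<epsilon>\<^sub>j\<close> are approximations of \<open>r h\<close> at the scales \<open>r \<epsilon>\<^sub>j\<close>.\<close>

lemma N_pos_scale:
  assumes h: "h \<in> Rb b" and r: "0 < r"
  shows "N (\<lambda>i. r * h i) = r * N h"
proof -
  obtain \<omega> where \<omega>: "\<omega> \<in> limit_event" by (rule limit_event_nonempty)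
  have "(\<lambda>j. (r * scale j) * rdist (approx h j) \<omega>) \<longlonglongrightarrow> N (\<lambda>i. r * h i)"
  proof (rule rdist_limit[OF \<omega>])
    show "(\<lambda>i. r * h i) \<in> Rb b" using h by simp
    show "0 < r * scale j" for j using r scale(1) by simp
    show "(\<lambda>j. r * scale j) \<longlonglongrightarrow> 0" using tendsto_mult_right_zero[OF scale(2), of r] .
    show "(\<lambda>j. r * scale j * real_of_int (approx h j i)) \<longlonglongrightarrow> r * h i" for i
      using tendsto_mult_left[OF approx_limit[of h i], of r] by (simp add: mult.assoc)
  qed
  moreover have "(\<lambda>j. r * (scale j * rdist (approx h j) \<omega>)) \<longlonglongrightarrow> r * N h"
    by (intro tendsto_mult_left rdist_limit_approx[OF \<omega> h])
  ultimately show ?thesis by (simp add: LIMSEQ_unique mult.assoc)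
qed

text \<open>The coordinates of a lattice point are bounded by the distance to which it displaces, and both
  scale alike.\<close>

lemma N_definite:
  assumes h: "h \<in> Rb b" and N0: "N h = 0"
  shows "h = (\<lambda>_. 0)"
proof
  fix i
  show "h i = 0"
  proof (cases "i < b")
    case True
    obtain \<omega> where \<omega>: "\<omega> \<in> limit_event" by (rule limit_event_nonempty)
    obtain B \<delta> where B: "0 \<le> B" "0 < \<delta>"
      "\<And>x a. a \<in> carrier G \<Longrightarrow> real_of_int \<bar>coord i a\<bar> \<le> B * (energy_dist g0 x (act a x) / \<delta> + 1)"
      using displacement_bound[of "coord i", OF coord_mult[OF True]] by blast
    have le: "\<bar>scale j * real_of_int (approx h j i)\<bar> \<le> B * (distortion / \<delta> * (scale j * rdist (approx h j) \<omega>) + scale j)" for j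
    proof -
      have "real_of_int \<bar>approx h j i\<bar> \<le> B * (energy_dist g0 x0 (act (shift (approx h j)) x0) / \<delta> + 1)"
        using B(3)[OF shift_closed, of "approx h j" x0] coord_shift[OF True, of "approx h j"] by simp
      also have "\<dots> \<le> B * (distortion * rdist (approx h j) \<omega> / \<delta> + 1)"
        using energy_dist_lower[OF limit_event_space[OF \<omega>], of x0 "act (shift (approx h j)) x0"] B(1,2)
        by (intro mult_left_mono add_right_mono divide_right_mono) (auto simp: rdist_def)
      finally have "scale j * real_of_int \<bar>approx h j i\<bar> \<le> scale j * (B * (distortion * rdist (approx h j) \<omega> / \<delta> + 1))"
        using scale(1)[of j] by (intro mult_left_mono) auto
      then show ?thesis using scale(1)[of j] by (simp add: abs_mult algebra_simps)
    qed
    have "(\<lambda>j. B * (distortion / \<delta> * (scale j * rdist (approx h j) \<omega>) + scale j)) \<longlonglongrightarrow> B * (distortion / \<delta> * N h + 0)"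
      by (intro tendsto_intros rdist_limit_approx[OF \<omega> h] scale)
    then have "(\<lambda>j. B * (distortion / \<delta> * (scale j * rdist (approx h j) \<omega>) + scale j)) \<longlonglongrightarrow> 0" by (simp add: N0)
    then have "(\<lambda>j. scale j * real_of_int (approx h j i)) \<longlonglongrightarrow> 0"
      by (rule Lim_null_comparison[rotated]) (use le in \<open>auto intro!: always_eventually\<close>)
    then show ?thesis using approx_limit LIMSEQ_unique by blast
  next
    case False
    then show ?thesis using h by simp
  qed
qed

text \<open>Almost sure convergence implies convergence in probability, by dominated convergence.\<close>

lemma bad_event_small:
  assumes h: "h \<in> Rb b" and \<eta>: "0 < \<eta>"
    and n: "\<And>i. i < b \<Longrightarrow> (\<lambda>j. scale j * real_of_int (n j i)) \<longlonglongrightarrow> h i"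
  shows "(\<lambda>j. measure P {\<omega>\<in>space P. \<eta> \<le> \<bar>scale j * rdist (n j) \<omega> - N h\<bar>}) \<longlonglongrightarrow> 0"
proof -
  define S where "S j = {\<omega>\<in>space P. \<eta> \<le> \<bar>scale j * rdist (n j) \<omega> - N h\<bar>}" for j
  have S: "S j \<in> sets P" for j
  proof -
    note rdist_measurable[measurable]
    show ?thesis unfolding S_def by measurable
  qed
  have "(\<lambda>j. \<integral>\<omega>. indicator (S j) \<omega> \<partial>P) \<longlonglongrightarrow> (\<integral>\<omega>. (0::real) \<partial>P)"
  proof (rule integral_dominated_convergence[where w = "\<lambda>_. 1"])
    have "AE \<omega> in P. \<omega> \<in> limit_event" by (rule P.AE_prob_1[OF limit_event(2)])
    then show "AE \<omega> in P. (\<lambda>j. indicator (S j) \<omega>) \<longlonglongrightarrow> (0::real)"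
    proof eventually_elim
      case (elim \<omega>)
      have "(\<lambda>j. scale j * rdist (n j) \<omega>) \<longlonglongrightarrow> N h" by (rule rdist_limit[OF elim h scale n])
      then have "\<forall>\<^sub>F j in sequentially. dist (scale j * rdist (n j) \<omega>) (N h) < \<eta>" using \<eta> by (rule tendstoD)
      then have "\<forall>\<^sub>F j in sequentially. indicator (S j) \<omega> = (0::real)"
        by eventually_elim (auto simp: S_def dist_real_def indicator_def)
      then show ?case by (rule tendsto_eventually)
    qed
  qed (use S in \<open>auto simp: indicator_def\<close>)
  then show ?thesis using S by (simp add: S_def)
qed

text \<open>Convergence in probability survives a shift of the sample point, so that for some large
  scale three approximations hold simultaneously, one of them at a shifted sample point.\<close>

lemma common_sample:
  assumes h: "h1 \<in> Rb b" "h2 \<in> Rb b" "h3 \<in> Rb b" and \<eta>: "0 < \<eta>"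
    and n1: "\<And>i. i < b \<Longrightarrow> (\<lambda>j. scale j * real_of_int (n1 j i)) \<longlonglongrightarrow> h1 i"
    and n2: "\<And>i. i < b \<Longrightarrow> (\<lambda>j. scale j * real_of_int (n2 j i)) \<longlonglongrightarrow> h2 i"
    and n3: "\<And>i. i < b \<Longrightarrow> (\<lambda>j. scale j * real_of_int (n3 j i)) \<longlonglongrightarrow> h3 i"
    and a: "\<And>j. a j \<in> carrier G"
  obtains j \<omega> where "\<omega> \<in> space P" "\<bar>scale j * rdist (n1 j) \<omega> - N h1\<bar> < \<eta>"
    "\<bar>scale j * rdist (n2 j) \<omega> - N h2\<bar> < \<eta>" "\<bar>scale j * rdist (n3 j) (\<tau> (a j) \<omega>) - N h3\<bar> < \<eta>"
proof -
  define S where "S n h' j = {\<omega>\<in>space P. \<eta> \<le> \<bar>scale j * rdist (n j) \<omega> - N h'\<bar>}" for n h' j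
  have S: "S n h' j \<in> sets P" for n h' j
  proof -
    note rdist_measurable[measurable]
    show ?thesis unfolding S_def by measurable
  qed
  have small: "\<forall>\<^sub>F j in sequentially. measure P (S n h' j) < 1 / 3"
    if "h' \<in> Rb b" "\<And>i. i < b \<Longrightarrow> (\<lambda>j. scale j * real_of_int (n j i)) \<longlonglongrightarrow> h' i" for n h'
    using order_tendstoD(2)[OF bad_event_small[OF that(1) \<eta> that(2)], of "1 / 3"] by (simp add: S_def)
  have "\<forall>\<^sub>F j in sequentially. measure P (S n1 h1 j) < 1 / 3 \<and> measure P (S n2 h2 j) < 1 / 3 \<and> measure P (S n3 h3 j) < 1 / 3"
    by (intro eventually_conj small h n1 n2 n3)
  then obtain j where j: "measure P (S n1 h1 j) < 1 / 3" "measure P (S n2 h2 j) < 1 / 3" "measure P (S n3 h3 j) < 1 / 3"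
    using eventually_happens'[OF sequentially_bot] by blast
  let ?pre = "\<tau> (a j) -` S n3 h3 j \<inter> space P"
  have meas: "\<tau> (a j) \<in> measurable P P" using ds a unfolding dynamical_system_def by blast
  have pre: "?pre \<in> sets P" by (rule measurable_sets[OF meas S])
  have "measure P ?pre < 1 / 3" using dynamical_system_preimage[OF ds grp P a S] j(3) by simp
  moreover have "measure P (S n1 h1 j \<union> S n2 h2 j \<union> ?pre) \<le> measure P (S n1 h1 j) + measure P (S n2 h2 j) + measure P ?pre"
    using measure_Un_le[of "S n1 h1 j \<union> S n2 h2 j" P ?pre] measure_Un_le[of "S n1 h1 j" P "S n2 h2 j"] S pre by simp
  ultimately have "measure P (S n1 h1 j \<union> S n2 h2 j \<union> ?pre) < 1" using j by linarith
  then have "S n1 h1 j \<union> S n2 h2 j \<union> ?pre \<noteq> space P" using P.prob_space by auto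
  moreover have "S n1 h1 j \<union> S n2 h2 j \<union> ?pre \<subseteq> space P" by (auto simp: S_def)
  ultimately obtain \<omega> where \<omega>: "\<omega> \<in> space P" "\<omega> \<notin> S n1 h1 j" "\<omega> \<notin> S n2 h2 j" "\<omega> \<notin> ?pre" by blast
  have "\<tau> (a j) \<omega> \<in> space P" by (rule tau_space[OF a \<omega>(1)])
  then show thesis using that[OF \<omega>(1), of j] \<omega> by (simp add: S_def)
qed

text \<open>The way from \<open>x\<close> to \<open>(-n) x\<close> is the reversed way from \<open>x\<close> to \<open>n x\<close>, seen from the sample point shifted
  by \<open>-n\<close>.\<close>

lemma N_minus_le:
  assumes h: "h \<in> Rb b"
  shows "N (\<lambda>i. - h i) \<le> N h"
proof (rule field_le_epsilon)
  fix \<eta> :: real assume \<eta>: "0 < \<eta>"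
  have h': "(\<lambda>i. - h i) \<in> Rb b" using h by simp
  have lim: "(\<lambda>j. scale j * real_of_int (- approx h j i)) \<longlonglongrightarrow> - h i" for i
    using tendsto_minus[OF approx_limit[of h i]] by simp
  obtain j \<omega> where \<omega>: "\<omega> \<in> space P"
    and 1: "\<bar>scale j * rdist (\<lambda>i. - approx h j i) \<omega> - N (\<lambda>i. - h i)\<bar> < \<eta> / 2"
    and 3: "\<bar>scale j * rdist (approx h j) (\<tau> (shift (\<lambda>i. - approx h j i)) \<omega>) - N h\<bar> < \<eta> / 2"
    by (rule common_sample[OF h' h' h half_gt_zero[OF \<eta>] lim lim approx_limit[of h] shift_closed[of "\<lambda>i. - approx h _ i"]]) blast
  have "rdist (approx h j) (\<tau> (shift (\<lambda>i. - approx h j i)) \<omega>) = rdist (\<lambda>i. - approx h j i) \<omega>"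
    using rdist_tau[OF \<omega>, of "approx h j" "\<lambda>i. - approx h j i"] energy_dist_sym[OF g[OF \<omega>]]
    by (simp add: rdist_def shift_zero act_one)
  then have "\<bar>scale j * rdist (\<lambda>i. - approx h j i) \<omega> - N h\<bar> < \<eta> / 2" using 3 by simp
  then show "N (\<lambda>i. - h i) \<le> N h + \<eta>" using 1 by linarith
qed

lemma N_minus:
  assumes h: "h \<in> Rb b"
  shows "N (\<lambda>i. - h i) = N h"
  using N_minus_le[OF h] N_minus_le[of "\<lambda>i. - h i"] h by simp

text \<open>The second leg of the way from \<open>x\<close> over \<open>n x\<close> to \<open>(n + m) x\<close> is the way from \<open>x\<close> to \<open>m x\<close> at the sample
  point shifted by \<open>n\<close>.\<close>

lemma N_triangle:
  assumes h: "h \<in> Rb b" "h' \<in> Rb b"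
  shows "N (\<lambda>i. h i + h' i) \<le> N h + N h'"
proof (rule field_le_epsilon)
  fix \<eta> :: real assume \<eta>: "0 < \<eta>"
  then have \<eta>': "0 < \<eta> / 3" by simp
  have hh: "(\<lambda>i. h i + h' i) \<in> Rb b" using h by simp
  have lim: "(\<lambda>j. scale j * real_of_int (approx h j i + approx h' j i)) \<longlonglongrightarrow> h i + h' i" for i
    using tendsto_add[OF approx_limit[of h i] approx_limit[of h' i]] by (simp add: distrib_left)
  obtain j \<omega> where \<omega>: "\<omega> \<in> space P"
    and 1: "\<bar>scale j * rdist (\<lambda>i. approx h j i + approx h' j i) \<omega> - N (\<lambda>i. h i + h' i)\<bar> < \<eta> / 3"
    and 2: "\<bar>scale j * rdist (approx h j) \<omega> - N h\<bar> < \<eta> / 3"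
    and 3: "\<bar>scale j * rdist (approx h' j) (\<tau> (shift (approx h j)) \<omega>) - N h'\<bar> < \<eta> / 3"
    by (rule common_sample[OF hh h \<eta>' lim approx_limit[of h] approx_limit[of h'] shift_closed[of "approx h _"]]) blast
  have "rdist (\<lambda>i. approx h j i + approx h' j i) \<omega> \<le>
     rdist (approx h j) \<omega> + rdist (approx h' j) (\<tau> (shift (approx h j)) \<omega>)"
    unfolding rdist_tau[OF \<omega>] using energy_dist_triangle[OF g[OF \<omega>]] by (simp add: rdist_def)
  then have "scale j * rdist (\<lambda>i. approx h j i + approx h' j i) \<omega> \<le>
     scale j * rdist (approx h j) \<omega> + scale j * rdist (approx h' j) (\<tau> (shift (approx h j)) \<omega>)"
    using scale(1)[of j] by (simp add: distrib_left[symmetric])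
  then show "N (\<lambda>i. h i + h' i) \<le> N h + N h' + \<eta>" using 1 2 3 by linarith
qed

theorem stable_norm_is_norm: "is_norm_on (Rb b) N"
  unfolding is_norm_on_def
proof (intro conjI ballI allI)
  fix h r assume h: "h \<in> Rb b"
  show "0 \<le> N h" by (rule N_nonneg[OF h])
  show "N h = 0 \<longleftrightarrow> h = (\<lambda>_. 0)" using N_definite[OF h] N_zero by blast
  show "N (\<lambda>i. r * h i) = \<bar>r\<bar> * N h"
  proof (cases r "0::real" rule: linorder_cases)
    case less
    have "N (\<lambda>i. r * h i) = N (\<lambda>i. - (- r * h i))" by simp
    also have "\<dots> = N (\<lambda>i. - r * h i)" by (rule N_minus) (use h in simp)
    also have "\<dots> = - r * N h" by (rule N_pos_scale[OF h]) (use less in simp)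
    finally show ?thesis using less by simp
  next
    case equal
    then show ?thesis using N_zero by simp
  next
    case greater
    then show ?thesis using N_pos_scale[OF h greater] by simp
  qed
next
  fix h h' assume "h \<in> Rb b" "h' \<in> Rb b"
  then show "N (\<lambda>i. h i + h' i) \<le> N h + N h'" by (rule N_triangle)
qed

end

theorem mainTheorem3:
  fixes A :: "('m::{t2_space,second_countable_topology}, 'e::real_inner) chart set"
    and g0 :: "('m, 'e) metric"
    and G :: "('g, 'z) monoid_scheme" and T :: "('k, 'y) monoid_scheme"
    and \<iota> :: "(nat \<Rightarrow> int) \<times> 'k \<Rightarrow> 'g" and b :: nat
    and act :: "'g \<Rightarrow> 'm \<Rightarrow> 'm" and TG :: "'g topology"
    and P :: "'w measure" and \<tau> :: "'g \<Rightarrow> 'w \<Rightarrow> 'w"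
    and g :: "'w \<Rightarrow> ('m, 'e) metric"
    and \<Phi> :: "real \<Rightarrow> (nat \<Rightarrow> real) \<Rightarrow> nat \<Rightarrow> int" and C :: "real \<Rightarrow> real"
    and Lbar :: "(nat \<Rightarrow> real) \<Rightarrow> real"
  assumes "smooth_atlas A" and "connected (UNIV :: 'm set)"
    and "riemannian_metric A g0" and "complete_metric A g0"
    and "comm_group G" and "group T" and "finite (carrier T)"
    and "\<iota> \<in> iso (Zb b \<times>\<times> T) G"
    and "group_action G UNIV act"
    and "\<forall>a\<in>carrier G. riemannian_isometry A g0 (act a)"
    and "free_action G act" and "totally_discontinuous G act" and "cocompact_action G act"
    and "prob_space P" and "topspace TG = carrier G"
    and "dynamical_system G TG P \<tau>" and "ergodic_system G P \<tau>"
    and "\<forall>\<omega>\<in>space P. riemannian_metric A (g \<omega>)"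
    and "continuous_random_metric A P g"
    and "superlinear_bounds A g0 P g"
    and "stationary_metric A G act P \<tau> g"
    and "lattice_approximation b \<Phi> C"
    and "effective_lagrangian A b T \<iota> act P \<Phi> (metric_lagrangian g) Lbar"
  shows "is_norm_on (Rb b) (stable_norm Lbar)"
proof -
  have conn: "connected_manifold A"
    using assms(1,2) by (simp add: connected_manifold_def smooth_manifold_def connected_manifold_axioms_def)
  have "group G" using assms(5) by (simp add: comm_group_def)
  then have "cocompact_isometric_action A g0 G act"
    using conn assms(3,9-13)
    by (simp add: cocompact_isometric_action_def cocompact_isometric_action_axioms_def)
  then have "stationary_metric_setting A g0 G act T \<iota> b TG P \<tau> g \<Phi> C Lbar"
    using assms(6,8,14,16,18-23)
    by (simp add: stationary_metric_setting_def stationary_metric_setting_axioms_def)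
  then show ?thesis by (rule stationary_metric_setting.stable_norm_is_norm)
qed

end
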